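(* In the diffusion setting described in the context, for every $0<c<1$, the pseudometric $\ell^c$ is a fixpoint of $\mathcal{G}_c$: $\ell^c=\mathcal{G}_c(\ell^c)$.
   Context: Setting (diffusion). Let $E$ be a locally compact Hausdorff space with a countable base, with its Borel $\sigma$-algebra; $E$ is Polish and $\Delta$ is a fixed 1-bounded metric generating its topology $\mathcal{O}$. Let $(\hat P_t)_{t\ge 0}$ be an honest Feller–Dynkin semigroup on $C_0(E)$ with associated Markov (probability) kernels $P_t(x,\cdot)$. It is assumed to be a diffusion: the trajectory space is $\Omega=\{\omega:[0,\infty)\to E \text{ continuous}\}$ with the $\sigma$-algebra generated by evaluations and the topology generated by the uniform metric $U(\Delta)(\omega,\omega')=\sup_{t\ge0}\Delta(\omega(t),\omega'(t))$ (treated as Polish); for each $x\in E$, $\mathbb{P}^x$ is the law on $\Omega$ of the process started at $x$; and $x\mapsto\mathbb{P}^x$ is weakly continuous. A continuous observable $obs:E\to[0,1]$ is given. Optimal transport: $W(c)(\mu,\nu)=\min_{\gamma\in\Gamma(\mu,\nu)}\int c\,\mathrm{d}\gamma$ over couplings, for lower semi-continuous cost $c$ with values in $[0,1]$ vanishing on the diagonal. For a 1-bounded lower semi-continuous pseudometric $m$ on $E$: $U_c(m)(\omega,\omega')=\sup_{t\ge0}c^tm(\omega(t),\omega'(t))$, $\mathcal{G}_c(m)(x,y)=W(U_c(m))(\mathbb{P}^x,\mathbb{P}^y)$. Logic: $f\in\mathcal{L}_\sigma::= q\mid obs\mid 1-f\mid \int g$ and $g\in\mathcal{L}_\tau::=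 f\circ ev_t\mid \min\{g_1,g_2\}\mid\max\{g_1,g_2\}\mid g\ominus q\mid g\oplus q$, with $q\in\mathbb{Q}\cap[0,1]$, $t\in\mathbb{Q}_{\ge0}$. Interpretation (for the fixed $c$): $\mathcal{L}_\sigma$ as functions $E\to[0,1]$ with $q(x)=q$, $obs(x)$, $(1-f)(x)=1-f(x)$, $(\int g)(x)=\int g\,\mathrm{d}\mathbb{P}^x$; $\mathcal{L}_\tau$ as functions $\Omega\to[0,1]$ with $(f\circ ev_t)(\omega)=c^tf(\omega(t))$, pointwise min/max, $(g\ominus q)(\omega)=\max\{0,g(\omega)-q\}$, $(g\oplus q)(\omega)=\min\{1,g(\omega)+q\}$. Define $\ell^c(x,y)=\sup_{f\in\mathcal{L}_\sigma}|f(x)-f(y)|$. *)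

theory Defs
  imports "HOL-Probability.Probability"
begin

section \<open>Feller--Dynkin semigroups\<close>

definition C0 :: "('e::topological_space \<Rightarrow> real) set" where
  "C0 = {f. continuous_on UNIV f \<and> (\<forall>\<epsilon>>0. \<exists>K. compact K \<and> (\<forall>x. x \<notin> K \<longrightarrow> \<bar>f x\<bar> < \<epsilon>))}"

text \<open>Boundedness of the operators need not be required: linearity and the second condition make
  every \<^term>\<open>T t\<close> a contraction for the supremum norm. The last condition is strong continuity.\<close>

definition feller_dynkin_semigroup ::
    "(real \<Rightarrow> ('e::topological_space \<Rightarrow> real) \<Rightarrow> ('e \<Rightarrow> real)) \<Rightarrow> bool" where
  "feller_dynkin_semigroup T \<longleftrightarrow>
     (\<forall>t\<ge>0. \<forall>f\<in>C0. T t f \<in> C0) \<and>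
     (\<forall>t\<ge>0. \<forall>f\<in>C0. (\<forall>x. 0 \<le> f x \<and> f x \<le> 1) \<longrightarrow> (\<forall>x. 0 \<le> T t f x \<and> T t f x \<le> 1)) \<and>
     (\<forall>t\<ge>0. \<forall>f\<in>C0. \<forall>g\<in>C0. \<forall>a b. T t (\<lambda>x. a * f x + b * g x) = (\<lambda>x. a * T t f x + b * T t g x)) \<and>
     (\<forall>f\<in>C0. T 0 f = f) \<and>
     (\<forall>s\<ge>0. \<forall>t\<ge>0. \<forall>f\<in>C0. T (s + t) f = T s (T t f)) \<and>
     (\<forall>f\<in>C0. uniform_limit UNIV (\<lambda>t. T t f) f (at_right 0))"

text \<open>The sub-Markov kernels that the Riesz representation theorem attaches to the semigroup; it is
  honest if no mass is lost.\<close>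

definition associated_kernels ::
    "(real \<Rightarrow> ('e::topological_space \<Rightarrow> real) \<Rightarrow> ('e \<Rightarrow> real)) \<Rightarrow> (real \<Rightarrow> 'e \<Rightarrow> 'e measure) \<Rightarrow> bool" where
  "associated_kernels T P \<longleftrightarrow>
     (\<forall>t\<ge>0. P t \<in> borel \<rightarrow>\<^sub>M subprob_algebra borel) \<and>
     (\<forall>t\<ge>0. \<forall>f\<in>C0. \<forall>x. T t f x = (\<integral>y. f y \<partial>(P t x)))"

definition honest :: "(real \<Rightarrow> 'e \<Rightarrow> 'e measure) \<Rightarrow> bool" where
  "honest P \<longleftrightarrow> (\<forall>t\<ge>0. \<forall>x. prob_space (P t x))"

section \<open>Trajectories\<close>

text \<open>A trajectory on \<open>[0, \<infinity>)\<close> is encoded as a function on the reals with the value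
  \<^term>\<open>undefined\<close> at negative times.\<close>

definition trajectories :: "(real \<Rightarrow> 'e::topological_space) set" where
  "trajectories = {\<omega> \<in> extensional {0..}. continuous_on {0..} \<omega>}"

definition trajectory_space :: "(real \<Rightarrow> 'e::topological_space) measure" where
  "trajectory_space =
     sigma trajectories {{\<omega> \<in> trajectories. \<omega> t \<in> A} | t A. 0 \<le> t \<and> A \<in> sets borel}"

definition uniform_metric :: "('e \<Rightarrow> 'e \<Rightarrow> real) \<Rightarrow> (real \<Rightarrow> 'e) \<Rightarrow> (real \<Rightarrow> 'e) \<Rightarrow> real" where
  "uniform_metric \<Delta> \<omega> \<omega>' = (SUP t\<in>{0..}. \<Delta> (\<omega> t) (\<omega>' t))"

definition uniform_topology :: "('e::topological_space \<Rightarrow> 'e \<Rightarrow> real) \<Rightarrow> (real \<Rightarrow> 'e) topology" where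
  "uniform_topology \<Delta> = Metric_space.mtopology trajectories (uniform_metric \<Delta>)"

text \<open>Finite-dimensional distributions as iterated integrals of the kernels: for
  \<open>s \<le> t\<^sub>1 \<le> \<dots> \<le> t\<^sub>n\<close> and a list \<open>r\<close> with entries \<open>(t\<^sub>i, A\<^sub>i)\<close>, \<^term>\<open>fdd P s x r\<close> is the probability
  that the process which is at \<^term>\<open>x\<close> at time \<^term>\<open>s\<close> lies in \<open>A\<^sub>i\<close> at time \<open>t\<^sub>i\<close> for all \<open>i\<close>.\<close>

fun fdd :: "(real \<Rightarrow> 'e \<Rightarrow> 'e measure) \<Rightarrow> real \<Rightarrow> 'e \<Rightarrow> (real \<times> 'e set) list \<Rightarrow> ennreal" where
  "fdd P s x [] = 1"
| "fdd P s x ((t, A) # r) = (\<integral>\<^sup>+y. indicator A y * fdd P t y r \<partial>(P (t - s) x))"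

definition law_from ::
    "(real \<Rightarrow> 'e \<Rightarrow> 'e measure) \<Rightarrow> 'e::topological_space \<Rightarrow> (real \<Rightarrow> 'e) measure \<Rightarrow> bool" where
  "law_from P x M \<longleftrightarrow>
     prob_space M \<and> sets M = sets trajectory_space \<and>
     (\<forall>r. sorted (0 # map fst r) \<and> (\<forall>(t, A) \<in> set r. A \<in> sets borel) \<longrightarrow>
        emeasure M {\<omega> \<in> trajectories. \<forall>(t, A) \<in> set r. \<omega> t \<in> A} = fdd P 0 x r)"

text \<open>The measurability condition on the test functions is automatic when the uniform topology is
  separable, for then its Borel sets are generated by the evaluations. In general they are not, and
  only measurable test functions have an integral with respect to \<^term>\<open>\<P> x\<close>.\<close>

definition weakly_continuous ::
    "('e \<Rightarrow> 'e \<Rightarrow> real) \<Rightarrow> ('e::topological_space \<Rightarrow> (real \<Rightarrow> 'e) measure) \<Rightarrow> bool" where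
  "weakly_continuous \<Delta> \<P> \<longleftrightarrow>
     (\<forall>F :: (real \<Rightarrow> 'e) \<Rightarrow> real.
        continuous_map (uniform_topology \<Delta>) euclideanreal F \<and> bounded (F ` trajectories) \<and>
        F \<in> borel_measurable trajectory_space \<longrightarrow>
        continuous_on UNIV (\<lambda>x. \<integral>\<omega>. F \<omega> \<partial>(\<P> x)))"

section \<open>Optimal transport\<close>

definition couplings :: "'a measure \<Rightarrow> 'b measure \<Rightarrow> ('a \<times> 'b) measure set" where
  "couplings \<mu> \<nu> = {\<gamma>. prob_space \<gamma> \<and> sets \<gamma> = sets (\<mu> \<Otimes>\<^sub>M \<nu>) \<and>
                       distr \<gamma> \<mu> fst = \<mu> \<and> distr \<gamma> \<nu> snd = \<nu>}"

text \<open>The infimum is a minimum for the lower semi-continuous costs under consideration.\<close>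

definition transport_cost :: "('a \<Rightarrow> 'a \<Rightarrow> real) \<Rightarrow> 'a measure \<Rightarrow> 'a measure \<Rightarrow> real" where
  "transport_cost d \<mu> \<nu> = (INF \<gamma>\<in>couplings \<mu> \<nu>. \<integral>(\<omega>, \<omega>'). d \<omega> \<omega>' \<partial>\<gamma>)"

definition discounted_uniform ::
    "real \<Rightarrow> ('e \<Rightarrow> 'e \<Rightarrow> real) \<Rightarrow> (real \<Rightarrow> 'e) \<Rightarrow> (real \<Rightarrow> 'e) \<Rightarrow> real" where
  "discounted_uniform c m \<omega> \<omega>' = (SUP t\<in>{0..}. c powr t * m (\<omega> t) (\<omega>' t))"

definition \<G> ::
    "('e \<Rightarrow> (real \<Rightarrow> 'e) measure) \<Rightarrow> real \<Rightarrow> ('e \<Rightarrow> 'e \<Rightarrow> real) \<Rightarrow> ('e \<Rightarrow> 'e \<Rightarrow> real)" where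
  "\<G> \<P> c m x y = transport_cost (discounted_uniform c m) (\<P> x) (\<P> y)"

section \<open>Logic\<close>

datatype state_form = Const rat | Obs | Compl state_form | Integ path_form
  and path_form = Ev state_form rat | PMin path_form path_form | PMax path_form path_form
    | Minus path_form rat | Plus path_form rat

primrec wf_state :: "state_form \<Rightarrow> bool" and wf_path :: "path_form \<Rightarrow> bool" where
  "wf_state (Const q) \<longleftrightarrow> 0 \<le> q \<and> q \<le> 1"
| "wf_state Obs \<longleftrightarrow> True"
| "wf_state (Compl f) \<longleftrightarrow> wf_state f"
| "wf_state (Integ g) \<longleftrightarrow> wf_path g"
| "wf_path (Ev f t) \<longleftrightarrow> wf_state f \<and> 0 \<le> t"
| "wf_path (PMin g1 g2) \<longleftrightarrow> wf_path g1 \<and> wf_path g2"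
| "wf_path (PMax g1 g2) \<longleftrightarrow> wf_path g1 \<and> wf_path g2"
| "wf_path (Minus g q) \<longleftrightarrow> wf_path g \<and> 0 \<le> q \<and> q \<le> 1"
| "wf_path (Plus g q) \<longleftrightarrow> wf_path g \<and> 0 \<le> q \<and> q \<le> 1"

definition \<L>\<^sub>\<sigma> :: "state_form set" where
  "\<L>\<^sub>\<sigma> = {f. wf_state f}"

definition \<L>\<^sub>\<tau> :: "path_form set" where
  "\<L>\<^sub>\<tau> = {g. wf_path g}"

primrec sem_state :: "('e \<Rightarrow> real) \<Rightarrow> ('e \<Rightarrow> (real \<Rightarrow> 'e) measure) \<Rightarrow> real \<Rightarrow> state_form \<Rightarrow> 'e \<Rightarrow> real"
  and sem_path :: "('e \<Rightarrow> real) \<Rightarrow> ('e \<Rightarrow> (real \<Rightarrow> 'e) measure) \<Rightarrow> real \<Rightarrow> path_form \<Rightarrow> (real \<Rightarrow> 'e) \<Rightarrow> real"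
where
  "sem_state obs \<P> c (Const q) = (\<lambda>x. of_rat q)"
| "sem_state obs \<P> c Obs = obs"
| "sem_state obs \<P> c (Compl f) = (\<lambda>x. 1 - sem_state obs \<P> c f x)"
| "sem_state obs \<P> c (Integ g) = (\<lambda>x. \<integral>\<omega>. sem_path obs \<P> c g \<omega> \<partial>(\<P> x))"
| "sem_path obs \<P> c (Ev f t) = (\<lambda>\<omega>. c powr of_rat t * sem_state obs \<P> c f (\<omega> (of_rat t)))"
| "sem_path obs \<P> c (PMin g1 g2) = (\<lambda>\<omega>. min (sem_path obs \<P> c g1 \<omega>) (sem_path obs \<P> c g2 \<omega>))"
| "sem_path obs \<P> c (PMax g1 g2) = (\<lambda>\<omega>. max (sem_path obs \<P> c g1 \<omega>) (sem_path obs \<P> c g2 \<omega>))"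
| "sem_path obs \<P> c (Minus g q) = (\<lambda>\<omega>. max 0 (sem_path obs \<P> c g \<omega> - of_rat q))"
| "sem_path obs \<P> c (Plus g q) = (\<lambda>\<omega>. min 1 (sem_path obs \<P> c g \<omega> + of_rat q))"

definition logic_dist ::
    "('e \<Rightarrow> real) \<Rightarrow> ('e \<Rightarrow> (real \<Rightarrow> 'e) measure) \<Rightarrow> real \<Rightarrow> 'e \<Rightarrow> 'e \<Rightarrow> real" where
  "logic_dist obs \<P> c x y = (SUP f\<in>\<L>\<^sub>\<sigma>. \<bar>sem_state obs \<P> c f x - sem_state obs \<P> c f y\<bar>)"

end

theory Submission
  imports Defs
begin

text \<open>The distance \<open>\<ell>\<close> is at most the cost of any coupling because every path formula is 1-Lipschitz for
  \<open>U\<^sub>c(\<ell>)\<close>, and \<open>obs\<close> is recovered as the integral of \<open>obs \<circ> ev\<^sub>0\<close> since the process starts at its starting point.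

  For the converse, \<open>U\<^sub>c(\<ell>)\<close> is the supremum of \<open>\<bar>h\<^sub>k \<omega> - h\<^sub>k \<omega>'\<bar>\<close> over countably many formulas \<open>h\<^sub>k = f \<circ> ev\<^sub>t\<close>. By
  the lattice form of the Stone--Weierstrass theorem, every function that is 1-Lipschitz for the maximum of the first
  \<open>N\<close> of these differences is a uniform limit of path formulas, up to a constant. Kantorovich duality on a
  finite partition of the trajectory space therefore yields, for each \<open>N\<close>, a finite transport plan of cost about
  \<open>\<ell>(x, y)\<close>. The trajectory space is standard Borel: a path is coded by a sequence of bits from which it can be
  recovered measurably. Hence the plans, viewed as weights on pairs of bit sequences, have a limit by
  compactness of the Cantor space, and the limit is a coupling that is optimal for all \<open>N\<close> simultaneously.\<close>

section \<open>Finite transport duality\<close>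

text \<open>The trajectory space with its uniform topology is not compact and in general not
  separable, so neither a finite net of paths nor a convergent sequence of couplings comes for free;
  bits are the substitute. The code also records the rational level sets of every h_k, hence h_k is
  known up to any given error from finitely many bits. The maximum of finitely many differences is
  therefore totally bounded, which serves both the finite partition and the lattice approximation,
  and it is a uniform limit of functions of finitely many bits, the only functions whose integrals
  are controlled when just the masses of cylinders converge. The full distance is reached only at
  the end, by dominated convergence from below; as the maxima increase with N, a plan made for a
  late stage also bounds the cost of every earlier one. The price of the passage through the Cantor
  space is that a limit there might charge sequences that code no path. Its two marginals are the
  laws of genuine codes, which rules this out up to null sets.\<close>

lemma compact_box:
  fixes l b :: "'a \<Rightarrow> real"
  shows "compact {f. \<forall>z. l z \<le> f z \<and> f z \<le> b z}"
proof -
  have "compactin (product_topology (\<lambda>_::'a. euclidean) UNIV) (PiE UNIV (\<lambda>z. {l z..b z}))"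
    by (subst compactin_PiE) simp
  moreover have "PiE UNIV (\<lambda>z. {l z..b z}) = {f. \<forall>z. l z \<le> f z \<and> f z \<le> b z}"
    by (auto simp: PiE_UNIV_domain)
  ultimately show ?thesis
    by (simp add: euclidean_product_topology)
qed

text \<open>Minimise the cost plus \<open>1 / (2 * \<epsilon>)\<close> times the squared errors in the two marginals. At a minimiser the
  errors, divided by \<open>- \<epsilon>\<close>, are dual feasible potentials \<open>u\<close> and \<open>v\<close> satisfying complementary slackness, so
  neither linear programming duality nor cyclical monotonicity is needed.\<close>

lemma transport_duality_approx:
  fixes d :: "'a \<Rightarrow> 'a \<Rightarrow> real" and p q :: "'a \<Rightarrow> real"
  assumes fin: "finite S"
    and d: "\<And>i j. i \<in> S \<Longrightarrow> j \<in> S \<Longrightarrow> 0 \<le> d i j"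
    and p: "\<And>i. i \<in> S \<Longrightarrow> 0 \<le> p i \<and> p i \<le> 1"
    and q: "\<And>i. i \<in> S \<Longrightarrow> 0 \<le> q i \<and> q i \<le> 1"
    and dual: "\<And>u v. (\<And>i j. i \<in> S \<Longrightarrow> j \<in> S \<Longrightarrow> u i + v j \<le> d i j) \<Longrightarrow>
                 (\<Sum>i\<in>S. p i * u i) + (\<Sum>j\<in>S. q j * v j) \<le> L"
    and \<eta>: "0 < \<eta>"
  obtains \<pi> :: "'a \<times> 'a \<Rightarrow> real" where "\<And>z. 0 \<le> \<pi> z"
    and "\<And>i. i \<in> S \<Longrightarrow> \<bar>(\<Sum>j\<in>S. \<pi> (i, j)) - p i\<bar> \<le> \<eta>"
    and "\<And>j. j \<in> S \<Longrightarrow> \<bar>(\<Sum>i\<in>S. \<pi> (i, j)) - q j\<bar> \<le> \<eta>"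
    and "(\<Sum>i\<in>S. \<Sum>j\<in>S. \<pi> (i, j) * d i j) \<le> L"
proof -
  have L: "0 \<le> L"
    using dual[of "\<lambda>_. 0" "\<lambda>_. 0"] d by simp
  \<comment> \<open>A minimiser will satisfy \<open>\<epsilon> * (u i)\<^sup>2 \<le> L\<close>, so
    the square of its marginal error \<open>\<epsilon> * u i\<close> is at most
    \<open>\<epsilon> * L\<close>. This choice brings that below \<open>\<eta>\<^sup>2\<close>; the
    \<open>+ 1\<close> covers \<open>L = 0\<close>.\<close>
  define \<epsilon> where "\<epsilon> = \<eta>\<^sup>2 / (L + 1)"
  have \<epsilon>: "0 < \<epsilon>" using \<eta> L by (simp add: \<epsilon>_def)
  have \<epsilon>L: "\<epsilon> * L \<le> \<eta>\<^sup>2"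
  proof -
    have "\<epsilon> * L \<le> \<epsilon> * (L + 1)" using \<epsilon> by simp
    also have "\<dots> = \<eta>\<^sup>2" using L by (simp add: \<epsilon>_def)
    finally show ?thesis .
  qed
  define r where "r \<pi> i = (\<Sum>j\<in>S. \<pi> (i, j)) - p i" for \<pi> :: "'a \<times> 'a \<Rightarrow> real" and i
  define s where "s \<pi> j = (\<Sum>i\<in>S. \<pi> (i, j)) - q j" for \<pi> :: "'a \<times> 'a \<Rightarrow> real" and j
  define C where "C \<pi> = (\<Sum>i\<in>S. \<Sum>j\<in>S. \<pi> (i, j) * d i j)" for \<pi> :: "'a \<times> 'a \<Rightarrow> real"
  define \<Phi> where "\<Phi> \<pi> = C \<pi> + ((\<Sum>i\<in>S. (r \<pi> i)\<^sup>2) + (\<Sum>j\<in>S. (s \<pi> j)\<^sup>2)) / (2 * \<epsilon>)" for \<pi>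
  define n where "n = real (card S)"
  \<comment> \<open>The box only provides compactness. Comparison with the zero plan keeps every
    entry of a minimiser below \<open>B - 1\<close>, so the upper wall is inactive and increments up
    to 1 remain inside.\<close>
  define B where "B = 3 + 2 * n"
  have n: "0 \<le> n" by (simp add: n_def)
  define b where "b = (\<lambda>z. if z \<in> S \<times> S then B else 0)"
  define K where "K = {\<pi>. \<forall>z. 0 \<le> \<pi> z \<and> \<pi> z \<le> b z}"
  have "compact K" unfolding K_def by (rule compact_box)
  moreover have K0: "(\<lambda>_. 0) \<in> K" using n by (auto simp: K_def b_def B_def)
  moreover have "continuous_on K \<Phi>"
    unfolding \<Phi>_def C_def r_def s_def
    by (intro continuous_intros continuous_on_subset[OF continuous_on_product_coordinates]) (use \<epsilon> in auto)
  ultimately obtain \<pi> where \<pi>K: "\<pi> \<in> K" and min: "\<And>\<rho>. \<rho> \<in> K \<Longrightarrow> \<Phi> \<pi> \<le> \<Phi> \<rho>"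
    using continuous_attains_inf[of K \<Phi>] by blast
  have \<pi>0: "0 \<le> \<pi> z" for z using \<pi>K unfolding K_def by blast
  have C0: "0 \<le> C \<pi>" unfolding C_def using \<pi>0 d by (auto intro!: sum_nonneg)
  have \<Phi>0: "\<Phi> (\<lambda>_. 0) \<le> 2 * n / (2 * \<epsilon>)"
  proof -
    have "(\<Sum>i\<in>S. (p i)\<^sup>2) \<le> (\<Sum>i\<in>S. 1)" "(\<Sum>i\<in>S. (q i)\<^sup>2) \<le> (\<Sum>i\<in>S. 1)"
      by (intro sum_mono power_le_one; use p q in simp)+
    then show ?thesis
      unfolding \<Phi>_def C_def r_def s_def using \<epsilon>
      by (simp add: n_def divide_right_mono[of _ "2 * real (card S)" "2 * \<epsilon>", simplified])
  qed
  have bnd: "\<pi> (i, j) + 1 < B" if ij: "i \<in> S" "j \<in> S" for i j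
  proof -
    have "(r \<pi> i)\<^sup>2 \<le> (\<Sum>i\<in>S. (r \<pi> i)\<^sup>2)"
      using member_le_sum[of i S "\<lambda>i. (r \<pi> i)\<^sup>2"] fin ij by simp
    also have "\<dots> \<le> (\<Sum>i\<in>S. (r \<pi> i)\<^sup>2) + (\<Sum>j\<in>S. (s \<pi> j)\<^sup>2)" by (simp add: sum_nonneg)
    finally have "(r \<pi> i)\<^sup>2 / (2 * \<epsilon>) \<le> ((\<Sum>i\<in>S. (r \<pi> i)\<^sup>2) + (\<Sum>j\<in>S. (s \<pi> j)\<^sup>2)) / (2 * \<epsilon>)"
      using \<epsilon> by (intro divide_right_mono) auto
    also have "\<dots> \<le> \<Phi> \<pi>" using C0 by (simp add: \<Phi>_def)
    also have "\<dots> \<le> 2 * n / (2 * \<epsilon>)" using min[OF K0] \<Phi>0 by linarith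
    finally have "(r \<pi> i)\<^sup>2 \<le> 2 * n" using \<epsilon> by (simp add: field_simps)
    also have "\<dots> < (1 + 2 * n)\<^sup>2" using n by (simp add: power2_eq_square algebra_simps add_pos_nonneg)
    finally have "r \<pi> i < 1 + 2 * n" using n by (meson add_nonneg_nonneg mult_nonneg_nonneg power_less_imp_less_base zero_le_numeral zero_le_one)
    moreover have "\<pi> (i, j) \<le> (\<Sum>j\<in>S. \<pi> (i, j))"
      using member_le_sum[of j S "\<lambda>j. \<pi> (i, j)"] fin ij \<pi>0 by simp
    ultimately show ?thesis using p[OF ij(1)] by (simp add: r_def B_def)
  qed
  \<comment> \<open>The partial derivative of \<open>\<Phi>\<close> in the entry
    \<open>(i, j)\<close>. Changing that entry by \<open>t\<close> moves one row error and one
    column error by \<open>t\<close>, so the remainder is exactly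
    \<open>t\<^sup>2 / \<epsilon>\<close>.\<close>
  define g where "g i j = d i j + (r \<pi> i + s \<pi> j) / \<epsilon>" for i j
  have pert: "0 \<le> t * (g i j + t / \<epsilon>)"
    if ij: "i \<in> S" "j \<in> S" and t: "- \<pi> (i, j) \<le> t" "t \<le> 1" for i j t
  proof -
    define \<rho> where "\<rho> = \<pi>((i, j) := \<pi> (i, j) + t)"
    have \<rho>: "\<rho> (k, l) = \<pi> (k, l) + (if k = i then if l = j then t else 0 else 0)" for k l
      by (auto simp: \<rho>_def)
    have "\<rho> \<in> K"
      unfolding K_def
    proof (intro CollectI allI)
      fix z
      have "0 \<le> \<pi> z \<and> \<pi> z \<le> b z" using \<pi>K unfolding K_def by blast
      then show "0 \<le> \<rho> z \<and> \<rho> z \<le> b z"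
        using bnd[OF ij] t ij by (cases "z = (i, j)") (simp_all add: \<rho>_def b_def)
    qed
    then have le: "\<Phi> \<pi> \<le> \<Phi> \<rho>" by (rule min)
    have R: "r \<rho> k = r \<pi> k + (if k = i then t else 0)" for k
      using fin ij by (simp add: r_def \<rho> sum.distrib)
    have S: "s \<rho> k = s \<pi> k + (if k = j then t else 0)" for k
      using fin ij by (simp add: s_def \<rho> sum.distrib)
    have CC: "C \<rho> = C \<pi> + t * d i j"
    proof -
      have "C \<rho> = (\<Sum>k\<in>S. \<Sum>l\<in>S. \<pi> (k, l) * d k l + (if k = i then if l = j then t * d k l else 0 else 0))"
        unfolding C_def \<rho> by (intro sum.cong refl) (simp add: algebra_simps)
      also have "\<dots> = C \<pi> + (\<Sum>k\<in>S. \<Sum>l\<in>S. if k = i then if l = j then t * d k l else 0 else 0)"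
        by (simp add: C_def sum.distrib)
      also have "(\<Sum>k\<in>S. \<Sum>l\<in>S. if k = i then if l = j then t * d k l else 0 else 0) =
          (\<Sum>k\<in>S. if k = i then t * d k j else 0)"
        using fin ij by (intro sum.cong refl) simp
      finally show ?thesis using fin ij by simp
    qed
    have R2: "(\<Sum>k\<in>S. (r \<rho> k)\<^sup>2) = (\<Sum>k\<in>S. (r \<pi> k)\<^sup>2) + (2 * t * r \<pi> i + t\<^sup>2)"
    proof -
      have "(\<Sum>k\<in>S. (r \<rho> k)\<^sup>2) = (\<Sum>k\<in>S. (r \<pi> k)\<^sup>2 + (if k = i then 2 * t * r \<pi> k + t\<^sup>2 else 0))"
        unfolding R by (intro sum.cong refl) (simp add: power2_eq_square algebra_simps)
      then show ?thesis using fin ij by (simp add: sum.distrib)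
    qed
    have S2: "(\<Sum>k\<in>S. (s \<rho> k)\<^sup>2) = (\<Sum>k\<in>S. (s \<pi> k)\<^sup>2) + (2 * t * s \<pi> j + t\<^sup>2)"
    proof -
      have "(\<Sum>k\<in>S. (s \<rho> k)\<^sup>2) = (\<Sum>k\<in>S. (s \<pi> k)\<^sup>2 + (if k = j then 2 * t * s \<pi> k + t\<^sup>2 else 0))"
        unfolding S by (intro sum.cong refl) (simp add: power2_eq_square algebra_simps)
      then show ?thesis using fin ij by (simp add: sum.distrib)
    qed
    have "\<Phi> \<rho> = \<Phi> \<pi> + t * (g i j + t / \<epsilon>)"
      unfolding \<Phi>_def CC R2 S2 g_def using \<epsilon> by (simp add: field_simps power2_eq_square)
    with le show ?thesis by simp
  qed
  have g0: "0 \<le> g i j" if ij: "i \<in> S" "j \<in> S" for i j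
  proof (rule ccontr)
    assume "\<not> 0 \<le> g i j"
    then have g: "g i j < 0" by simp
    \<comment> \<open>Half of the root of \<open>g i j + t / \<epsilon>\<close>, capped at the
      largest step that \<open>pert\<close> admits.\<close>
    define t where "t = min 1 (- g i j * \<epsilon> / 2)"
    have t: "0 < t" "t \<le> 1" "t / \<epsilon> \<le> - g i j / 2"
      using g \<epsilon> by (auto simp: t_def field_simps mult_pos_neg min_def)
    then have "g i j + t / \<epsilon> < 0" using g by linarith
    with t have "t * (g i j + t / \<epsilon>) < 0" by (simp add: mult_pos_neg)
    moreover have "- \<pi> (i, j) \<le> t" using \<pi>0[of "(i, j)"] t by linarith
    ultimately show False using pert[OF ij, of t] t by simp
  qed
  have slack: "\<pi> (i, j) * g i j = 0" if ij: "i \<in> S" "j \<in> S" for i j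
  proof (rule ccontr)
    assume "\<pi> (i, j) * g i j \<noteq> 0"
    then have g: "g i j > 0" "\<pi> (i, j) > 0"
      using g0[OF ij] \<pi>0[of "(i, j)"] by (auto simp: order_less_le)
    define t where "t = min (\<pi> (i, j)) (g i j * \<epsilon> / 2)"
    have t: "0 < t" "t \<le> \<pi> (i, j)" "t / \<epsilon> \<le> g i j / 2"
      using g \<epsilon> by (auto simp: t_def field_simps min_def)
    then have "g i j + (- t) / \<epsilon> > 0" using g by linarith
    with t have "(- t) * (g i j + (- t) / \<epsilon>) < 0" by (intro mult_neg_pos) auto
    then show False using pert[OF ij, of "- t"] t by simp
  qed
  define u where "u i = - r \<pi> i / \<epsilon>" for i
  define v where "v i = - s \<pi> i / \<epsilon>" for i
  have guv: "g i j = d i j - u i - v j" for i j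
    using \<epsilon> by (simp add: g_def u_def v_def field_simps)
  have dual': "(\<Sum>i\<in>S. p i * u i) + (\<Sum>j\<in>S. q j * v j) \<le> L"
  proof (rule dual)
    show "u i + v j \<le> d i j" if "i \<in> S" "j \<in> S" for i j
      using g0[OF that] guv[of i j] by linarith
  qed
  have ru: "(\<Sum>j\<in>S. \<pi> (i, j)) = p i - \<epsilon> * u i" for i
    using \<epsilon> by (simp add: u_def r_def)
  have sv: "(\<Sum>i\<in>S. \<pi> (i, j)) = q j - \<epsilon> * v j" for j
    using \<epsilon> by (simp add: v_def s_def)
  \<comment> \<open>By slackness the cost is the integral of the potentials against the actual
    marginals \<open>p - \<epsilon> * u\<close> and \<open>q - \<epsilon> * v\<close>. The
    deviations contribute negative squares; moved to the other side in \<open>key\<close>, they are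
    bounded by \<open>L\<close> together with the cost.\<close>
  have "C \<pi> = (\<Sum>i\<in>S. \<Sum>j\<in>S. \<pi> (i, j) * u i + \<pi> (i, j) * v j)"
    unfolding C_def
  proof (intro sum.cong refl)
    fix i j assume ij: "i \<in> S" "j \<in> S"
    show "\<pi> (i, j) * d i j = \<pi> (i, j) * u i + \<pi> (i, j) * v j"
      using slack[OF ij] unfolding guv by (simp add: algebra_simps)
  qed
  also have "\<dots> = (\<Sum>i\<in>S. (\<Sum>j\<in>S. \<pi> (i, j)) * u i) + (\<Sum>i\<in>S. \<Sum>j\<in>S. \<pi> (i, j) * v j)"
    by (simp add: sum.distrib sum_distrib_right)
  also have "(\<Sum>i\<in>S. \<Sum>j\<in>S. \<pi> (i, j) * v j) = (\<Sum>j\<in>S. (\<Sum>i\<in>S. \<pi> (i, j)) * v j)"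
    by (subst sum.swap) (simp add: sum_distrib_right)
  also have "(\<Sum>i\<in>S. (\<Sum>j\<in>S. \<pi> (i, j)) * u i) = (\<Sum>i\<in>S. p i * u i) - \<epsilon> * (\<Sum>i\<in>S. (u i)\<^sup>2)"
    unfolding ru by (simp add: algebra_simps sum_subtractf sum_distrib_left power2_eq_square)
  also have "(\<Sum>j\<in>S. (\<Sum>i\<in>S. \<pi> (i, j)) * v j) = (\<Sum>j\<in>S. q j * v j) - \<epsilon> * (\<Sum>j\<in>S. (v j)\<^sup>2)"
    unfolding sv by (simp add: algebra_simps sum_subtractf sum_distrib_left power2_eq_square)
  finally have key: "C \<pi> + \<epsilon> * (\<Sum>i\<in>S. (u i)\<^sup>2) + \<epsilon> * (\<Sum>j\<in>S. (v j)\<^sup>2) \<le> L"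
    using dual' by simp
  have uv0: "0 \<le> \<epsilon> * (\<Sum>i\<in>S. (u i)\<^sup>2)" "0 \<le> \<epsilon> * (\<Sum>j\<in>S. (v j)\<^sup>2)"
    using \<epsilon> by (auto simp: sum_nonneg)
  have small: "\<bar>\<epsilon> * x\<bar> \<le> \<eta>" if "\<epsilon> * x\<^sup>2 \<le> L" for x
  proof -
    have "(\<epsilon> * x)\<^sup>2 = \<epsilon> * (\<epsilon> * x\<^sup>2)" by (simp add: power2_eq_square)
    also have "\<dots> \<le> \<epsilon> * L" using that \<epsilon> by simp
    also have "\<dots> \<le> \<eta>\<^sup>2" by (rule \<epsilon>L)
    finally show ?thesis using \<eta> abs_le_square_iff[of "\<epsilon> * x" \<eta>] by simp
  qed
  have u: "\<epsilon> * (u i)\<^sup>2 \<le> L" if "i \<in> S" for i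
  proof -
    have "(u i)\<^sup>2 \<le> (\<Sum>i\<in>S. (u i)\<^sup>2)"
      using member_le_sum[of i S "\<lambda>i. (u i)\<^sup>2"] fin that by simp
    then have "\<epsilon> * (u i)\<^sup>2 \<le> \<epsilon> * (\<Sum>i\<in>S. (u i)\<^sup>2)" using \<epsilon> by simp
    then show ?thesis using key C0 uv0 by linarith
  qed
  have v: "\<epsilon> * (v i)\<^sup>2 \<le> L" if "i \<in> S" for i
  proof -
    have "(v i)\<^sup>2 \<le> (\<Sum>i\<in>S. (v i)\<^sup>2)"
      using member_le_sum[of i S "\<lambda>i. (v i)\<^sup>2"] fin that by simp
    then have "\<epsilon> * (v i)\<^sup>2 \<le> \<epsilon> * (\<Sum>i\<in>S. (v i)\<^sup>2)" using \<epsilon> by simp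
    then show ?thesis using key C0 uv0 by linarith
  qed
  show thesis
  proof (rule that)
    show "\<bar>(\<Sum>j\<in>S. \<pi> (i, j)) - p i\<bar> \<le> \<eta>" if "i \<in> S" for i
      using small[OF u[OF that]] unfolding ru by simp
    show "\<bar>(\<Sum>i\<in>S. \<pi> (i, j)) - q j\<bar> \<le> \<eta>" if "j \<in> S" for j
      using small[OF v[OF that]] unfolding sv by simp
    show "(\<Sum>i\<in>S. \<Sum>j\<in>S. \<pi> (i, j) * d i j) \<le> L"
      using key uv0 unfolding C_def by linarith
  qed (rule \<pi>0)
qed

section \<open>Random bit sequences\<close>

abbreviation bit_space :: "(nat \<Rightarrow> bool) measure" where
  "bit_space \<equiv> PiM UNIV (\<lambda>_. count_space UNIV)"

text \<open>The most recent bit comes first, so that one step down the binary tree is a \<open>Cons\<close>.\<close>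

primrec rprefix :: "(nat \<Rightarrow> bool) \<Rightarrow> nat \<Rightarrow> bool list" where
  "rprefix x 0 = []"
| "rprefix x (Suc n) = x n # rprefix x n"

lemma length_rprefix [simp]: "length (rprefix x n) = n"
  by (induction n) auto

lemma rprefix_eq_iff: "rprefix x n = rprefix y n \<longleftrightarrow> (\<forall>i<n. x i = y i)"
  by (induction n) (auto simp: less_Suc_eq)

lemma rprefix_nth: "i < n \<Longrightarrow> x i = rev (rprefix x n) ! i"
  by (induction n) (auto simp: nth_append less_Suc_eq)

lemma finite_bool_lists [simp, intro]: "finite {s :: bool list. length s = n}"
  using finite_lists_length_eq[of "UNIV :: bool set" n] by simp

lemma space_bit_space: "space bit_space = UNIV"
  by (simp add: space_PiM)

lemma measurable_bit [measurable]: "(\<lambda>x. x i) \<in> bit_space \<rightarrow>\<^sub>M count_space UNIV"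
  by (rule measurable_component_singleton) simp

lemma measurable_into_bit_space:
  assumes "\<And>i. {x \<in> space M. f x i} \<in> sets M"
  shows "f \<in> M \<rightarrow>\<^sub>M bit_space"
proof (rule measurable_PiM_single')
  fix i :: nat
  have "Measurable.pred M (\<lambda>x. f x i)"
    using assms[of i] by (simp add: pred_def)
  then show "(\<lambda>x. f x i) \<in> M \<rightarrow>\<^sub>M count_space UNIV" .
qed auto

lemma measurable_rprefix [measurable]: "(\<lambda>x. rprefix x n) \<in> bit_space \<rightarrow>\<^sub>M count_space UNIV"
proof (induction n)
  case (Suc n)
  note [measurable] = Suc
  have "(\<lambda>x. (x n, rprefix x n)) \<in> bit_space \<rightarrow>\<^sub>M count_space UNIV \<Otimes>\<^sub>M count_space UNIV"
    by measurable
  then have "(\<lambda>x. (x n, rprefix x n)) \<in> bit_space \<rightarrow>\<^sub>M count_space UNIV"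
    by (simp add: pair_measure_countable)
  then have "(\<lambda>(b, l). b # l) \<circ> (\<lambda>x. (x n, rprefix x n)) \<in> bit_space \<rightarrow>\<^sub>M count_space UNIV"
    by (rule measurable_comp) simp
  then show ?case by (simp add: comp_def)
qed simp

lemma sets_rprefix [measurable]: "{x. rprefix x n = s} \<in> sets bit_space"
proof -
  have "(\<lambda>x. rprefix x n) -` {s} \<inter> space bit_space \<in> sets bit_space"
    by (rule measurable_sets[OF measurable_rprefix]) simp
  then show ?thesis by (simp add: space_bit_space vimage_def)
qed

text \<open>The bits are read off a uniform random point of \<open>[0, 1)\<close>: the node \<open>s\<close> of the binary tree is
  given a half-open interval of length \<open>w s\<close>, split between its two children.\<close>

lemma tree_measure:
  fixes w :: "bool list \<Rightarrow> real"
  assumes w0: "\<And>s. 0 \<le> w s" and w1: "w [] = 1"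
    and split: "\<And>s. w s = w (True # s) + w (False # s)"
  obtains M where "prob_space M" and "sets M = sets bit_space"
    and "\<And>s. measure M {x. rprefix x (length s) = s} = w s"
proof -
  \<comment> \<open>Left end of the interval of a node. The \<open>False\<close> child takes the
    left part, so the \<open>True\<close> child starts after the weight of its sibling.\<close>
  define L where "L = rec_list 0 (\<lambda>b s l. l + (if b then w (False # s) else (0::real)))"
  have L: "L [] = 0" "\<And>b s. L (b # s) = L s + (if b then w (False # s) else 0)"
    by (simp_all add: L_def)
  \<comment> \<open>The node of depth \<open>n\<close> whose interval contains \<open>u\<close>,
    found by comparing \<open>u\<close> with the split point at each level.\<close>
  define pre where "pre u = rec_nat [] (\<lambda>n s. (L s + w (False # s) \<le> u) # s)" for u :: real
  have pre: "pre u 0 = []" "\<And>n. pre u (Suc n) = (L (pre u n) + w (False # pre u n) \<le> u) # pre u n" for u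
    by (simp_all add: pre_def)
  define \<beta> where "\<beta> u n = hd (pre u (Suc n))" for u n
  have rp: "rprefix (\<beta> u) n = pre u n" for u n
    by (induction n) (simp_all add: pre \<beta>_def)
  have len: "length (pre u n) = n" for u n
    by (induction n) (simp_all add: pre)
  have iff: "pre u (length s) = s \<longleftrightarrow> L s \<le> u \<and> u < L s + w s" if u: "u \<in> {0..<1}" for u s
  proof (induction s)
    case Nil
    show ?case using u by (simp add: pre L w1)
  next
    case (Cons b s)
    have "pre u (length (b # s)) = b # s \<longleftrightarrow>
        pre u (length s) = s \<and> (L s + w (False # s) \<le> u) = b"
      by (auto simp: pre)
    also have "\<dots> \<longleftrightarrow> L (b # s) \<le> u \<and> u < L (b # s) + w (b # s)"
      using Cons split[of s] w0[of "True # s"] w0[of "False # s"] by (cases b) (auto simp: L)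
    finally show ?case .
  qed
  have bounds: "0 \<le> L s \<and> L s + w s \<le> 1" for s
  proof (induction s)
    case (Cons b s)
    then show ?case using split[of s] w0[of "True # s"] w0[of "False # s"] by (cases b) (auto simp: L)
  qed (simp add: L w1)
  define U where "U = restrict_space lborel {0..<1::real}"
  have spU: "space U = {0..<1}" by (simp add: U_def space_restrict_space)
  have probU: "prob_space U"
    by (rule prob_spaceI) (simp add: U_def space_restrict_space emeasure_restrict_space)
  have cyl: "{u \<in> {0..<1}. pre u (length s) = s} = {L s..<L s + w s}" for s
  proof (intro set_eqI)
    fix u
    show "u \<in> {u \<in> {0..<1}. pre u (length s) = s} \<longleftrightarrow> u \<in> {L s..<L s + w s}"
      using iff[of u s] bounds[of s] by (cases "u \<in> {0..<1}") auto
  qed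
  have setsU: "{L s..<L s + w s} \<in> sets U" for s
    using bounds[of s] by (auto simp: U_def sets_restrict_space_iff)
  have \<beta>m: "\<beta> \<in> U \<rightarrow>\<^sub>M bit_space"
  proof (rule measurable_into_bit_space)
    fix i
    have "{u \<in> space U. \<beta> u i} =
        (\<Union>s\<in>{s. length s = Suc i \<and> hd s}. {u \<in> {0..<1}. pre u (length s) = s})"
      by (auto simp: spU \<beta>_def len)
    also have "\<dots> \<in> sets U"
      unfolding cyl by (rule sets.finite_UN) (auto simp: setsU intro: finite_subset[OF _ finite_bool_lists[of "Suc i"]])
    finally show "{u \<in> space U. \<beta> u i} \<in> sets U" .
  qed
  show thesis
  proof (rule that)
    show "prob_space (distr U bit_space \<beta>)"
      by (rule prob_space.prob_space_distr[OF probU \<beta>m])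
    show "sets (distr U bit_space \<beta>) = sets bit_space" by simp
    show "measure (distr U bit_space \<beta>) {x. rprefix x (length s) = s} = w s" for s
    proof -
      have "measure (distr U bit_space \<beta>) {x. rprefix x (length s) = s} =
          measure U {u \<in> {0..<1}. pre u (length s) = s}"
        by (subst measure_distr[OF \<beta>m]) (auto simp: rp spU vimage_def Int_def conj_commute intro!: arg_cong[of _ _ "measure U"])
      also have "\<dots> = measure lborel {L s..<L s + w s}"
        unfolding cyl U_def using bounds[of s] by (subst measure_restrict_space) auto
      also have "\<dots> = w s" using w0[of s] by simp
      finally show ?thesis .
    qed
  qed
qed

lemma integral_rprefix:
  fixes G :: "bool list \<Rightarrow> real"
  assumes M: "prob_space M" and sets: "sets M = sets bit_space"
  shows "(\<integral>x. G (rprefix x n) \<partial>M) = (\<Sum>s | length s = n. G s * measure M {x. rprefix x n = s})"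
proof -
  interpret prob_space M by fact
  have sp: "space M = UNIV" using sets_eq_imp_space_eq[OF sets] by (simp add: space_bit_space)
  have m: "{x. rprefix x n = s} \<in> sets M" for s by (simp add: sets sets_rprefix)
  have "(\<integral>x. G (rprefix x n) \<partial>M) =
      (\<integral>x. (\<Sum>s | length s = n. G s * indicator {x. rprefix x n = s} x) \<partial>M)"
  proof (rule Bochner_Integration.integral_cong[OF refl])
    fix x
    have "(\<Sum>s | length s = n. G s * indicator {x. rprefix x n = s} x) =
        (\<Sum>s | length s = n. if s = rprefix x n then G s else 0)"
      by (intro sum.cong refl) (auto simp: indicator_def)
    then show "G (rprefix x n) = (\<Sum>s | length s = n. G s * indicator {x. rprefix x n = s} x)"
      by simp
  qed
  also have "\<dots> = (\<Sum>s | length s = n. \<integral>x. G s * indicator {x. rprefix x n = s} x \<partial>M)"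
    by (intro Bochner_Integration.integral_sum integrable_mult_right integrable_real_indicator m)
      (simp add: emeasure_eq_measure)
  also have "\<dots> = (\<Sum>s | length s = n. G s * measure M {x. rprefix x n = s})"
    by (simp add: m sp)
  finally show ?thesis .
qed

text \<open>The masses of the cylinders lie in a box indexed by the countable set of finite bit
  lists, which is sequentially compact. Additivity over the two children of a node survives the
  limit, so \<open>tree_measure\<close> realises the limiting masses. A function of \<open>n\<close>
  bits is a finite combination of cylinders, whence the convergence of integrals. The weights need
  not be normalised; their total only has to tend to 1.\<close>

lemma cantor_compactness:
  fixes S :: "nat \<Rightarrow> 'b set" and \<pi> :: "nat \<Rightarrow> 'b \<Rightarrow> real" and X :: "'b \<Rightarrow> nat \<Rightarrow> bool"
  assumes fin: "\<And>N. finite (S N)" and nonneg: "\<And>N z. 0 \<le> \<pi> N z"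
    and total: "(\<lambda>N. \<Sum>z\<in>S N. \<pi> N z) \<longlonglongrightarrow> 1"
  obtains r M where "strict_mono r" and "prob_space M" and "sets M = sets bit_space"
    and "\<And>n (G :: bool list \<Rightarrow> real).
           (\<lambda>N. \<Sum>z\<in>S (r N). \<pi> (r N) z * G (rprefix (X z) n)) \<longlonglongrightarrow> (\<integral>x. G (rprefix x n) \<partial>M)"
proof -
  define W where "W N s = (\<Sum>z\<in>S N. \<pi> N z * of_bool (rprefix (X z) (length s) = s))" for N s
  obtain C where C: "\<And>N. \<bar>\<Sum>z\<in>S N. \<pi> N z\<bar> \<le> C"
    using convergent_imp_Bseq[OF convergentI[OF total]] by (auto simp: Bseq_def)
  have W: "0 \<le> W N s" "W N s \<le> C" for N s
  proof -
    show "0 \<le> W N s" unfolding W_def using nonneg by (auto intro!: sum_nonneg)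
    have "W N s \<le> (\<Sum>z\<in>S N. \<pi> N z)" unfolding W_def
      by (intro sum_mono) (use nonneg in auto)
    then show "W N s \<le> C" using C[of N] by linarith
  qed
  have "seq_compact {f :: bool list \<Rightarrow> real. \<forall>s. 0 \<le> f s \<and> f s \<le> C}"
    by (rule compact_imp_seq_compact[OF compact_box])
  moreover have "\<forall>N. W N \<in> {f. \<forall>s. 0 \<le> f s \<and> f s \<le> C}" using W by auto
  ultimately obtain w r where w: "w \<in> {f. \<forall>s. 0 \<le> f s \<and> f s \<le> C}"
    and r: "strict_mono r" and lim: "(W \<circ> r) \<longlonglongrightarrow> w"
    unfolding seq_compact_def by blast
  have lim': "(\<lambda>N. W (r N) s) \<longlonglongrightarrow> w s" for s
  proof -
    have "isCont (\<lambda>f :: bool list \<Rightarrow> real. f s) w"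
      using continuous_on_product_coordinates[of s, where ?'b = real]
      unfolding continuous_on_eq_continuous_at[OF open_UNIV] by blast
    from isCont_tendsto_compose[OF this lim] show ?thesis by (simp add: comp_def)
  qed
  have w1: "w [] = 1"
    using LIMSEQ_unique[OF lim'[of "[]"]] LIMSEQ_subseq_LIMSEQ[OF total r]
    by (simp add: W_def comp_def)
  have wsplit: "w s = w (True # s) + w (False # s)" for s
  proof -
    have "W N s = W N (True # s) + W N (False # s)" for N
      unfolding W_def sum.distrib[symmetric]
      by (intro sum.cong refl) (auto simp: of_bool_def)
    then have "(\<lambda>N. W (r N) s) \<longlonglongrightarrow> w (True # s) + w (False # s)"
      using tendsto_add[OF lim'[of "True # s"] lim'[of "False # s"]] by simp
    then show ?thesis using LIMSEQ_unique lim'[of s] by blast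
  qed
  have w0: "0 \<le> w s" for s using w by blast
  obtain M where M: "prob_space M" "sets M = sets bit_space"
    and cyl: "\<And>s. measure M {x. rprefix x (length s) = s} = w s"
    using tree_measure[of w, OF w0 w1 wsplit] by blast
  show thesis
  proof (rule that[OF r M])
    fix n and G :: "bool list \<Rightarrow> real"
    have "(\<Sum>z\<in>S N. \<pi> N z * G (rprefix (X z) n)) = (\<Sum>s | length s = n. G s * W N s)" for N
    proof -
      have "(\<Sum>s | length s = n. G s * W N s) =
          (\<Sum>z\<in>S N. \<Sum>s | length s = n. G s * (\<pi> N z * of_bool (rprefix (X z) n = s)))"
        unfolding W_def sum_distrib_left by (subst sum.swap) (auto intro!: sum.cong)
      also have "\<dots> = (\<Sum>z\<in>S N. \<Sum>s | length s = n. if s = rprefix (X z) n then \<pi> N z * G s else 0)"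
        by (intro sum.cong refl) auto
      also have "\<dots> = (\<Sum>z\<in>S N. \<pi> N z * G (rprefix (X z) n))"
        by simp
      finally show ?thesis by simp
    qed
    moreover have "(\<lambda>N. \<Sum>s | length s = n. G s * W (r N) s) \<longlonglongrightarrow> (\<Sum>s | length s = n. G s * w s)"
      by (intro tendsto_sum tendsto_mult tendsto_const lim')
    moreover have "(\<integral>x. G (rprefix x n) \<partial>M) = (\<Sum>s | length s = n. G s * w s)"
      unfolding integral_rprefix[OF M] by (intro sum.cong refl) (auto simp: cyl[symmetric])
    ultimately show "(\<lambda>N. \<Sum>z\<in>S (r N). \<pi> (r N) z * G (rprefix (X z) n)) \<longlonglongrightarrow> (\<integral>x. G (rprefix x n) \<partial>M)"
      by simp
  qed
qed

lemma bit_space_eqI: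
  assumes M: "prob_space M" "sets M = sets bit_space" and N: "prob_space N" "sets N = sets bit_space"
    and eq: "\<And>n s. length s = n \<Longrightarrow> measure M {x. rprefix x n = s} = measure N {x. rprefix x n = s}"
  shows "M = N"
proof -
  interpret M: prob_space M by fact
  interpret N: prob_space N by fact
  \<comment> \<open>Two cylinders are nested or disjoint, so adding the empty set makes this
    generator stable under intersections. The empty prefix contributes the whole space.\<close>
  define E where "E = insert {} (range (\<lambda>s. {x. rprefix x (length s) = s}))"
  have sets_E: "sets bit_space = sigma_sets UNIV E"
  proof
    show "sigma_sets UNIV E \<subseteq> sets bit_space"
      using sets.sigma_sets_subset[of E bit_space]
      by (auto simp: E_def space_bit_space intro: sets_rprefix)
    have sp: "space (sigma UNIV E) = UNIV" by (simp add: space_measure_of_conv)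
    have "(\<lambda>x. x) \<in> sigma UNIV E \<rightarrow>\<^sub>M bit_space"
    proof (rule measurable_into_bit_space)
      fix i
      have "{x \<in> space (sigma UNIV E). x i} =
          (\<Union>s\<in>{s. length s = Suc i \<and> hd s}. {x. rprefix x (length s) = s})"
        by (auto simp: sp)
      also have "\<dots> \<in> sets (sigma UNIV E)"
      proof (rule sets.finite_UN)
        show "finite {s. length s = Suc i \<and> hd s}"
          by (rule finite_subset[OF _ finite_bool_lists[of "Suc i"]]) auto
        show "{x. rprefix x (length s) = s} \<in> sets (sigma UNIV E)" for s
          by (subst sets_measure_of) (simp_all add: E_def sigma_sets.Basic)
      qed
      finally show "{x \<in> space (sigma UNIV E). x i} \<in> sets (sigma UNIV E)" .
    qed
    from measurable_sets[OF this] show "sets bit_space \<subseteq> sigma_sets UNIV E"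
      by (auto simp: sp)
  qed
  show ?thesis
  proof (rule measure_eqI_generator_eq[where A = "\<lambda>_. UNIV" and \<Omega> = UNIV and E = E])
    show "Int_stable E"
    proof (rule Int_stableI)
      fix a b assume "a \<in> E" "b \<in> E"
      then consider "a = {} \<or> b = {}"
        | s t where "a = {x. rprefix x (length s) = s}" "b = {x. rprefix x (length t) = t}"
        by (auto simp: E_def)
      then show "a \<inter> b \<in> E"
      proof cases
        case 2
        have nested: "B \<subseteq> A \<or> A \<inter> B = {}"
          if "A = {x. rprefix x (length s) = s}" "B = {x. rprefix x (length t) = t}" "length s \<le> length t"
          for A B s t
        proof -
          have "y \<in> A" if z: "z \<in> A" "z \<in> B" and y: "y \<in> B" for y z
          proof -
            have "rprefix y (length t) = rprefix z (length t)"
              using z y \<open>B = _\<close> by simp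
            then have "rprefix y (length s) = rprefix z (length s)"
              using \<open>length s \<le> length t\<close> by (simp add: rprefix_eq_iff)
            then show ?thesis using z \<open>A = _\<close> by simp
          qed
          then show ?thesis by blast
        qed
        have "a \<inter> b = {} \<or> a \<inter> b = a \<or> a \<inter> b = b"
          using nested[OF 2] nested[OF 2(2) 2(1)] by (cases "length s \<le> length t") auto
        with \<open>a \<in> E\<close> \<open>b \<in> E\<close> show ?thesis by (auto simp: E_def)
      qed (auto simp: E_def)
    qed
    show "emeasure M X = emeasure N X" if "X \<in> E" for X
      using that eq by (auto simp: E_def M.emeasure_eq_measure N.emeasure_eq_measure)
    show "range (\<lambda>_. UNIV) \<subseteq> E"
      by (auto simp: E_def image_iff intro!: exI[of _ "[]"])
  qed (auto simp: M N sets_E M.emeasure_eq_measure)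
qed

section \<open>Couplings of bit-coded spaces\<close>

text \<open>Starting at 0 gives the empty maximum a value, and the recursion lets the pseudometric
  laws and measurability follow by induction on \<open>n\<close>.\<close>

primrec maxdiff :: "(nat \<Rightarrow> 'a \<Rightarrow> real) \<Rightarrow> nat \<Rightarrow> 'a \<Rightarrow> 'a \<Rightarrow> real" where
  "maxdiff h 0 x y = 0"
| "maxdiff h (Suc n) x y = max (maxdiff h n x y) \<bar>h n x - h n y\<bar>"

lemma maxdiff_nonneg: "0 \<le> maxdiff h n x y"
  by (induction n) auto

lemma maxdiff_commute: "maxdiff h n x y = maxdiff h n y x"
  by (induction n) (auto simp: abs_minus_commute)

lemma maxdiff_triangle: "maxdiff h n x z \<le> maxdiff h n x y + maxdiff h n y z"
  by (induction n) (auto simp: max_def)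

lemma maxdiff_ge: "k < n \<Longrightarrow> \<bar>h k x - h k y\<bar> \<le> maxdiff h n x y"
  by (induction n) (auto simp: less_Suc_eq max_def)

lemma maxdiff_le: "0 \<le> c \<Longrightarrow> (\<And>k. k < n \<Longrightarrow> \<bar>h k x - h k y\<bar> \<le> c) \<Longrightarrow> maxdiff h n x y \<le> c"
  by (induction n) auto

lemma maxdiff_mono: "m \<le> n \<Longrightarrow> maxdiff h m x y \<le> maxdiff h n x y"
  by (meson maxdiff_ge maxdiff_le maxdiff_nonneg order_less_le_trans)

text \<open>For the interpolation of two prescribed values: a single function realises the distance
  of the given pair, while its differences stay below \<open>maxdiff\<close> at all other
  pairs.\<close>

lemma maxdiff_attained:
  "maxdiff h n x y = 0 \<or> (\<exists>k<n. maxdiff h n x y = \<bar>h k x - h k y\<bar>)"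
  by (induction n) (auto simp: max_def less_Suc_eq)

lemma maxdiff_quadrangle:
  "\<bar>maxdiff h n x y - maxdiff h n x' y'\<bar> \<le> maxdiff h n x x' + maxdiff h n y y'"
  using maxdiff_triangle[of h n x y x'] maxdiff_triangle[of h n x' y y']
    maxdiff_triangle[of h n x' y' x] maxdiff_triangle[of h n x y' y]
    maxdiff_commute[of h n x' x] maxdiff_commute[of h n y' y] by linarith

lemma borel_measurable_maxdiff [measurable]:
  assumes "\<And>k. h k \<in> borel_measurable M" and "f \<in> N \<rightarrow>\<^sub>M M" and "g \<in> N \<rightarrow>\<^sub>M M"
  shows "(\<lambda>z. maxdiff h n (f z) (g z)) \<in> borel_measurable N"
proof (induction n)
  case (Suc n)
  have [measurable]: "(\<lambda>z. h n (f z)) \<in> borel_measurable N" "(\<lambda>z. h n (g z)) \<in> borel_measurable N"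
    using assms by (auto intro: measurable_compose)
  from Suc show ?case by simp
qed simp

lemma integrable_bounded:
  fixes F :: "'b \<Rightarrow> real"
  assumes "prob_space \<mu>" and "F \<in> borel_measurable \<mu>" and "\<And>x. x \<in> space \<mu> \<Longrightarrow> \<bar>F x\<bar> \<le> B"
  shows "integrable \<mu> F"
proof -
  interpret prob_space \<mu> by fact
  show ?thesis using assms by (intro integrable_const_bound[where B = B]) auto
qed

text \<open>The events \<open>A n\<close> are the bits of a code for the points of the space, and \<open>R\<close> is the decoder.\<close>

locale bit_coded =
  fixes M :: "'a measure" and A :: "nat \<Rightarrow> 'a set" and R :: "(nat \<Rightarrow> bool) \<Rightarrow> 'a" and h :: "nat \<Rightarrow> 'a \<Rightarrow> real"
  assumes A [measurable]: "\<And>n. A n \<in> sets M"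
    and R [measurable]: "R \<in> bit_space \<rightarrow>\<^sub>M M"
    and R_bits: "\<And>x. x \<in> space M \<Longrightarrow> R (\<lambda>n. x \<in> A n) = x"
    and h [measurable]: "\<And>k. h k \<in> borel_measurable M"
    and h01: "\<And>k x. x \<in> space M \<Longrightarrow> 0 \<le> h k x \<and> h k x \<le> 1"
    and sep: "\<And>k e. 0 < e \<Longrightarrow> \<exists>n. \<forall>x\<in>space M. \<forall>y\<in>space M.
                (\<forall>i<n. x \<in> A i \<longleftrightarrow> y \<in> A i) \<longrightarrow> \<bar>h k x - h k y\<bar> \<le> e"
begin

definition bits :: "'a \<Rightarrow> nat \<Rightarrow> bool" where
  "bits x = (\<lambda>n. x \<in> A n)"

lemma bits_measurable [measurable]: "bits \<in> M \<rightarrow>\<^sub>M bit_space"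
  by (rule measurable_into_bit_space) (simp add: bits_def)

lemma R_bits': "x \<in> space M \<Longrightarrow> R (bits x) = x"
  by (simp add: bits_def R_bits)

lemma maxdiff_le_1: "x \<in> space M \<Longrightarrow> y \<in> space M \<Longrightarrow> maxdiff h n x y \<le> 1"
  by (rule maxdiff_le) (simp, smt (verit) h01)

text \<open>The property \<open>sep\<close> of single functions passes to finite maxima by taking
  the longer prefix. The lower bound \<open>m\<close> on the prefix length allows
  \<open>finite_stage\<close> to use a partition finer than all cylinders of depth
  \<open>N\<close>.\<close>

lemma maxdiff_sep:
  assumes "0 < e"
  shows "\<exists>n\<ge>m. \<forall>x\<in>space M. \<forall>y\<in>space M. rprefix (bits x) n = rprefix (bits y) n \<longrightarrow> maxdiff h N x y \<le> e"
proof (induction N)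
  case 0
  then show ?case using assms by auto
next
  case (Suc N)
  then obtain n where n: "n \<ge> m"
    "\<And>x y. x \<in> space M \<Longrightarrow> y \<in> space M \<Longrightarrow> rprefix (bits x) n = rprefix (bits y) n \<Longrightarrow> maxdiff h N x y \<le> e"
    by blast
  obtain n' where n': "\<And>x y. x \<in> space M \<Longrightarrow> y \<in> space M \<Longrightarrow> (\<forall>i<n'. x \<in> A i \<longleftrightarrow> y \<in> A i) \<Longrightarrow> \<bar>h N x - h N y\<bar> \<le> e"
    using sep[OF assms, of N] by blast
  show ?case
  proof (intro exI[of _ "max n n'"] conjI ballI impI)
    fix x y assume xy: "x \<in> space M" "y \<in> space M" and eq: "rprefix (bits x) (max n n') = rprefix (bits y) (max n n')"
    from eq have "rprefix (bits x) n = rprefix (bits y) n" "\<forall>i<n'. x \<in> A i \<longleftrightarrow> y \<in> A i"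
      by (auto simp: rprefix_eq_iff bits_def)
    then show "maxdiff h (Suc N) x y \<le> e" using n(2) n' xy by simp
  qed (use n in auto)
qed

text \<open>Points with the same first \<open>n\<close> bits form finitely many cells of diameter at
  most \<open>\<epsilon> / 2\<close>. One representative per cell reduces the problem to finite
  weights, where \<open>transport_duality_approx\<close> applies. As \<open>n \<ge> N\<close>, every
  cylinder of depth at most \<open>N\<close> is a union of cells, so errors on the cells control
  errors on these cylinders.\<close>

lemma finite_stage:
  assumes \<mu>: "prob_space \<mu>" "sets \<mu> = sets M" and \<nu>: "prob_space \<nu>" "sets \<nu> = sets M"
    and dual: "\<And>F. F \<in> borel_measurable M \<Longrightarrow>
        (\<And>x y. x \<in> space M \<Longrightarrow> y \<in> space M \<Longrightarrow> \<bar>F x - F y\<bar> \<le> maxdiff h N x y) \<Longrightarrow>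
        (\<integral>x. F x \<partial>\<mu>) - (\<integral>x. F x \<partial>\<nu>) \<le> L"
    and \<epsilon>: "0 < \<epsilon>"
  shows "\<exists>S \<pi>. finite S \<and> S \<subseteq> space M \<and> (\<forall>z. 0 \<le> \<pi> z) \<and>
           (\<Sum>i\<in>S. \<Sum>j\<in>S. \<pi> (i, j) * maxdiff h N i j) \<le> L + \<epsilon> \<and>
           (\<forall>m s. m \<le> N \<longrightarrow> length s = m \<longrightarrow>
              \<bar>(\<Sum>i\<in>S. \<Sum>j\<in>S. \<pi> (i, j) * of_bool (rprefix (bits i) m = s)) -
               measure \<mu> {x \<in> space M. rprefix (bits x) m = s}\<bar> \<le> \<epsilon> \<and>
              \<bar>(\<Sum>i\<in>S. \<Sum>j\<in>S. \<pi> (i, j) * of_bool (rprefix (bits j) m = s)) -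
               measure \<nu> {x \<in> space M. rprefix (bits x) m = s}\<bar> \<le> \<epsilon>)"
proof -
  interpret \<mu>: prob_space \<mu> by fact
  interpret \<nu>: prob_space \<nu> by fact
  have sp: "space \<mu> = space M" "space \<nu> = space M"
    using \<mu>(2) \<nu>(2) by (auto dest: sets_eq_imp_space_eq)
  obtain n where n: "N \<le> n" and sepn: "\<And>x y. x \<in> space M \<Longrightarrow> y \<in> space M \<Longrightarrow>
      rprefix (bits x) n = rprefix (bits y) n \<Longrightarrow> maxdiff h N x y \<le> \<epsilon> / 2"
    using maxdiff_sep[of "\<epsilon> / 2" N N] \<epsilon> by auto
  define pre where "pre x = rprefix (bits x) n" for x
  define rep where "rep s = (SOME x. x \<in> space M \<and> pre x = s)" for s
  define S where "S = rep ` (pre ` space M)"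
  have rep: "rep (pre x) \<in> space M \<and> pre (rep (pre x)) = pre x" if "x \<in> space M" for x
    unfolding rep_def using that by (rule_tac someI_ex) auto
  have SM: "S \<subseteq> space M" using rep by (auto simp: S_def)
  have fin: "finite S"
    unfolding S_def
    by (intro finite_imageI finite_subset[OF _ finite_bool_lists[of n]]) (auto simp: pre_def)
  have rep_pre: "rep (pre i) = i" if "i \<in> S" for i
  proof -
    from that obtain x where x: "x \<in> space M" "i = rep (pre x)" by (auto simp: S_def)
    then show ?thesis using rep[OF x(1)] by simp
  qed
  have inj: "i = j" if "i \<in> S" "j \<in> S" "pre i = pre j" for i j
    using rep_pre[OF that(1)] rep_pre[OF that(2)] that(3) by metis
  have cover: "\<exists>i\<in>S. pre i = pre x" if "x \<in> space M" for x
    using that rep by (auto simp: S_def)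
  have Sne: "S \<noteq> {}" using \<mu>.not_empty sp by (auto simp: S_def)
  define C where "C i = {x \<in> space M. pre x = pre i}" for i
  have C [measurable]: "C i \<in> sets M" for i
  proof -
    have "bits -` {y. rprefix y n = pre i} \<inter> space M \<in> sets M"
      by (rule measurable_sets[OF bits_measurable sets_rprefix])
    then show ?thesis by (simp add: C_def pre_def vimage_def Int_def conj_commute)
  qed
  have disj: "disjoint_family_on C S"
    unfolding disjoint_family_on_def
  proof (intro ballI impI)
    fix i j assume "i \<in> S" "j \<in> S" "i \<noteq> j"
    then have "pre i \<noteq> pre j" using inj by blast
    then show "C i \<inter> C j = {}" by (auto simp: C_def)
  qed
  have D_C: "maxdiff h N x i \<le> \<epsilon> / 2" "maxdiff h N i x \<le> \<epsilon> / 2" if "i \<in> S" "x \<in> C i" for x i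
    using that sepn[of x i] sepn[of i x] SM by (auto simp: C_def pre_def)
  define p where "p i = measure \<mu> (C i)" for i
  define q where "q i = measure \<nu> (C i)" for i
  have step: "(\<integral>x. (\<Sum>i\<in>S. f i * indicator (C i) x) \<partial>\<rho>) = (\<Sum>i\<in>S. measure \<rho> (C i) * f i)"
    "integrable \<rho> (\<lambda>x. \<Sum>i\<in>S. f i * indicator (C i) x)"
    if "prob_space \<rho>" "sets \<rho> = sets M" for \<rho> :: "'a measure" and f :: "'a \<Rightarrow> real"
  proof -
    interpret \<rho>: prob_space \<rho> by fact
    have [simp]: "C i \<in> sets \<rho>" for i using that C by simp
    have i: "integrable \<rho> (\<lambda>x. f i * indicator (C i) x)" for i
      by (intro integrable_mult_right integrable_real_indicator) (auto simp: \<rho>.emeasure_eq_measure)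
    then show "integrable \<rho> (\<lambda>x. \<Sum>i\<in>S. f i * indicator (C i) x)" by auto
    have "C i \<inter> space \<rho> = C i" for i
      using sets_eq_imp_space_eq[OF that(2)] by (auto simp: C_def)
    then show "(\<integral>x. (\<Sum>i\<in>S. f i * indicator (C i) x) \<partial>\<rho>) = (\<Sum>i\<in>S. measure \<rho> (C i) * f i)"
      using i by (subst Bochner_Integration.integral_sum) (auto simp: mult.commute)
  qed
  have step_eq: "(\<Sum>i\<in>S. f i * indicator (C i) x) = f j" if "j \<in> S" "x \<in> C j" for f :: "'a \<Rightarrow> real" and x j
  proof -
    have "(\<Sum>i\<in>S. f i * indicator (C i) x) = (\<Sum>i\<in>S. if i = j then f i else 0)"
      using that inj by (intro sum.cong refl) (auto simp: C_def indicator_def)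
    then show ?thesis using that fin by simp
  qed
  have cell: "\<exists>j\<in>S. x \<in> C j" if "x \<in> space M" for x
    using cover[OF that] that unfolding C_def by (metis (mono_tags, lifting) mem_Collect_eq)
  have dualS: "(\<Sum>i\<in>S. p i * u i) + (\<Sum>j\<in>S. q j * v j) \<le> L + \<epsilon>"
    if uv: "\<And>i j. i \<in> S \<Longrightarrow> j \<in> S \<Longrightarrow> u i + v j \<le> maxdiff h N i j" for u v :: "'a \<Rightarrow> real"
  proof -
    \<comment> \<open>The inf-convolution of \<open>- v\<close> with the pseudometric. It extends
      the potential from the representatives to a 1-Lipschitz function on the whole space, which is
      the kind of test function that \<open>dual\<close> accepts.\<close>
    define F where "F x = Min ((\<lambda>j. maxdiff h N x j - v j) ` S)" for x
    have F_le: "F x \<le> maxdiff h N x j - v j" if "j \<in> S" for x j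
      unfolding F_def using fin that by (intro Min_le) auto
    have F_ge: "c \<le> F x" if "\<And>j. j \<in> S \<Longrightarrow> c \<le> maxdiff h N x j - v j" for c x
      unfolding F_def using fin Sne that by (intro Min.boundedI) auto
    have Lip: "F x - F y \<le> maxdiff h N x y" for x y
    proof -
      have "F x - maxdiff h N x y \<le> F y"
      proof (rule F_ge)
        show "F x - maxdiff h N x y \<le> maxdiff h N y j - v j" if "j \<in> S" for j
          using F_le[OF that, of x] maxdiff_triangle[of h N x j y] by linarith
      qed
      then show ?thesis by simp
    qed
    then have Lip': "\<bar>F x - F y\<bar> \<le> maxdiff h N x y" for x y
      using Lip[of x y] Lip[of y x] maxdiff_commute[of h N x y] by linarith
    have Fm [measurable]: "F \<in> borel_measurable M"
      unfolding F_def using fin SM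
      by (intro borel_measurable_Min borel_measurable_diff borel_measurable_maxdiff[where M = M]) auto
    obtain x0 where x0: "x0 \<in> space M" using Sne SM by auto
    have Fb: "\<bar>F x\<bar> \<le> \<bar>F x0\<bar> + 1" if "x \<in> space M" for x
      using Lip'[of x x0] maxdiff_le_1[OF that x0, of N] by linarith
    have "F \<in> borel_measurable \<mu>" "F \<in> borel_measurable \<nu>"
      using Fm \<mu>(2) \<nu>(2) by (metis measurable_cong_sets)+
    then have Fi: "integrable \<mu> F" "integrable \<nu> F"
      using \<mu> \<nu> Fb sp by (auto intro!: integrable_bounded[where B = "\<bar>F x0\<bar> + 1"])
    \<comment> \<open>Up to the cell diameter \<open>\<epsilon> / 2\<close>, \<open>F\<close> lies
      above \<open>u\<close> and below \<open>- v\<close> on each cell. One such error for each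
      marginal turns the bound \<open>L\<close> into \<open>L + \<epsilon>\<close>.\<close>
    have "(\<Sum>i\<in>S. p i * u i) - \<epsilon> / 2 = (\<integral>x. (\<Sum>i\<in>S. u i * indicator (C i) x) - \<epsilon> / 2 \<partial>\<mu>)"
      using step[OF \<mu>] by (simp add: p_def \<mu>.prob_space)
    also have "\<dots> \<le> (\<integral>x. F x \<partial>\<mu>)"
    proof (rule integral_mono)
      fix x assume "x \<in> space \<mu>"
      then obtain j where j: "j \<in> S" "x \<in> C j" using cell[of x] sp by auto
      have "u j - \<epsilon> / 2 \<le> F x"
      proof (rule F_ge)
        show "u j - \<epsilon> / 2 \<le> maxdiff h N x k - v k" if "k \<in> S" for k
          using uv[OF j(1) that] D_C[OF j] maxdiff_triangle[of h N j k x] by linarith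
      qed
      then show "(\<Sum>i\<in>S. u i * indicator (C i) x) - \<epsilon> / 2 \<le> F x" by (simp add: step_eq[OF j])
    qed (use step[OF \<mu>] Fi in auto)
    finally have 1: "(\<Sum>i\<in>S. p i * u i) - \<epsilon> / 2 \<le> (\<integral>x. F x \<partial>\<mu>)" .
    have "(\<integral>x. F x \<partial>\<nu>) \<le> (\<integral>x. \<epsilon> / 2 - (\<Sum>i\<in>S. v i * indicator (C i) x) \<partial>\<nu>)"
    proof (rule integral_mono)
      fix x assume "x \<in> space \<nu>"
      then obtain j where j: "j \<in> S" "x \<in> C j" using cell[of x] sp by auto
      show "F x \<le> \<epsilon> / 2 - (\<Sum>i\<in>S. v i * indicator (C i) x)"
        using F_le[OF j(1), of x] D_C[OF j] by (simp add: step_eq[OF j])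
    qed (use step[OF \<nu>] Fi in auto)
    also have "\<dots> = \<epsilon> / 2 - (\<Sum>j\<in>S. q j * v j)"
      using step[OF \<nu>] by (simp add: q_def \<nu>.prob_space)
    finally show ?thesis using 1 dual[OF Fm Lip'] by simp
  qed
  \<comment> \<open>The tolerance per cell, so that the errors over any union of cells add up to at
    most \<open>\<epsilon>\<close>.\<close>
  define \<eta> where "\<eta> = \<epsilon> / real (card S)"
  have card: "0 < real (card S)" using fin Sne by (simp add: card_gt_0_iff)
  have \<eta>: "0 < \<eta>" using \<epsilon> card by (simp add: \<eta>_def)
  obtain \<pi> where \<pi>: "\<And>z. 0 \<le> \<pi> z"
      "\<And>i. i \<in> S \<Longrightarrow> \<bar>(\<Sum>j\<in>S. \<pi> (i, j)) - p i\<bar> \<le> \<eta>"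
      "\<And>j. j \<in> S \<Longrightarrow> \<bar>(\<Sum>i\<in>S. \<pi> (i, j)) - q j\<bar> \<le> \<eta>"
      "(\<Sum>i\<in>S. \<Sum>j\<in>S. \<pi> (i, j) * maxdiff h N i j) \<le> L + \<epsilon>"
    using transport_duality_approx[of S "maxdiff h N" p q "L + \<epsilon>" \<eta>, OF fin maxdiff_nonneg _ _ dualS \<eta>]
    by (auto simp: p_def q_def)
  have cyl: "measure \<rho> {x \<in> space M. rprefix (bits x) m = s} =
      (\<Sum>i\<in>S. of_bool (rprefix (bits i) m = s) * measure \<rho> (C i))"
    if \<rho>: "prob_space \<rho>" "sets \<rho> = sets M" and m: "m \<le> N" for \<rho> :: "'a measure" and m s
  proof -
    interpret \<rho>: prob_space \<rho> by fact
    define S' where "S' = {i \<in> S. rprefix (bits i) m = s}"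
    have same: "rprefix (bits x) m = rprefix (bits i) m" if "x \<in> C i" for x i
      using that m n by (auto simp: C_def pre_def rprefix_eq_iff)
    have "{x \<in> space M. rprefix (bits x) m = s} = (\<Union>i\<in>S'. C i)"
    proof (intro subset_antisym subsetI)
      fix x assume "x \<in> {x \<in> space M. rprefix (bits x) m = s}"
      then have x: "x \<in> space M" "rprefix (bits x) m = s" by auto
      then obtain i where "i \<in> S" "x \<in> C i" using cell by blast
      then show "x \<in> (\<Union>i\<in>S'. C i)" using same[of x i] x by (auto simp: S'_def)
    next
      fix x assume "x \<in> (\<Union>i\<in>S'. C i)"
      then show "x \<in> {x \<in> space M. rprefix (bits x) m = s}"
        using same[of x] unfolding S'_def C_def by fastforce
    qed
    also have "measure \<rho> \<dots> = (\<Sum>i\<in>S'. measure \<rho> (C i))"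
      using fin disj C \<rho> by (intro \<rho>.finite_measure_finite_Union) (auto simp: S'_def disjoint_family_on_def)
    also have "\<dots> = (\<Sum>i\<in>S. of_bool (rprefix (bits i) m = s) * measure \<rho> (C i))"
      unfolding S'_def using fin by (simp add: sum.inter_filter of_bool_def if_distrib[of "\<lambda>c. c * _"] cong: if_cong)
    finally show ?thesis .
  qed
  have err: "\<bar>(\<Sum>i\<in>S. of_bool (P i) * a i) - (\<Sum>i\<in>S. of_bool (P i) * b i)\<bar> \<le> \<epsilon>"
    if "\<And>i. i \<in> S \<Longrightarrow> \<bar>a i - b i\<bar> \<le> \<eta>" for a b :: "'a \<Rightarrow> real" and P
  proof -
    have "\<bar>(\<Sum>i\<in>S. of_bool (P i) * a i) - (\<Sum>i\<in>S. of_bool (P i) * b i)\<bar> =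
        \<bar>\<Sum>i\<in>S. of_bool (P i) * (a i - b i)\<bar>"
      by (simp add: sum_subtractf right_diff_distrib)
    also have "\<dots> \<le> (\<Sum>i\<in>S. \<bar>of_bool (P i) * (a i - b i)\<bar>)" by (rule sum_abs)
    also have "\<dots> \<le> (\<Sum>i\<in>S. \<eta>)" using that \<eta> by (intro sum_mono) (auto simp: abs_mult)
    also have "\<dots> = \<epsilon>" using card by (simp add: \<eta>_def)
    finally show ?thesis .
  qed
  show ?thesis
  proof (intro exI[of _ S] exI[of _ \<pi>] conjI allI impI)
    fix m and s :: "bool list" assume m: "m \<le> N"
    have "(\<Sum>i\<in>S. \<Sum>j\<in>S. \<pi> (i, j) * of_bool (rprefix (bits i) m = s)) =
        (\<Sum>i\<in>S. of_bool (rprefix (bits i) m = s) * (\<Sum>j\<in>S. \<pi> (i, j)))"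
      unfolding sum_distrib_left by (simp add: mult.commute)
    then show "\<bar>(\<Sum>i\<in>S. \<Sum>j\<in>S. \<pi> (i, j) * of_bool (rprefix (bits i) m = s)) -
        measure \<mu> {x \<in> space M. rprefix (bits x) m = s}\<bar> \<le> \<epsilon>"
      unfolding cyl[OF \<mu> m] using err[OF \<pi>(2)] by (simp add: p_def)
    have "(\<Sum>i\<in>S. \<Sum>j\<in>S. \<pi> (i, j) * of_bool (rprefix (bits j) m = s)) =
        (\<Sum>j\<in>S. of_bool (rprefix (bits j) m = s) * (\<Sum>i\<in>S. \<pi> (i, j)))"
      unfolding sum_distrib_left by (subst sum.swap) (simp add: mult.commute)
    then show "\<bar>(\<Sum>i\<in>S. \<Sum>j\<in>S. \<pi> (i, j) * of_bool (rprefix (bits j) m = s)) -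
        measure \<nu> {x \<in> space M. rprefix (bits x) m = s}\<bar> \<le> \<epsilon>"
      unfolding cyl[OF \<nu> m] using err[OF \<pi>(3)] by (simp add: q_def)
  qed (use \<pi> fin SM in auto)
qed

end

section \<open>Pairs of bit sequences as one bit sequence\<close>

definition even_bits :: "(nat \<Rightarrow> bool) \<Rightarrow> nat \<Rightarrow> bool" where
  "even_bits x = (\<lambda>k. x (2 * k))"

definition odd_bits :: "(nat \<Rightarrow> bool) \<Rightarrow> nat \<Rightarrow> bool" where
  "odd_bits x = (\<lambda>k. x (2 * k + 1))"

definition interleave :: "(nat \<Rightarrow> bool) \<Rightarrow> (nat \<Rightarrow> bool) \<Rightarrow> nat \<Rightarrow> bool" where
  "interleave x y = (\<lambda>k. if even k then x (k div 2) else y (k div 2))"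

lemma even_bits_interleave [simp]: "even_bits (interleave x y) = x"
  and odd_bits_interleave [simp]: "odd_bits (interleave x y) = y"
  by (auto simp: even_bits_def odd_bits_def interleave_def)

lemma measurable_even_bits [measurable]: "even_bits \<in> bit_space \<rightarrow>\<^sub>M bit_space"
  and measurable_odd_bits [measurable]: "odd_bits \<in> bit_space \<rightarrow>\<^sub>M bit_space"
  by (rule measurable_into_bit_space, simp add: even_bits_def odd_bits_def)+

text \<open>Convergence is known only for functions of a prefix, so the half of the bits must be
  readable from a prefix of length \<open>2 * n\<close>. The \<open>rev\<close> is there because
  prefixes list the most recent bit first.\<close>

definition even_prefix :: "nat \<Rightarrow> bool list \<Rightarrow> bool list" where
  "even_prefix n l = rprefix (\<lambda>k. rev l ! (2 * k)) n"

definition odd_prefix :: "nat \<Rightarrow> bool list \<Rightarrow> bool list" where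
  "odd_prefix n l = rprefix (\<lambda>k. rev l ! (2 * k + 1)) n"

lemma even_prefix_rprefix [simp]: "even_prefix n (rprefix x (2 * n)) = rprefix (even_bits x) n"
  unfolding even_prefix_def rprefix_eq_iff even_bits_def by (auto simp: rprefix_nth[symmetric])

lemma odd_prefix_rprefix [simp]: "odd_prefix n (rprefix x (2 * n)) = rprefix (odd_bits x) n"
  unfolding odd_prefix_def rprefix_eq_iff odd_bits_def by (auto simp: rprefix_nth[symmetric])

context bit_coded
begin

text \<open>Since \<open>R\<close> undoes \<open>bits\<close>, decoding a half whose law is that of
  the codes under a marginal gives back this marginal. The same identity shows that
  \<open>bits (R y) = y\<close> holds almost surely under the law of the codes, and equality of laws
  transfers this to both halves of the limit.\<close>

lemma coupling_of_stages:
  assumes \<mu>: "prob_space \<mu>" "sets \<mu> = sets M" and \<nu>: "prob_space \<nu>" "sets \<nu> = sets M"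
    and M': "prob_space M'" "sets M' = sets bit_space"
    and E: "distr M' bit_space even_bits = distr \<mu> bit_space bits"
    and O: "distr M' bit_space odd_bits = distr \<nu> bit_space bits"
  defines "\<gamma> \<equiv> distr M' (\<mu> \<Otimes>\<^sub>M \<nu>) (\<lambda>z. (R (even_bits z), R (odd_bits z)))"
  shows "\<gamma> \<in> couplings \<mu> \<nu>"
    and "AE z in M'. bits (R (even_bits z)) = even_bits z"
    and "AE z in M'. bits (R (odd_bits z)) = odd_bits z"
proof -
  interpret M': prob_space M' by fact
  have sp: "space \<mu> = space M" "space \<nu> = space M"
    using \<mu>(2) \<nu>(2) by (auto dest: sets_eq_imp_space_eq)
  have M'm: "measurable M' N = measurable bit_space N" for N :: "'z measure"
    by (rule measurable_cong_sets[OF M'(2) refl])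
  have toM: "measurable N \<mu> = measurable N M" "measurable N \<nu> = measurable N M" for N :: "'z measure"
    by (rule measurable_cong_sets[OF refl \<mu>(2)], rule measurable_cong_sets[OF refl \<nu>(2)])
  have fromM: "measurable \<mu> N = measurable M N" "measurable \<nu> N = measurable M N" for N :: "'z measure"
    by (rule measurable_cong_sets[OF \<mu>(2) refl], rule measurable_cong_sets[OF \<nu>(2) refl])
  have E': "even_bits \<in> M' \<rightarrow>\<^sub>M bit_space" "odd_bits \<in> M' \<rightarrow>\<^sub>M bit_space"
    unfolding M'm by measurable
  have RE: "(\<lambda>z. R (even_bits z)) \<in> M' \<rightarrow>\<^sub>M \<mu>" "(\<lambda>z. R (odd_bits z)) \<in> M' \<rightarrow>\<^sub>M \<nu>"
    unfolding M'm toM by measurable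
  have pm: "(\<lambda>z. (R (even_bits z), R (odd_bits z))) \<in> M' \<rightarrow>\<^sub>M \<mu> \<Otimes>\<^sub>M \<nu>"
    using RE by (rule measurable_Pair)
  have law: "distr M' \<rho> (\<lambda>z. R (e z)) = \<rho>"
    if \<rho>: "sets \<rho> = sets M" and e: "e \<in> M' \<rightarrow>\<^sub>M bit_space"
      and eq: "distr M' bit_space e = distr \<rho> bit_space bits" for \<rho> e
  proof -
    have sp\<rho>: "space \<rho> = space M" using \<rho> by (rule sets_eq_imp_space_eq)
    have R\<rho>: "R \<in> bit_space \<rightarrow>\<^sub>M \<rho>" using R measurable_cong_sets[OF refl \<rho>] by blast
    have b\<rho>: "bits \<in> \<rho> \<rightarrow>\<^sub>M bit_space" using bits_measurable measurable_cong_sets[OF \<rho> refl] by blast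
    have "distr M' \<rho> (\<lambda>z. R (e z)) = distr (distr M' bit_space e) \<rho> R"
      using distr_distr[OF R\<rho> e] by (simp add: comp_def)
    also have "\<dots> = distr \<rho> \<rho> (\<lambda>x. R (bits x))"
      unfolding eq using distr_distr[OF R\<rho> b\<rho>] by (simp add: comp_def)
    also have "\<dots> = distr \<rho> \<rho> (\<lambda>x. x)"
      by (rule distr_cong) (auto simp: sp\<rho> R_bits')
    finally show ?thesis by (simp add: distr_id)
  qed
  show "\<gamma> \<in> couplings \<mu> \<nu>"
    unfolding couplings_def
  proof (intro CollectI conjI)
    show "prob_space \<gamma>" unfolding \<gamma>_def by (rule M'.prob_space_distr[OF pm])
    show "sets \<gamma> = sets (\<mu> \<Otimes>\<^sub>M \<nu>)" by (simp add: \<gamma>_def)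
    have "distr \<gamma> \<mu> fst = distr M' \<mu> (\<lambda>z. R (even_bits z))"
      unfolding \<gamma>_def by (subst distr_distr[OF measurable_fst pm]) (simp add: comp_def)
    then show "distr \<gamma> \<mu> fst = \<mu>" using law[OF \<mu>(2) E'(1) E] by simp
    have "distr \<gamma> \<nu> snd = distr M' \<nu> (\<lambda>z. R (odd_bits z))"
      unfolding \<gamma>_def by (subst distr_distr[OF measurable_snd pm]) (simp add: comp_def)
    then show "distr \<gamma> \<nu> snd = \<nu>" using law[OF \<nu>(2) E'(2) O] by simp
  qed
  have coh: "AE z in M'. bits (R (e z)) = e z"
    if \<rho>: "sets \<rho> = sets M" and e: "e \<in> M' \<rightarrow>\<^sub>M bit_space"
      and eq: "distr M' bit_space e = distr \<rho> bit_space bits" for \<rho> e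
  proof -
    have sp\<rho>: "space \<rho> = space M" using \<rho> by (rule sets_eq_imp_space_eq)
    have b\<rho>: "bits \<in> \<rho> \<rightarrow>\<^sub>M bit_space" using bits_measurable measurable_cong_sets[OF \<rho> refl] by blast
    have m: "Measurable.pred bit_space (\<lambda>y. \<forall>i. bits (R y) i = y i)"
    proof -
      have "(\<lambda>y. bits (R y) i) \<in> bit_space \<rightarrow>\<^sub>M count_space UNIV" for i
        by (rule measurable_compose[OF measurable_compose[OF R bits_measurable] measurable_bit])
      then show ?thesis by measurable
    qed
    have "AE y in distr \<rho> bit_space bits. \<forall>i. bits (R y) i = y i"
      using m by (subst AE_distr_iff[OF b\<rho>]) (auto simp: pred_def sp\<rho> R_bits')
    then have "AE y in distr M' bit_space e. \<forall>i. bits (R y) i = y i" unfolding eq .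
    then have "AE z in M'. \<forall>i. bits (R (e z)) i = e z i"
      using m by (subst (asm) AE_distr_iff[OF e]) (auto simp: pred_def)
    then show ?thesis by (simp add: fun_eq_iff)
  qed
  show "AE z in M'. bits (R (even_bits z)) = even_bits z" by (rule coh[OF \<mu>(2) E'(1) E])
  show "AE z in M'. bits (R (odd_bits z)) = odd_bits z" by (rule coh[OF \<nu>(2) E'(2) O])
qed

text \<open>\<open>\<Phi> N n G\<close> stands for the integral of \<open>G\<close>, as a function
  of \<open>2 * n\<close> bits, under the plan of stage \<open>N\<close>. The indicator of a
  cylinder in one half is such a function, by way of \<open>g\<close>, and the cylinder masses
  determine the law by \<open>bit_space_eqI\<close>.\<close>

lemma law_of_limit:
  assumes \<mu>: "prob_space \<mu>" "sets \<mu> = sets M"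
    and M': "prob_space M'" "sets M' = sets bit_space" and e: "e \<in> bit_space \<rightarrow>\<^sub>M bit_space"
    and pre: "\<And>n x. g n (rprefix x (2 * n)) = rprefix (e x) n"
    and lim: "\<And>n (G :: bool list \<Rightarrow> real). (\<lambda>N. \<Phi> N n G) \<longlonglongrightarrow> (\<integral>x. G (rprefix x (2 * n)) \<partial>M')"
    and val: "\<And>n s. length s = n \<Longrightarrow>
      (\<lambda>N. \<Phi> N n (\<lambda>l. of_bool (g n l = s))) \<longlonglongrightarrow> measure \<mu> {x \<in> space M. rprefix (bits x) n = s}"
  shows "distr M' bit_space e = distr \<mu> bit_space bits"
proof (rule bit_space_eqI)
  interpret M': prob_space M' by fact
  interpret \<mu>: prob_space \<mu> by fact
  have e': "e \<in> M' \<rightarrow>\<^sub>M bit_space" using e measurable_cong_sets[OF M'(2) refl] by blast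
  have b\<mu>: "bits \<in> \<mu> \<rightarrow>\<^sub>M bit_space" using bits_measurable measurable_cong_sets[OF \<mu>(2) refl] by blast
  show "prob_space (distr M' bit_space e)" by (rule M'.prob_space_distr[OF e'])
  show "prob_space (distr \<mu> bit_space bits)" by (rule \<mu>.prob_space_distr[OF b\<mu>])
  fix n and s :: "bool list" assume s: "length s = n"
  have spM': "space M' = UNIV" using sets_eq_imp_space_eq[OF M'(2)] by (simp add: space_bit_space)
  have sp\<mu>: "space \<mu> = space M" using sets_eq_imp_space_eq[OF \<mu>(2)] .
  have "(\<integral>x. of_bool (g n (rprefix x (2 * n)) = s) \<partial>M') = (\<integral>x. indicator {x. rprefix (e x) n = s} x \<partial>M')"
    by (intro Bochner_Integration.integral_cong refl) (simp add: pre indicator_def)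
  also have "\<dots> = measure M' {x. rprefix (e x) n = s}" by (simp add: spM')
  finally have "measure M' {x. rprefix (e x) n = s} = measure \<mu> {x \<in> space M. rprefix (bits x) n = s}"
    using LIMSEQ_unique[OF lim val[OF s]] by simp
  then show "measure (distr M' bit_space e) {x. rprefix x n = s} =
      measure (distr \<mu> bit_space bits) {x. rprefix x n = s}"
    by (simp add: measure_distr[OF e' sets_rprefix] measure_distr[OF b\<mu> sets_rprefix] spM' sp\<mu> vimage_def Int_def conj_commute)
qed simp_all

text \<open>Stage \<open>N\<close> is solved for the cost \<open>maxdiff h N\<close> with tolerance
  \<open>1 / real (Suc N)\<close>. Both the cost and the depth of the controlled cylinders grow
  along the sequence, so one limit plan has the right marginals and bounds all truncated costs at
  once.\<close>

theorem optimal_coupling_exists: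
  assumes \<mu>: "prob_space \<mu>" "sets \<mu> = sets M" and \<nu>: "prob_space \<nu>" "sets \<nu> = sets M"
    and dual: "\<And>N F. F \<in> borel_measurable M \<Longrightarrow>
        (\<And>x y. x \<in> space M \<Longrightarrow> y \<in> space M \<Longrightarrow> \<bar>F x - F y\<bar> \<le> maxdiff h N x y) \<Longrightarrow>
        (\<integral>x. F x \<partial>\<mu>) - (\<integral>x. F x \<partial>\<nu>) \<le> L"
  shows "\<exists>\<gamma>\<in>couplings \<mu> \<nu>. \<forall>N. (\<integral>(x, y). maxdiff h N x y \<partial>\<gamma>) \<le> L"
proof -
  interpret \<mu>: prob_space \<mu> by fact
  interpret \<nu>: prob_space \<nu> by fact
  have sp: "space \<mu> = space M" "space \<nu> = space M"
    using \<mu>(2) \<nu>(2) by (auto dest: sets_eq_imp_space_eq)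
  define Q where "Q N S \<pi> \<longleftrightarrow> finite S \<and> S \<subseteq> space M \<and> (\<forall>z. 0 \<le> \<pi> z) \<and>
           (\<Sum>i\<in>S. \<Sum>j\<in>S. \<pi> (i, j) * maxdiff h N i j) \<le> L + 1 / real (Suc N) \<and>
           (\<forall>m s. m \<le> N \<longrightarrow> length s = m \<longrightarrow>
              \<bar>(\<Sum>i\<in>S. \<Sum>j\<in>S. \<pi> (i, j) * of_bool (rprefix (bits i) m = s)) -
               measure \<mu> {x \<in> space M. rprefix (bits x) m = s}\<bar> \<le> 1 / real (Suc N) \<and>
              \<bar>(\<Sum>i\<in>S. \<Sum>j\<in>S. \<pi> (i, j) * of_bool (rprefix (bits j) m = s)) -
               measure \<nu> {x \<in> space M. rprefix (bits x) m = s}\<bar> \<le> 1 / real (Suc N))"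
    for N S \<pi>
  have "\<forall>N. \<exists>S \<pi>. Q N S \<pi>"
    unfolding Q_def by (intro allI finite_stage[OF \<mu> \<nu> dual]) auto
  then obtain S \<pi> where Q: "\<And>N. Q N (S N) (\<pi> N)" by metis
  have fin: "finite (S N)" and SM: "S N \<subseteq> space M" and \<pi>0: "0 \<le> \<pi> N z"
    and cost: "(\<Sum>i\<in>S N. \<Sum>j\<in>S N. \<pi> N (i, j) * maxdiff h N i j) \<le> L + 1 / real (Suc N)" for N z
    using Q[of N] unfolding Q_def by blast+
  have left: "\<bar>(\<Sum>i\<in>S N. \<Sum>j\<in>S N. \<pi> N (i, j) * of_bool (rprefix (bits i) m = s)) -
               measure \<mu> {x \<in> space M. rprefix (bits x) m = s}\<bar> \<le> 1 / real (Suc N)"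
    and right: "\<bar>(\<Sum>i\<in>S N. \<Sum>j\<in>S N. \<pi> N (i, j) * of_bool (rprefix (bits j) m = s)) -
               measure \<nu> {x \<in> space M. rprefix (bits x) m = s}\<bar> \<le> 1 / real (Suc N)"
    if "m \<le> N" "length s = m" for N m s
    using Q[of N] that unfolding Q_def by blast+
  have small: "f \<longlonglongrightarrow> c" if "\<And>N. m \<le> N \<Longrightarrow> \<bar>f N - c\<bar> \<le> 1 / real (Suc N)" for f :: "nat \<Rightarrow> real" and c m
  proof -
    have "(\<lambda>N. f N - c) \<longlonglongrightarrow> 0"
      by (rule tendsto_0_le[where K = 1, OF LIMSEQ_inverse_real_of_nat])
        (use that in \<open>auto simp: eventually_sequentially inverse_eq_divide intro!: exI[of _ m]\<close>)
    then show ?thesis by (simp add: LIM_zero_iff)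
  qed
  define X where "X z = interleave (bits (fst z)) (bits (snd z))" for z
  \<comment> \<open>Total mass is the marginal estimate for the empty prefix.\<close>
  have tot: "(\<lambda>N. \<Sum>z\<in>S N \<times> S N. \<pi> N z) \<longlonglongrightarrow> 1"
    using small[of 0 "\<lambda>N. \<Sum>z\<in>S N \<times> S N. \<pi> N z" 1] left[of 0 _ "[]"]
    by (simp add: sum.cartesian_product case_prod_beta sp(1)[symmetric] \<mu>.prob_space)
  obtain r M' where r: "strict_mono r" and M': "prob_space M'" "sets M' = sets bit_space"
    and lim: "\<And>n (G :: bool list \<Rightarrow> real). (\<lambda>N. \<Sum>z\<in>S (r N) \<times> S (r N). \<pi> (r N) z * G (rprefix (X z) n)) \<longlonglongrightarrow>
           (\<integral>x. G (rprefix x n) \<partial>M')"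
    using cantor_compactness[of "\<lambda>N. S N \<times> S N" \<pi> X] fin \<pi>0 tot by blast
  interpret M': prob_space M' by fact
  have E: "distr M' bit_space even_bits = distr \<mu> bit_space bits"
  proof (rule law_of_limit[OF \<mu> M' measurable_even_bits even_prefix_rprefix lim])
    fix n and s :: "bool list" assume "length s = n"
    then show "(\<lambda>N. \<Sum>z\<in>S (r N) \<times> S (r N). \<pi> (r N) z * of_bool (even_prefix n (rprefix (X z) (2 * n)) = s))
        \<longlonglongrightarrow> measure \<mu> {x \<in> space M. rprefix (bits x) n = s}"
      using LIMSEQ_subseq_LIMSEQ[OF small[OF left] r]
      by (simp add: X_def comp_def sum.cartesian_product case_prod_beta)
  qed
  have O: "distr M' bit_space odd_bits = distr \<nu> bit_space bits"
  proof (rule law_of_limit[OF \<nu> M' measurable_odd_bits odd_prefix_rprefix lim])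
    fix n and s :: "bool list" assume "length s = n"
    then show "(\<lambda>N. \<Sum>z\<in>S (r N) \<times> S (r N). \<pi> (r N) z * of_bool (odd_prefix n (rprefix (X z) (2 * n)) = s))
        \<longlonglongrightarrow> measure \<nu> {x \<in> space M. rprefix (bits x) n = s}"
      using LIMSEQ_subseq_LIMSEQ[OF small[OF right] r]
      by (simp add: X_def comp_def sum.cartesian_product case_prod_beta)
  qed
  define \<gamma> where "\<gamma> = distr M' (\<mu> \<Otimes>\<^sub>M \<nu>) (\<lambda>z. (R (even_bits z), R (odd_bits z)))"
  note coupling = coupling_of_stages[OF \<mu> \<nu> M' E O, folded \<gamma>_def]
  have R_space: "R y \<in> space M" for y
    using measurable_space[OF R, of y] by (simp add: space_bit_space)
  have pm: "(\<lambda>z. (R (even_bits z), R (odd_bits z))) \<in> M' \<rightarrow>\<^sub>M \<mu> \<Otimes>\<^sub>M \<nu>"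
  proof -
    have "(\<lambda>z. (R (even_bits z), R (odd_bits z))) \<in> bit_space \<rightarrow>\<^sub>M M \<Otimes>\<^sub>M M" by measurable
    moreover have "sets (\<mu> \<Otimes>\<^sub>M \<nu>) = sets (M \<Otimes>\<^sub>M M)" using \<mu> \<nu> by (intro sets_pair_measure_cong)
    ultimately show ?thesis using measurable_cong_sets[OF M'(2)] by blast
  qed
  have h': "h k \<in> borel_measurable \<mu>" "h k \<in> borel_measurable \<nu>" for k
    using h[of k] measurable_cong_sets[OF \<mu>(2) refl] measurable_cong_sets[OF \<nu>(2) refl] by blast+
  have D_int: "(\<integral>(x, y). maxdiff h N x y \<partial>\<gamma>) \<le> L" for N
  proof (rule field_le_epsilon)
    fix e :: real assume "0 < e"
    then have e4: "0 < e / 4" by simp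
    \<comment> \<open>Moving both arguments by \<open>e / 4\<close> changes \<open>maxdiff\<close>
      by at most \<open>e / 2\<close>. This error is paid twice, once under the limit measure and
      once under the plans, which makes \<open>e\<close>.\<close>
    obtain n where n: "\<And>x y. x \<in> space M \<Longrightarrow> y \<in> space M \<Longrightarrow> rprefix (bits x) n = rprefix (bits y) n \<Longrightarrow>
        maxdiff h N x y \<le> e / 4"
      using maxdiff_sep[OF e4, of 0 N] by auto
    \<comment> \<open>Picks a point for every prefix that occurs; its value at other prefixes is
      never compared with anything.\<close>
    define \<rho> where "\<rho> s = (SOME x. x \<in> space M \<and> rprefix (bits x) n = s)" for s
    have \<rho>: "\<rho> (rprefix (bits x) n) \<in> space M \<and> rprefix (bits (\<rho> (rprefix (bits x) n))) n = rprefix (bits x) n"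
      if "x \<in> space M" for x
      unfolding \<rho>_def using that by (rule_tac someI_ex) auto
    define G where "G l = maxdiff h N (\<rho> (even_prefix n l)) (\<rho> (odd_prefix n l))" for l
    have approx: "\<bar>G (rprefix (interleave (bits x) (bits y)) (2 * n)) - maxdiff h N x y\<bar> \<le> e / 2"
      if "x \<in> space M" "y \<in> space M" for x y
    proof -
      let ?x = "\<rho> (rprefix (bits x) n)" and ?y = "\<rho> (rprefix (bits y) n)"
      have "maxdiff h N ?x x \<le> e / 4" "maxdiff h N ?y y \<le> e / 4"
        using n[of ?x x] n[of ?y y] \<rho>[OF that(1)] \<rho>[OF that(2)] that by blast+
      then show ?thesis
        using maxdiff_quadrangle[of h N ?x ?y x y] by (simp add: G_def)
    qed
    have G_meas: "(\<lambda>z. G (rprefix z (2 * n))) \<in> borel_measurable M'"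
    proof -
      have "(\<lambda>z. G (rprefix z (2 * n))) \<in> borel_measurable bit_space"
        by (rule measurable_compose[OF measurable_rprefix]) simp
      then show ?thesis using measurable_cong_sets[OF M'(2) refl] by blast
    qed
    have D_meas: "(\<lambda>(x, y). maxdiff h N x y) \<in> borel_measurable (\<mu> \<Otimes>\<^sub>M \<nu>)"
    proof -
      have "(\<lambda>z. maxdiff h N (fst z) (snd z)) \<in> borel_measurable (M \<Otimes>\<^sub>M M)" by measurable
      moreover have "sets (\<mu> \<Otimes>\<^sub>M \<nu>) = sets (M \<Otimes>\<^sub>M M)" using \<mu> \<nu> by (intro sets_pair_measure_cong)
      ultimately have "(\<lambda>z. maxdiff h N (fst z) (snd z)) \<in> borel_measurable (\<mu> \<Otimes>\<^sub>M \<nu>)"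
        using measurable_cong_sets[of "\<mu> \<Otimes>\<^sub>M \<nu>" "M \<Otimes>\<^sub>M M" borel borel] by blast
      then show ?thesis by (simp add: case_prod_beta)
    qed
    \<comment> \<open>The approximation is valid for codes of points only. Almost surely both halves
      of \<open>z\<close> are the codes of their decoded points, so it carries over to the limit
      measure.\<close>
    have AE: "AE z in M'. \<bar>G (rprefix z (2 * n)) - maxdiff h N (R (even_bits z)) (R (odd_bits z))\<bar> \<le> e / 2"
      using coupling(2,3)
    proof eventually_elim
      case (elim z)
      then show ?case
        using approx[of "R (even_bits z)" "R (odd_bits z)"] R_space by (simp add: G_def)
    qed
    have D_comp: "(\<lambda>z. maxdiff h N (R (even_bits z)) (R (odd_bits z))) \<in> borel_measurable M'"
      using measurable_compose[OF pm D_meas] by simp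
    have iD: "integrable M' (\<lambda>z. maxdiff h N (R (even_bits z)) (R (odd_bits z)))"
      using D_comp maxdiff_le_1[OF R_space R_space]
      by (intro integrable_bounded[OF M'(1), where B = 1]) (simp_all add: abs_of_nonneg[OF maxdiff_nonneg])
    have iG: "integrable M' (\<lambda>z. G (rprefix z (2 * n)))"
    proof (rule M'.integrable_const_bound[where B = "1 + e / 2"])
      show "AE z in M'. norm (G (rprefix z (2 * n))) \<le> 1 + e / 2"
        using AE
      proof eventually_elim
        case (elim z)
        then show ?case
          using maxdiff_le_1[OF R_space R_space, of N "even_bits z" "odd_bits z"]
            maxdiff_nonneg[of h N "R (even_bits z)" "R (odd_bits z)"]
          unfolding real_norm_def by linarith
      qed
    qed (rule G_meas)
    have "(\<integral>(x, y). maxdiff h N x y \<partial>\<gamma>) = (\<integral>z. maxdiff h N (R (even_bits z)) (R (odd_bits z)) \<partial>M')"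
      unfolding \<gamma>_def by (subst integral_distr[OF pm D_meas]) simp
    also have "\<dots> \<le> (\<integral>z. G (rprefix z (2 * n)) + e / 2 \<partial>M')"
    proof (rule integral_mono_AE)
      show "AE z in M'. maxdiff h N (R (even_bits z)) (R (odd_bits z)) \<le> G (rprefix z (2 * n)) + e / 2"
        using AE by eventually_elim linarith
    qed (use iD iG in auto)
    also have "\<dots> = (\<integral>z. G (rprefix z (2 * n)) \<partial>M') + e / 2"
      using iG by (simp add: M'.prob_space)
    also have "(\<integral>z. G (rprefix z (2 * n)) \<partial>M') \<le> L + e / 2"
    proof (rule LIMSEQ_le[OF lim])
      let ?t = "\<lambda>K. \<Sum>z\<in>S (r K) \<times> S (r K). \<pi> (r K) z"
      have "(\<lambda>K. 1 / real (Suc (r K))) \<longlonglongrightarrow> 0"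
        using LIMSEQ_subseq_LIMSEQ[OF LIMSEQ_inverse_real_of_nat r] by (simp add: comp_def inverse_eq_divide)
      moreover have "?t \<longlonglongrightarrow> 1" using LIMSEQ_subseq_LIMSEQ[OF tot r] by (simp add: comp_def)
      ultimately have "(\<lambda>K. L + 1 / real (Suc (r K)) + e / 2 * ?t K) \<longlonglongrightarrow> L + 0 + e / 2 * 1"
        by (intro tendsto_intros)
      then show "(\<lambda>K. L + 1 / real (Suc (r K)) + e / 2 * ?t K) \<longlonglongrightarrow> L + e / 2" by simp
      show "\<exists>K0. \<forall>K\<ge>K0. (\<Sum>z\<in>S (r K) \<times> S (r K). \<pi> (r K) z * G (rprefix (X z) (2 * n)))
          \<le> L + 1 / real (Suc (r K)) + e / 2 * ?t K"
      proof (intro exI[of _ N] allI impI)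
        fix K assume "N \<le> K"
        \<comment> \<open>From here on the plan of stage \<open>r K\<close> was made for a cost that
          dominates \<open>maxdiff h N\<close>, so its cost bound applies to the smaller cost as
          well.\<close>
        then have NK: "N \<le> r K" using seq_suble[OF r, of K] by simp
        have "(\<Sum>z\<in>S (r K) \<times> S (r K). \<pi> (r K) z * G (rprefix (X z) (2 * n)))
            \<le> (\<Sum>z\<in>S (r K) \<times> S (r K). \<pi> (r K) z * maxdiff h (r K) (fst z) (snd z) + e / 2 * \<pi> (r K) z)"
        proof (rule sum_mono)
          fix z assume z: "z \<in> S (r K) \<times> S (r K)"
          then have "fst z \<in> space M" "snd z \<in> space M" using SM[of "r K"] by auto
          then have "G (rprefix (X z) (2 * n)) \<le> maxdiff h (r K) (fst z) (snd z) + e / 2"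
            using approx[of "fst z" "snd z"] maxdiff_mono[OF NK, of h "fst z" "snd z"]
            unfolding X_def by linarith
          from mult_left_mono[OF this \<pi>0[of "r K" z]]
          show "\<pi> (r K) z * G (rprefix (X z) (2 * n))
              \<le> \<pi> (r K) z * maxdiff h (r K) (fst z) (snd z) + e / 2 * \<pi> (r K) z"
            by (simp add: algebra_simps)
        qed
        also have "\<dots> \<le> L + 1 / real (Suc (r K)) + e / 2 * ?t K"
          using cost[of "r K"]
          by (simp add: sum.distrib sum_distrib_left sum.cartesian_product case_prod_beta)
        finally show "(\<Sum>z\<in>S (r K) \<times> S (r K). \<pi> (r K) z * G (rprefix (X z) (2 * n)))
            \<le> L + 1 / real (Suc (r K)) + e / 2 * ?t K" .
      qed
    qed
    finally show "(\<integral>(x, y). maxdiff h N x y \<partial>\<gamma>) \<le> L + e" by simp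
  qed
  show ?thesis using coupling(1) D_int by blast
qed

end

section \<open>Coding continuous paths by bits\<close>

lemma closure_rational_interval:
  fixes T :: real
  assumes "0 < T"
  shows "closure (\<rat> \<inter> {0..T}) = {0..T}"
proof
  show "closure (\<rat> \<inter> {0..T}) \<subseteq> {0..T}"
    by (rule closure_minimal) auto
  have "{0..T} = closure ({0<..<T} \<inter> \<rat>)"
    using assms closure_open_Int_superset[of "{0<..<T}" "\<rat>"] by (simp add: Rats_closure_real)
  also have "\<dots> \<subseteq> closure (\<rat> \<inter> {0..T})"
    by (rule closure_mono) auto
  finally show "{0..T} \<subseteq> closure (\<rat> \<inter> {0..T})" .
qed

definition rational_time :: "nat \<Rightarrow> real" where
  "rational_time = from_nat_into (\<rat> \<inter> {0..})"

lemma range_rational_time: "range rational_time = \<rat> \<inter> {0..}"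
  unfolding rational_time_def
  by (rule range_from_nat_into) (auto intro: countable_rat)

lemma rational_time_nonneg: "0 \<le> rational_time i"
  using range_rational_time by (metis IntD2 atLeast_iff rangeI)

definition rational_level :: "nat \<Rightarrow> real" where
  "rational_level = from_nat_into (\<rat> \<inter> {0..1})"

lemma range_rational_level: "range rational_level = \<rat> \<inter> {0..1}"
  unfolding rational_level_def
  by (rule range_from_nat_into) (auto intro: countable_rat Rats_0)

lemma rational_level_bounds: "0 \<le> rational_level l" "rational_level l \<le> 1"
  using range_rational_level by (metis IntD2 atLeastAtMost_iff rangeI)+

text \<open>Compact time intervals are where a path has compact range and its coordinates are
  uniformly continuous.\<close>

lemma continuous_on_times_iff:
  fixes f :: "real \<Rightarrow> 'b::topological_space"
  shows "continuous_on {0..} f \<longleftrightarrow> (\<forall>T::nat. continuous_on {0..real T} f)"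
proof
  assume R: "\<forall>T::nat. continuous_on {0..real T} f"
  show "continuous_on {0..} f"
    unfolding continuous_on_eq_continuous_within
  proof
    fix t :: real assume t: "t \<in> {0..}"
    obtain T :: nat where T: "t < real T" using reals_Archimedean2 by blast
    have "at t within {0..} = at t within {0..real T}"
      by (rule at_within_nhd[of _ "{..<real T}"]) (use T t in auto)
    then show "continuous (at t within {0..}) f"
      using R t T unfolding continuous_on_eq_continuous_within by auto
  qed
qed (auto intro: continuous_on_subset)

lemma space_trajectory_space: "space trajectory_space = trajectories"
  by (auto simp: trajectory_space_def space_measure_of_conv)

lemma trajectory_generators:
  "{{\<omega> \<in> trajectories. \<omega> t \<in> B} | t B. 0 \<le> t \<and> B \<in> sets borel} \<subseteq> Pow trajectories"
  by auto

lemma measurable_evaluation [measurable]: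
  assumes "0 \<le> t"
  shows "(\<lambda>\<omega>. \<omega> t) \<in> trajectory_space \<rightarrow>\<^sub>M borel"
proof (rule measurableI)
  fix B assume B: "B \<in> sets (borel :: 'a measure)"
  have "(\<lambda>\<omega>. \<omega> t) -` B \<inter> space trajectory_space = {\<omega> \<in> trajectories. \<omega> t \<in> B}"
    by (auto simp: space_trajectory_space)
  then show "(\<lambda>\<omega>. \<omega> t) -` B \<inter> space trajectory_space \<in> sets trajectory_space"
    unfolding trajectory_space_def sets_measure_of[OF trajectory_generators]
    using B assms by (auto intro!: sigma_sets.Basic)
qed simp

lemma measurable_into_trajectory_space:
  assumes "\<And>x. x \<in> space M \<Longrightarrow> f x \<in> trajectories"
    and "\<And>t. 0 \<le> t \<Longrightarrow> (\<lambda>x. f x t) \<in> M \<rightarrow>\<^sub>M borel"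
  shows "f \<in> M \<rightarrow>\<^sub>M trajectory_space"
  unfolding trajectory_space_def
proof (rule measurable_measure_of[OF trajectory_generators])
  show "f \<in> space M \<rightarrow> trajectories" using assms by auto
  fix y assume "y \<in> {{\<omega> \<in> trajectories. \<omega> t \<in> B} | t B. 0 \<le> t \<and> B \<in> sets (borel :: 'b measure)}"
  then obtain t B where tB: "0 \<le> t" "B \<in> sets borel" "y = {\<omega> \<in> trajectories. \<omega> t \<in> B}" by blast
  have "f -` y \<inter> space M = (\<lambda>x. f x t) -` B \<inter> space M" using assms(1) tB by auto
  also have "\<dots> \<in> sets M" using measurable_sets[OF assms(2)[OF tB(1)] tB(2)] .
  finally show "f -` y \<inter> space M \<in> sets M" .
qed

section \<open>State space coordinates and paths as tables of reals\<close>

locale lc_state_space = Metric_space "UNIV :: 'e set" \<Delta>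
  for \<Delta> :: "'e::{t2_space, second_countable_topology} \<Rightarrow> 'e \<Rightarrow> real" +
  assumes lc: "locally_compact_space (euclidean :: 'e topology)"
    and mtop: "mtopology = (euclidean :: 'e topology)"
    and dist_le_1: "\<Delta> x y \<le> 1"
begin

lemma open_iff: "open U \<longleftrightarrow> (\<forall>x\<in>U. \<exists>r>0. \<forall>y. \<Delta> x y < r \<longrightarrow> y \<in> U)"
proof -
  have "open U \<longleftrightarrow> openin mtopology U" by (simp add: mtop)
  then show ?thesis by (auto simp: openin_mtopology mball_def subset_iff)
qed

lemma continuous_iff:
  fixes f :: "'e \<Rightarrow> real"
  shows "continuous_on UNIV f \<longleftrightarrow> (\<forall>x. \<forall>e>0. \<exists>r>0. \<forall>y. \<Delta> x y < r \<longrightarrow> \<bar>f y - f x\<bar> < e)"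
proof
  assume f: "continuous_on UNIV f"
  show "\<forall>x. \<forall>e>0. \<exists>r>0. \<forall>y. \<Delta> x y < r \<longrightarrow> \<bar>f y - f x\<bar> < e"
  proof (intro allI impI)
    fix x and e :: real assume e: "0 < e"
    have "open (f -` ball (f x) e)" using f by (simp add: continuous_on_open_vimage)
    moreover have "x \<in> f -` ball (f x) e" using e by simp
    ultimately obtain r where "r > 0" "\<And>y. \<Delta> x y < r \<Longrightarrow> y \<in> f -` ball (f x) e"
      unfolding open_iff by blast
    then show "\<exists>r>0. \<forall>y. \<Delta> x y < r \<longrightarrow> \<bar>f y - f x\<bar> < e"
      by (auto simp: dist_real_def abs_minus_commute)
  qed
next
  assume R: "\<forall>x. \<forall>e>0. \<exists>r>0. \<forall>y. \<Delta> x y < r \<longrightarrow> \<bar>f y - f x\<bar> < e"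
  have "open (f -` B)" if B: "open B" for B
    unfolding open_iff
  proof
    fix x assume "x \<in> f -` B"
    then obtain e where e: "e > 0" "ball (f x) e \<subseteq> B" using B by (auto simp: open_contains_ball)
    then obtain r where r: "r > 0" "\<And>y. \<Delta> x y < r \<Longrightarrow> \<bar>f y - f x\<bar> < e" using R by meson
    have "y \<in> f -` B" if "\<Delta> x y < r" for y
      using e r(2)[OF that] by (auto simp: dist_real_def abs_minus_commute subset_iff)
    then show "\<exists>r>0. \<forall>y. \<Delta> x y < r \<longrightarrow> y \<in> f -` B" using r by blast
  qed
  then show "continuous_on UNIV f" by (simp add: continuous_on_open_vimage)
qed

lemma dist_triangle: "\<Delta> x z \<le> \<Delta> x y + \<Delta> y z"
  by (rule triangle) auto

lemma continuous_dist: "continuous_on UNIV (\<Delta> x)"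
  unfolding continuous_iff
proof (intro allI impI)
  fix y and e :: real assume "0 < e"
  moreover have "\<bar>\<Delta> x z - \<Delta> x y\<bar> \<le> \<Delta> y z" for z
    using dist_triangle[of x z y] dist_triangle[of x y z] commute[of z y] by linarith
  ultimately show "\<exists>r>0. \<forall>z. \<Delta> y z < r \<longrightarrow> \<bar>\<Delta> x z - \<Delta> x y\<bar> < e"
    by (meson order_le_less_trans)
qed

lemma ex_dense_sequence: "\<exists>z :: nat \<Rightarrow> 'e. \<forall>x. \<forall>r>0. \<exists>k. \<Delta> x (z k) < r"
proof -
  obtain D :: "'e set" where D: "countable D" "\<And>U. open U \<Longrightarrow> U \<noteq> {} \<Longrightarrow> \<exists>d\<in>D. d \<in> U"
    using countable_dense_setE by blast
  have Dne: "D \<noteq> {}" using D(2)[of UNIV] by auto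
  have "\<exists>k. \<Delta> x (from_nat_into D k) < r" if r: "r > 0" for x r
  proof -
    have "open {y. \<Delta> x y < r}"
      using openin_mball[of x r] by (simp add: mtop mball_def)
    moreover have "{y. \<Delta> x y < r} \<noteq> {}" using r by (auto intro!: exI[of _ x])
    ultimately obtain d where "d \<in> D" "\<Delta> x d < r" using D(2)[of "{y. \<Delta> x y < r}"] by blast
    then show ?thesis using from_nat_into_surj[OF D(1)] by metis
  qed
  then show ?thesis by blast
qed

definition dense_seq :: "nat \<Rightarrow> 'e" where
  "dense_seq = (SOME z. \<forall>x. \<forall>r>0. \<exists>k. \<Delta> x (z k) < r)"

lemma dense_seq: "r > 0 \<Longrightarrow> \<exists>k. \<Delta> x (dense_seq k) < r"
  unfolding dense_seq_def using someI_ex[OF ex_dense_sequence] by blast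

text \<open>Distances to a dense sequence serve as coordinates in [0,1]: they separate states, and
  their sublevel sets at rational levels form a base. This reduces measurability and continuity
  questions about states to real numbers.\<close>

definition \<phi> :: "nat \<Rightarrow> 'e \<Rightarrow> real" where
  "\<phi> k x = \<Delta> (dense_seq k) x"

lemma continuous_\<phi>: "continuous_on UNIV (\<phi> k)"
  unfolding \<phi>_def by (rule continuous_dist)

lemma \<phi>_bounds: "0 \<le> \<phi> k x" "\<phi> k x \<le> 1"
  by (auto simp: \<phi>_def dist_le_1)

lemma \<phi>_base:
  assumes "open U" and "x \<in> U"
  obtains k l where "\<phi> k x < rational_level l" and "\<And>y. \<phi> k y < rational_level l \<Longrightarrow> y \<in> U"
proof -
  obtain r where r: "r > 0" "\<And>y. \<Delta> x y < r \<Longrightarrow> y \<in> U" using assms open_iff by blast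
  \<comment> \<open>Half of \<open>r\<close> leaves room for the triangle inequality; the cap by 1
    keeps the level \<open>q\<close> within the range of \<open>rational_level\<close>.\<close>
  obtain k where k: "\<Delta> x (dense_seq k) < min 1 r / 2" using dense_seq[of "min 1 r / 2" x] r by auto
  obtain q where q: "q \<in> \<rat>" "\<Delta> x (dense_seq k) < q" "q < min 1 r / 2" using Rats_dense_in_real[OF k] by blast
  have "q \<in> range rational_level"
    unfolding range_rational_level using q order_trans[OF nonneg[of x "dense_seq k"] less_imp_le[OF q(2)]] by auto
  then obtain l where l: "q = rational_level l" by blast
  show thesis
  proof (rule that)
    show "\<phi> k x < rational_level l" using q l by (simp add: \<phi>_def commute[of "dense_seq k"])
    fix y assume "\<phi> k y < rational_level l"
    then have "\<Delta> x y < r"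
      using q l k dist_triangle[of x y "dense_seq k"] by (simp add: \<phi>_def)
    then show "y \<in> U" by (rule r)
  qed
qed

lemma \<phi>_separates:
  assumes "\<And>k. \<phi> k x = \<phi> k y"
  shows "x = y"
proof (rule ccontr)
  assume "x \<noteq> y"
  then have "x \<in> - {y}" by simp
  moreover have "open (- {y})" using closed_singleton by (simp add: open_Compl)
  ultimately obtain k l where "\<phi> k x < rational_level l" "\<And>w. \<phi> k w < rational_level l \<Longrightarrow> w \<in> - {y}"
    using \<phi>_base[of "- {y}" x] by blast
  then show False using assms[of k] by auto
qed

definition embed :: "'e \<Rightarrow> nat \<Rightarrow> real" where
  "embed x = (\<lambda>k. \<phi> k x)"

lemma continuous_embed: "continuous_on S embed"
  unfolding embed_def
  by (intro continuous_on_coordinatewise_then_product continuous_on_subset[OF continuous_\<phi>]) auto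

lemma inj_embed: "embed x = embed y \<Longrightarrow> x = y"
  by (rule \<phi>_separates) (metis embed_def)

text \<open>By Lindelof, countably many open sets with compact supersets cover the space, and finite
  unions of these supersets absorb any compact set. A continuous path on a compact interval thus
  stays in one of countably many sets, a condition fit for a measurable description.\<close>

lemma ex_exhaustion: "\<exists>K :: nat \<Rightarrow> 'e set. (\<forall>j. compact (K j)) \<and> (\<forall>C. compact C \<longrightarrow> (\<exists>j. C \<subseteq> K j))"
proof -
  define \<F> where "\<F> = {U :: 'e set. open U \<and> (\<exists>V. compact V \<and> U \<subseteq> V)}"
  have cover: "\<Union>\<F> = UNIV"
    using lc unfolding locally_compact_space_def \<F>_def by fastforce
  obtain \<F>' where F': "\<F>' \<subseteq> \<F>" "countable \<F>'" "\<Union>\<F>' = \<Union>\<F>"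
    using Lindelof[of \<F>] by (auto simp: \<F>_def)
  then have ne: "\<F>' \<noteq> {}" using cover by auto
  define U where "U = from_nat_into \<F>'"
  have U: "open (U i)" "\<exists>V. compact V \<and> U i \<subseteq> V" for i
    using from_nat_into[OF ne, of i] F' by (auto simp: \<F>_def U_def)
  have UU: "(\<Union>i. U i) = UNIV"
    using range_from_nat_into[OF ne F'(2)] F' cover by (simp add: U_def)
  obtain V where V: "\<And>i. compact (V i)" "\<And>i. U i \<subseteq> V i" using U(2) by metis
  have "\<exists>j. C \<subseteq> (\<Union>i\<le>j. V i)" if C: "compact C" for C
  proof -
    obtain I where I: "finite I" "C \<subseteq> (\<Union>i\<in>I. U i)"
      using compactE_image[OF C, of UNIV U] U UU by auto
    then obtain j where "I \<subseteq> {..j}" using finite_nat_iff_bounded_le by blast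
    then have "C \<subseteq> (\<Union>i\<le>j. U i)" using I by blast
    also have "\<dots> \<subseteq> (\<Union>i\<le>j. V i)" by (rule UN_mono) (use V in auto)
    finally show ?thesis by (intro exI[of _ j])
  qed
  moreover have "compact (\<Union>i\<le>j. V i)" for j using V by (intro compact_UN) auto
  ultimately show ?thesis by (intro exI[of _ "\<lambda>j. \<Union>i\<le>j. V i"] conjI allI impI)
qed

definition K :: "nat \<Rightarrow> 'e set" where
  "K = (SOME K. (\<forall>j. compact (K j)) \<and> (\<forall>C. compact C \<longrightarrow> (\<exists>j. C \<subseteq> K j)))"

lemma compact_K: "compact (K j)"
  and K_exhausts: "compact C \<Longrightarrow> \<exists>j. C \<subseteq> K j"
  unfolding K_def using someI_ex[OF ex_exhaustion] by blast+

lemma closed_embed_K: "closed (embed ` K j)"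
  by (intro compact_imp_closed compact_continuous_image continuous_embed compact_K)

text \<open>Describes the tables \<open>a i k\<close> of the values of \<open>\<phi> k\<close> along continuous paths at rational times by
  countably many conditions, so that the set of these tables is measurable. Compactness of \<open>K j\<close> makes
  the uniformly continuous extension to real times stay in the range of \<open>embed\<close>.\<close>

definition path_table :: "(nat \<Rightarrow> nat \<Rightarrow> real) \<Rightarrow> bool" where
  "path_table a \<longleftrightarrow> (\<forall>T::nat. \<exists>j. (\<forall>i. rational_time i \<le> real T \<longrightarrow> a i \<in> embed ` K j) \<and>
     (\<forall>k m. \<exists>n. \<forall>i i'. rational_time i \<le> real T \<longrightarrow> rational_time i' \<le> real T \<longrightarrow>
        \<bar>rational_time i - rational_time i'\<bar> < 1 / real (Suc n) \<longrightarrow> \<bar>a i k - a i' k\<bar> \<le> 1 / real (Suc m)))"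

lemma path_table_of_path:
  assumes "\<omega> \<in> trajectories"
  shows "path_table (\<lambda>i. embed (\<omega> (rational_time i)))"
  unfolding path_table_def
proof
  fix T :: nat
  have cont: "continuous_on {0..real T} \<omega>"
    using assms by (auto simp: trajectories_def intro: continuous_on_subset)
  then have "compact (\<omega> ` {0..real T})" by (intro compact_continuous_image) auto
  then obtain j where j: "\<omega> ` {0..real T} \<subseteq> K j" using K_exhausts by blast
  show "\<exists>j. (\<forall>i. rational_time i \<le> real T \<longrightarrow> embed (\<omega> (rational_time i)) \<in> embed ` K j) \<and>
     (\<forall>k m. \<exists>n. \<forall>i i'. rational_time i \<le> real T \<longrightarrow> rational_time i' \<le> real T \<longrightarrow>
        \<bar>rational_time i - rational_time i'\<bar> < 1 / real (Suc n) \<longrightarrow>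
        \<bar>embed (\<omega> (rational_time i)) k - embed (\<omega> (rational_time i')) k\<bar> \<le> 1 / real (Suc m))"
  proof (rule exI[of _ j], rule conjI; intro allI)
    fix i
    show "rational_time i \<le> real T \<longrightarrow> embed (\<omega> (rational_time i)) \<in> embed ` K j"
      using j rational_time_nonneg[of i] by (intro impI imageI) auto
  next
    fix k m :: nat
    have "uniformly_continuous_on {0..real T} (\<lambda>t. \<phi> k (\<omega> t))"
      using cont by (intro compact_uniformly_continuous continuous_on_compose2[OF continuous_\<phi>]) auto
    then obtain d where d: "d > 0" "\<And>s t. s \<in> {0..real T} \<Longrightarrow> t \<in> {0..real T} \<Longrightarrow> dist s t < d \<Longrightarrow>
        dist (\<phi> k (\<omega> s)) (\<phi> k (\<omega> t)) < 1 / real (Suc m)"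
      unfolding uniformly_continuous_on_def by (metis of_nat_0_less_iff zero_less_Suc zero_less_divide_1_iff)
    obtain n where n: "1 / real (Suc n) < d" using d(1) nat_approx_posE by blast
    show "\<exists>n. \<forall>i i'. rational_time i \<le> real T \<longrightarrow> rational_time i' \<le> real T \<longrightarrow>
        \<bar>rational_time i - rational_time i'\<bar> < 1 / real (Suc n) \<longrightarrow>
        \<bar>embed (\<omega> (rational_time i)) k - embed (\<omega> (rational_time i')) k\<bar> \<le> 1 / real (Suc m)"
    proof (intro exI[of _ n] allI impI)
      fix i i' assume "rational_time i \<le> real T" "rational_time i' \<le> real T"
        "\<bar>rational_time i - rational_time i'\<bar> < 1 / real (Suc n)"
      then show "\<bar>embed (\<omega> (rational_time i)) k - embed (\<omega> (rational_time i')) k\<bar> \<le> 1 / real (Suc m)"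
        using d(2)[of "rational_time i" "rational_time i'"] n rational_time_nonneg
        by (auto simp: embed_def dist_real_def intro!: less_imp_le)
    qed
  qed
qed

lemma path_eqI:
  fixes w w' :: "real \<Rightarrow> 'e"
  assumes "continuous_on {0..T} w" and "continuous_on {0..T} w'" and T: "0 < T"
    and eq: "\<And>i. rational_time i \<le> T \<Longrightarrow> w (rational_time i) = w' (rational_time i)"
    and t: "0 \<le> t" "t \<le> T"
  shows "w t = w' t"
proof (rule \<phi>_separates)
  fix k
  have "continuous_on (closure (\<rat> \<inter> {0..T})) (\<lambda>t. \<phi> k (w t) - \<phi> k (w' t))"
    unfolding closure_rational_interval[OF T]
    by (intro continuous_on_diff continuous_on_compose2[OF continuous_\<phi>] assms) auto
  moreover have "\<phi> k (w s) - \<phi> k (w' s) = 0" if "s \<in> \<rat> \<inter> {0..T}" for s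
  proof -
    have "s \<in> range rational_time" using that by (auto simp: range_rational_time)
    then show ?thesis using eq that by auto
  qed
  moreover have "t \<in> closure (\<rat> \<inter> {0..T})" using t by (simp add: closure_rational_interval[OF T])
  ultimately show "\<phi> k (w t) = \<phi> k (w' t)"
    using continuous_constant_on_closure[of "\<rat> \<inter> {0..T}" "\<lambda>t. \<phi> k (w t) - \<phi> k (w' t)" 0 t] by simp
qed

lemma path_table_interval:
  assumes a: "path_table a"
  shows "\<exists>w. continuous_on {0..real (Suc T)} w \<and>
    (\<forall>i. rational_time i \<le> real (Suc T) \<longrightarrow> embed (w (rational_time i)) = a i)"
proof -
  let ?T = "real (Suc T)"
  obtain j where j: "\<And>i. rational_time i \<le> ?T \<Longrightarrow> a i \<in> embed ` K j"
    and uc: "\<And>k m. \<exists>n. \<forall>i i'. rational_time i \<le> ?T \<longrightarrow> rational_time i' \<le> ?T \<longrightarrow>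
        \<bar>rational_time i - rational_time i'\<bar> < 1 / real (Suc n) \<longrightarrow> \<bar>a i k - a i' k\<bar> \<le> 1 / real (Suc m)"
    using a unfolding path_table_def by blast
  define X where "X = \<rat> \<inter> {0..?T}"
  have clX: "closure X = {0..?T}" unfolding X_def by (rule closure_rational_interval) simp
  define idx where "idx t = (SOME i. rational_time i = t)" for t
  have idx: "rational_time (idx t) = t" if "t \<in> X" for t
  proof -
    have "t \<in> range rational_time" using that by (auto simp: X_def range_rational_time)
    then show ?thesis unfolding idx_def by (metis (mono_tags, lifting) imageE someI_ex)
  qed
  have X_T: "t \<le> ?T" if "t \<in> X" for t using that by (auto simp: X_def)
  have UC: "uniformly_continuous_on X (\<lambda>t. a (idx t) k)" for k
    unfolding uniformly_continuous_on_def
  proof (intro allI impI)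
    fix e :: real assume "0 < e"
    then obtain m where m: "1 / real (Suc m) < e" using nat_approx_posE by blast
    obtain n where n: "\<And>i i'. rational_time i \<le> ?T \<Longrightarrow> rational_time i' \<le> ?T \<Longrightarrow>
        \<bar>rational_time i - rational_time i'\<bar> < 1 / real (Suc n) \<Longrightarrow> \<bar>a i k - a i' k\<bar> \<le> 1 / real (Suc m)"
      using uc[of k m] by blast
    have "dist (a (idx s) k) (a (idx t) k) < e" if "s \<in> X" "t \<in> X" "dist s t < 1 / real (Suc n)" for s t
      using n[of "idx s" "idx t"] that m X_T by (simp add: idx dist_real_def)
    then show "\<exists>d>0. \<forall>x\<in>X. \<forall>x'\<in>X. dist x' x < d \<longrightarrow> dist (a (idx x') k) (a (idx x) k) < e"
      by (intro exI[of _ "1 / real (Suc n)"]) auto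
  qed
  have "\<forall>k. \<exists>g. uniformly_continuous_on {0..?T} g \<and> (\<forall>t\<in>X. a (idx t) k = g t)"
    using uniformly_continuous_on_extension_on_closure[OF UC] unfolding clX by metis
  then obtain g where g: "\<And>k. uniformly_continuous_on {0..?T} (g k)" "\<And>k t. t \<in> X \<Longrightarrow> a (idx t) k = g k t"
    by metis
  define G where "G t = (\<lambda>k. g k t)" for t
  have contG: "continuous_on {0..?T} G"
    unfolding G_def by (intro continuous_on_coordinatewise_then_product uniformly_continuous_imp_continuous g)
  have GX: "G t = a (idx t)" if "t \<in> X" for t using g(2)[OF that] by (auto simp: G_def)
  have G_im: "G ` {0..?T} \<subseteq> embed ` K j"
    unfolding clX[symmetric]
    by (rule image_closure_subset) (use contG closed_embed_K GX j idx X_T in \<open>auto simp: clX\<close>)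
  define \<psi> where "\<psi> = the_inv_into (K j) embed"
  have inj: "inj_on embed (K j)" by (rule inj_onI) (rule inj_embed)
  have cont\<psi>: "continuous_on (embed ` K j) \<psi>"
    unfolding \<psi>_def by (rule continuous_on_inv_into[OF continuous_embed compact_K inj])
  show ?thesis
  proof (intro exI[of _ "\<lambda>t. \<psi> (G t)"] conjI allI impI)
    show "continuous_on {0..?T} (\<lambda>t. \<psi> (G t))"
      by (rule continuous_on_compose2[OF cont\<psi> contG G_im])
    fix i assume i: "rational_time i \<le> ?T"
    define t where "t = rational_time i"
    have t: "t \<in> X" using range_rational_time i rational_time_nonneg[of i] unfolding t_def X_def by auto
    \<comment> \<open>Two indices of one time have gap 0, so the modulus of continuity for every
      \<open>m\<close> forces their entries to coincide; no injectivity of the enumeration is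
      invoked.\<close>
    have same: "a (idx t) = a i"
    proof
      fix k
      have "\<bar>a (idx t) k - a i k\<bar> \<le> 1 / real (Suc m)" for m
        using uc[of k m] i idx[OF t] by (auto simp: t_def)
      then have "\<bar>a (idx t) k - a i k\<bar> \<le> 0"
        by (intro LIMSEQ_le_const[OF LIMSEQ_inverse_real_of_nat]) (auto simp: inverse_eq_divide)
      then show "a (idx t) k = a i k" by simp
    qed
    have "G t \<in> embed ` K j" using G_im t by (auto simp: X_def)
    then have "embed (\<psi> (G t)) = G t"
      unfolding \<psi>_def by (rule f_the_inv_into_f[OF inj])
    then show "embed (\<psi> (G (rational_time i))) = a i"
      using GX[OF t] same by (simp add: t_def)
  qed
qed

lemma path_of_path_table:
  assumes a: "path_table a"
  shows "\<exists>\<omega>\<in>trajectories. \<forall>i. embed (\<omega> (rational_time i)) = a i"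
proof -
  obtain w where w: "\<And>T. continuous_on {0..real (Suc T)} (w T)"
    "\<And>T i. rational_time i \<le> real (Suc T) \<Longrightarrow> embed (w T (rational_time i)) = a i"
    using path_table_interval[OF a] by metis
  have agree: "w S t = w T t" if "S \<le> T" "0 \<le> t" "t \<le> real (Suc S)" for S T t
  proof (rule path_eqI[where T = "real (Suc S)"])
    show "continuous_on {0..real (Suc S)} (w T)"
      by (rule continuous_on_subset[OF w(1)[of T]]) (use that in auto)
    show "w S (rational_time i) = w T (rational_time i)" if "rational_time i \<le> real (Suc S)" for i
      using w(2)[of i S] w(2)[of i T] that \<open>S \<le> T\<close> by (intro inj_embed) simp
  qed (use w that in auto)
  \<comment> \<open>Glues the interval paths. \<open>w T\<close> lives on \<open>[0, T + 1]\<close>,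
    so the piece with index \<open>nat \<lceil>t\<rceil>\<close> is defined at \<open>t\<close>, and
    \<open>agree\<close> makes the choice of a larger index immaterial.\<close>
  define \<omega> where "\<omega> = restrict (\<lambda>t. w (nat \<lceil>t\<rceil>) t) {0..}"
  have \<omega>: "\<omega> t = w T t" if "0 \<le> t" "t \<le> real T" for t T
  proof -
    have "nat \<lceil>t\<rceil> \<le> T" using that by linarith
    moreover have "t \<le> real (Suc (nat \<lceil>t\<rceil>))" using that by linarith
    ultimately show ?thesis using agree that by (simp add: \<omega>_def)
  qed
  have "continuous_on {0..real T} \<omega>" for T
  proof -
    have "continuous_on {0..real T} (w T)" by (rule continuous_on_subset[OF w(1)]) auto
    then show ?thesis by (rule continuous_on_eq) (simp add: \<omega>[of _ T])
  qed
  then have "\<omega> \<in> trajectories"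
    unfolding trajectories_def continuous_on_times_iff by (auto simp: \<omega>_def)
  moreover have "embed (\<omega> (rational_time i)) = a i" for i
  proof -
    obtain T :: nat where T: "rational_time i \<le> real T" using real_arch_simple by blast
    then show ?thesis using w(2)[of i T] \<omega>[OF rational_time_nonneg T] by simp
  qed
  ultimately show ?thesis by blast
qed

lemma trajectory_eqI:
  assumes "\<omega> \<in> trajectories" and "\<omega>' \<in> trajectories"
    and eq: "\<And>i. embed (\<omega> (rational_time i)) = embed (\<omega>' (rational_time i))"
  shows "\<omega> = \<omega>'"
proof (rule extensionalityI)
  show "\<omega> \<in> extensional {0..}" "\<omega>' \<in> extensional {0..}" using assms by (auto simp: trajectories_def)
  fix t :: real assume t: "t \<in> {0..}"
  show "\<omega> t = \<omega>' t"
  proof (rule path_eqI[where T = "t + 1" and w = \<omega> and w' = \<omega>'])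
    show "continuous_on {0..t + 1} \<omega>" "continuous_on {0..t + 1} \<omega>'"
      using assms(1,2) unfolding trajectories_def by (auto elim: continuous_on_subset)
  qed (use t inj_embed[OF eq] in auto)
qed

end

section \<open>Measurable decoding of paths from bits\<close>

definition triple_encode :: "nat \<Rightarrow> nat \<Rightarrow> nat \<Rightarrow> nat" where
  "triple_encode i k l = prod_encode (i, prod_encode (k, l))"

definition triple_decode :: "nat \<Rightarrow> nat \<times> nat \<times> nat" where
  "triple_decode n = (let (i, m) = prod_decode n in (i, prod_decode m))"

lemma triple_decode_encode [simp]: "triple_decode (triple_encode i k l) = (i, k, l)"
  by (simp add: triple_decode_def triple_encode_def)

text \<open>Reconstructs a number in [0,1] from its comparisons with all rational levels. The
  default 0 keeps the supremum bounded and meaningful for bit sequences that arise from no number,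
  and gives the right value when no comparison holds.\<close>

definition level_sup :: "(nat \<Rightarrow> bool) \<Rightarrow> real" where
  "level_sup b = (SUP l. if b l then rational_level l else 0)"

lemma bdd_above_levels: "bdd_above (range (\<lambda>l. if b l then rational_level l else 0))"
  by (rule bdd_aboveI[of _ 1]) (auto simp: rational_level_bounds)

lemma level_sup_below:
  assumes "0 \<le> v" and "v \<le> 1"
  shows "level_sup (\<lambda>l. rational_level l < v) = v"
proof (rule antisym)
  show "level_sup (\<lambda>l. rational_level l < v) \<le> v"
    unfolding level_sup_def by (rule cSUP_least) (use assms in auto)
  show "v \<le> level_sup (\<lambda>l. rational_level l < v)"
  proof (rule dense_le)
    fix x assume "x < v"
    then obtain q where q: "q \<in> \<rat>" "x < q" "q < v" using Rats_dense_in_real by blast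
    have up: "(if rational_level l < v then rational_level l else 0) \<le> level_sup (\<lambda>l. rational_level l < v)" for l
      unfolding level_sup_def by (rule cSUP_upper[OF _ bdd_above_levels]) simp
    show "x \<le> level_sup (\<lambda>l. rational_level l < v)"
    proof (cases "0 \<le> q")
      case True
      then have "q \<in> range rational_level" unfolding range_rational_level using q assms by auto
      then obtain l where "q = rational_level l" by blast
      then show ?thesis using up[of l] q by simp
    next
      case False
      have "0 \<le> (if rational_level 0 < v then rational_level 0 else 0)"
        by (simp add: rational_level_bounds)
      then show ?thesis using up[of 0] q False by linarith
    qed
  qed
qed

lemma measurable_level_sup:
  assumes [measurable]: "\<And>l. Measurable.pred M (\<lambda>x. b x l)"
  shows "(\<lambda>x. level_sup (b x)) \<in> borel_measurable M"
  unfolding level_sup_def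
proof (rule borel_measurable_cSUP)
  show "(\<lambda>x. if b x l then rational_level l else 0) \<in> borel_measurable M" for l by measurable
  show "bdd_above ((\<lambda>l. if b x l then rational_level l else 0) ` UNIV)" for x by (rule bdd_above_levels)
qed simp

context lc_state_space
begin

definition path_event :: "nat \<Rightarrow> (real \<Rightarrow> 'e) set" where
  "path_event n = (case triple_decode n of (i, k, l) \<Rightarrow>
     {\<omega> \<in> trajectories. rational_level l < \<phi> k (\<omega> (rational_time i))})"

lemma measurable_\<phi> [measurable]: "\<phi> k \<in> borel_measurable borel"
  by (rule borel_measurable_continuous_onI[OF continuous_\<phi>])

lemma sets_path_event: "path_event n \<in> sets trajectory_space"
proof -
  obtain i k l where n: "triple_decode n = (i, k, l)" by (cases "triple_decode n")
  have [measurable]: "(\<lambda>\<omega>. \<omega> (rational_time i)) \<in> trajectory_space \<rightarrow>\<^sub>M (borel :: 'e measure)"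
    by (rule measurable_evaluation[OF rational_time_nonneg])
  have "{\<omega> \<in> space trajectory_space. rational_level l < \<phi> k (\<omega> (rational_time i))} \<in> sets trajectory_space"
    by measurable
  then show ?thesis by (simp add: path_event_def n space_trajectory_space)
qed

definition table_of_bits :: "(nat \<Rightarrow> bool) \<Rightarrow> nat \<Rightarrow> nat \<Rightarrow> real" where
  "table_of_bits b i k = level_sup (\<lambda>l. b (triple_encode i k l))"

lemma table_of_path_bits:
  "\<omega> \<in> trajectories \<Longrightarrow> table_of_bits (\<lambda>n. \<omega> \<in> path_event n) i = embed (\<omega> (rational_time i))"
  by (auto simp: table_of_bits_def path_event_def embed_def level_sup_below \<phi>_bounds)

lemma measurable_table_of_bits [measurable]:
  "(\<lambda>b. table_of_bits b i k) \<in> borel_measurable bit_space"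
  unfolding table_of_bits_def by (rule measurable_level_sup) (rule measurable_bit)

text \<open>\<open>path_table\<close> quantifies over natural numbers only, and its atoms are
  inequalities between entries or membership in the closed sets of
  \<open>closed_embed_K\<close>.\<close>

lemma measurable_path_table [measurable]:
  "Measurable.pred bit_space (\<lambda>b. path_table (table_of_bits b))"
proof -
  have [measurable]: "Measurable.pred bit_space (\<lambda>b. table_of_bits b i \<in> embed ` K j)" for i j
  proof -
    have "(\<lambda>b. table_of_bits b i) \<in> borel_measurable bit_space"
      by (rule measurable_coordinatewise_then_product) (rule measurable_table_of_bits)
    moreover have "embed ` K j \<in> sets borel" using closed_embed_K by (rule borel_closed)
    ultimately show ?thesis by measurable
  qed
  show ?thesis unfolding path_table_def by measurable
qed

definition some_path :: "real \<Rightarrow> 'e" where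
  "some_path = restrict (\<lambda>_. dense_seq 0) {0..}"

lemma some_path: "some_path \<in> trajectories"
proof -
  have "continuous_on {0..} some_path"
    by (rule continuous_on_eq[OF continuous_on_const[of _ "dense_seq 0"]]) (simp add: some_path_def)
  then show ?thesis by (simp add: trajectories_def some_path_def)
qed

definition path_of_bits :: "(nat \<Rightarrow> bool) \<Rightarrow> real \<Rightarrow> 'e" where
  "path_of_bits b = (if path_table (table_of_bits b)
     then SOME \<omega>. \<omega> \<in> trajectories \<and> (\<forall>i. embed (\<omega> (rational_time i)) = table_of_bits b i)
     else some_path)"

lemma path_of_bits_table:
  assumes "path_table (table_of_bits b)"
  shows "path_of_bits b \<in> trajectories \<and>
    (\<forall>i. embed (path_of_bits b (rational_time i)) = table_of_bits b i)"
proof -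
  have "\<exists>\<omega>. \<omega> \<in> trajectories \<and> (\<forall>i. embed (\<omega> (rational_time i)) = table_of_bits b i)"
    using path_of_path_table[OF assms] by blast
  from someI_ex[OF this] show ?thesis using assms by (simp add: path_of_bits_def)
qed

lemma path_of_bits_trajectory: "path_of_bits b \<in> trajectories"
  using path_of_bits_table[of b] some_path by (cases "path_table (table_of_bits b)") (auto simp: path_of_bits_def)

lemma path_of_path_bits:
  assumes "\<omega> \<in> trajectories"
  shows "path_of_bits (\<lambda>n. \<omega> \<in> path_event n) = \<omega>"
proof -
  have tab: "table_of_bits (\<lambda>n. \<omega> \<in> path_event n) = (\<lambda>i. embed (\<omega> (rational_time i)))"
    using table_of_path_bits[OF assms] by auto
  then have "path_table (table_of_bits (\<lambda>n. \<omega> \<in> path_event n))"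
    using path_table_of_path[OF assms] by simp
  then show ?thesis
    using path_of_bits_table tab assms by (intro trajectory_eqI) simp_all
qed

text \<open>An open set is the union of the countably many rational sublevel sets of coordinates
  that it contains.\<close>

lemma borel_measurable_via_\<phi>:
  assumes "\<And>k. (\<lambda>x. \<phi> k (f x)) \<in> borel_measurable M"
  shows "f \<in> M \<rightarrow>\<^sub>M borel"
proof (rule borel_measurableI)
  fix U :: "'e set" assume U: "open U"
  define I where "I = {(k, l). \<forall>y. \<phi> k y < rational_level l \<longrightarrow> y \<in> U}"
  have "f -` U \<inter> space M = (\<Union>(k, l)\<in>I. {x \<in> space M. \<phi> k (f x) < rational_level l})"
  proof (intro subset_antisym subsetI)
    fix x assume "x \<in> f -` U \<inter> space M"
    then obtain k l where "\<phi> k (f x) < rational_level l" "\<And>y. \<phi> k y < rational_level l \<Longrightarrow> y \<in> U"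
      using \<phi>_base[OF U, of "f x"] by blast
    then show "x \<in> (\<Union>(k, l)\<in>I. {x \<in> space M. \<phi> k (f x) < rational_level l})"
      using \<open>x \<in> f -` U \<inter> space M\<close> by (auto simp: I_def)
  qed (auto simp: I_def)
  also have "\<dots> \<in> sets M"
    using assms by (intro sets.countable_UN') (auto simp: case_prod_beta)
  finally show "f -` U \<inter> space M \<in> sets M" .
qed

text \<open>One index sequence works for all paths simultaneously, so evaluation at a real time is a
  pointwise limit of evaluations at fixed rational times.\<close>

lemma trajectory_rational_limit:
  assumes "0 \<le> t"
  obtains s where "\<And>\<omega> :: real \<Rightarrow> 'e. \<omega> \<in> trajectories \<Longrightarrow> (\<lambda>n. \<omega> (rational_time (s n))) \<longlonglongrightarrow> \<omega> t"
    and "(\<lambda>n. rational_time (s n)) \<longlonglongrightarrow> t"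
proof -
  have "t \<in> closure (\<rat> \<inter> {0..t + 1})" using assms by (subst closure_rational_interval) auto
  then obtain x where x: "\<And>n. x n \<in> \<rat> \<inter> {0..t + 1}" "x \<longlonglongrightarrow> t"
    unfolding closure_sequential by blast
  have "\<forall>n. \<exists>i. x n = rational_time i"
    using x(1) range_rational_time by (metis Int_iff atLeastAtMost_iff atLeast_iff imageE)
  then obtain s where s: "\<And>n. x n = rational_time (s n)" by metis
  show thesis
  proof (rule that)
    fix \<omega> :: "real \<Rightarrow> 'e" assume "\<omega> \<in> trajectories"
    then have "continuous_on {0..} \<omega>" by (simp add: trajectories_def)
    from continuous_on_tendsto_compose[OF this x(2)] x(1) assms
    show "(\<lambda>n. \<omega> (rational_time (s n))) \<longlonglongrightarrow> \<omega> t" by (auto simp: s[symmetric])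
  next
    show "(\<lambda>n. rational_time (s n)) \<longlonglongrightarrow> t" using x(2) by (simp add: s[symmetric])
  qed
qed

text \<open>The choice operator in the decoder does no harm: at rational times the coordinates of
  the decoded path are table entries, hence measurable in the bits, and real times are limits of
  rational ones.\<close>

lemma measurable_path_of_bits: "path_of_bits \<in> bit_space \<rightarrow>\<^sub>M trajectory_space"
proof (rule measurable_into_trajectory_space[OF path_of_bits_trajectory])
  fix t :: real assume t: "0 \<le> t"
  have rat: "(\<lambda>b. \<phi> k (path_of_bits b (rational_time i))) \<in> borel_measurable bit_space" for k i
  proof -
    have "(\<lambda>b. \<phi> k (path_of_bits b (rational_time i))) =
        (\<lambda>b. if path_table (table_of_bits b) then table_of_bits b i k else \<phi> k (some_path (rational_time i)))"
    proof
      fix b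
      show "\<phi> k (path_of_bits b (rational_time i)) =
          (if path_table (table_of_bits b) then table_of_bits b i k else \<phi> k (some_path (rational_time i)))"
      proof (cases "path_table (table_of_bits b)")
        case True
        then have "embed (path_of_bits b (rational_time i)) k = table_of_bits b i k"
          using path_of_bits_table by simp
        then show ?thesis using True by (simp add: embed_def)
      qed (simp add: path_of_bits_def)
    qed
    then show ?thesis by simp
  qed
  obtain s where s: "\<And>\<omega> :: real \<Rightarrow> 'e. \<omega> \<in> trajectories \<Longrightarrow> (\<lambda>n. \<omega> (rational_time (s n))) \<longlonglongrightarrow> \<omega> t"
    using trajectory_rational_limit[OF t] by blast
  show "(\<lambda>b. path_of_bits b t) \<in> bit_space \<rightarrow>\<^sub>M borel"
  proof (rule borel_measurable_via_\<phi>)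
    fix k
    show "(\<lambda>b. \<phi> k (path_of_bits b t)) \<in> borel_measurable bit_space"
    proof (rule borel_measurable_LIMSEQ_real)
      fix b
      show "(\<lambda>n. \<phi> k (path_of_bits b (rational_time (s n)))) \<longlonglongrightarrow> \<phi> k (path_of_bits b t)"
        by (rule continuous_on_tendsto_compose[OF continuous_\<phi> s[OF path_of_bits_trajectory]]) auto
    qed (rule rat)
  qed
qed

text \<open>Even bits encode the path itself, odd bits the level sets of the observables.\<close>

lemma bit_coded_trajectories:
  assumes h: "\<And>k. h k \<in> borel_measurable trajectory_space"
    and h01: "\<And>k \<omega>. \<omega> \<in> trajectories \<Longrightarrow> 0 \<le> h k \<omega> \<and> h k \<omega> \<le> 1"
  obtains A R where "bit_coded (trajectory_space :: (real \<Rightarrow> 'e) measure) A R h"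
proof -
  define B where "B n = (case prod_decode n of (k, l) \<Rightarrow>
    {\<omega> \<in> trajectories. rational_level l < h k \<omega>})" for n
  define A where "A n = (if even n then path_event (n div 2) else B (n div 2))" for n
  have B: "B n \<in> sets trajectory_space" for n
  proof -
    obtain k l where n: "prod_decode n = (k, l)" by (cases "prod_decode n")
    have "{\<omega> \<in> space trajectory_space. rational_level l < h k \<omega>} \<in> sets trajectory_space"
      using h[of k] by measurable
    then show ?thesis by (simp add: B_def n space_trajectory_space)
  qed
  have "bit_coded trajectory_space A (\<lambda>b. path_of_bits (even_bits b)) h"
  proof
    show "A n \<in> sets trajectory_space" for n by (simp add: A_def B sets_path_event)
    show "(\<lambda>b. path_of_bits (even_bits b)) \<in> bit_space \<rightarrow>\<^sub>M trajectory_space"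
      by (rule measurable_compose[OF measurable_even_bits measurable_path_of_bits])
    show "path_of_bits (even_bits (\<lambda>n. \<omega> \<in> A n)) = \<omega>" if "\<omega> \<in> space trajectory_space" for \<omega>
      using path_of_path_bits[of \<omega>] that by (simp add: even_bits_def A_def space_trajectory_space)
    show "h k \<in> borel_measurable trajectory_space" for k by (rule h)
    show "0 \<le> h k \<omega> \<and> h k \<omega> \<le> 1" if "\<omega> \<in> space trajectory_space" for k \<omega>
      using h01 that by (simp add: space_trajectory_space)
    fix k and e :: real assume e: "0 < e"
    then obtain m where m: "1 / real (Suc m) < e" using nat_approx_posE by blast
    have "\<forall>j\<in>{..Suc m}. \<exists>l. rational_level l = real j / real (Suc m)"
    proof
      fix j assume "j \<in> {..Suc m}"
      then have "real j / real (Suc m) \<in> range rational_level"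
        unfolding range_rational_level by (auto simp: divide_le_eq)
      then show "\<exists>l. rational_level l = real j / real (Suc m)" by (metis imageE)
    qed
    \<comment> \<open>A grid of levels with mesh below \<open>e\<close>: paths that agree in the
      comparisons of \<open>h k\<close> with all of them have values of \<open>h k\<close> within
      \<open>e\<close>.\<close>
    then obtain lev where lev: "\<And>j. j \<le> Suc m \<Longrightarrow> rational_level (lev j) = real j / real (Suc m)" by (metis atMost_iff)
    define code where "code j = 2 * prod_encode (k, lev j) + 1" for j
    \<comment> \<open>Any number above all \<open>code j\<close> would do; a sum of naturals bounds
      each summand.\<close>
    define n where "n = Suc (\<Sum>j\<le>Suc m. code j)"
    have code: "code j < n" if "j \<le> Suc m" for j
      using member_le_sum[of j "{..Suc m}" code] that by (simp add: n_def)
    have "h k \<omega> \<le> h k \<omega>' + e"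
      if "\<omega> \<in> trajectories" "\<omega>' \<in> trajectories" and eq: "\<forall>i<n. \<omega> \<in> A i \<longleftrightarrow> \<omega>' \<in> A i" for \<omega> \<omega>'
    proof (rule ccontr)
      assume "\<not> ?thesis"
      then have gap: "h k \<omega>' + e < h k \<omega>" by simp
      \<comment> \<open>Rounding the smaller value up to the grid lands at or above it but less than
        one mesh higher, hence strictly below the larger value. The bit of this level tells the two
        paths apart.\<close>
      define j where "j = nat \<lceil>h k \<omega>' * real (Suc m)\<rceil>"
      have h': "0 \<le> h k \<omega>'" "h k \<omega>' \<le> 1" using h01 that by auto
      have j1: "h k \<omega>' * real (Suc m) \<le> real j" and j2: "real j < h k \<omega>' * real (Suc m) + 1"
        unfolding j_def using h' by (auto simp: of_nat_nat) linarith+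
      have "h k \<omega>' * real (Suc m) \<le> real (Suc m)" by (metis h'(2) mult_1 mult_right_mono of_nat_0_le_iff)
      then have "real j < real (Suc m) + 1" using j2 by linarith
      then have j: "j \<le> Suc m" by linarith
      have "h k \<omega>' \<le> real j / real (Suc m)" using j1 by (simp add: field_simps)
      moreover have "real j / real (Suc m) < h k \<omega>' + 1 / real (Suc m)"
      proof -
        have "h k \<omega>' + 1 / real (Suc m) = (h k \<omega>' * real (Suc m) + 1) / real (Suc m)"
          by (simp add: add_divide_distrib)
        then show ?thesis using divide_strict_right_mono[OF j2, of "real (Suc m)"] by simp
      qed
      ultimately have "h k \<omega>' \<le> rational_level (lev j)" "rational_level (lev j) < h k \<omega>"
        unfolding lev[OF j] using m gap by linarith+
      then have "\<omega> \<in> A (code j)" "\<omega>' \<notin> A (code j)"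
        using that by (auto simp: A_def B_def code_def)
      then show False using eq code[OF j] by blast
    qed
    note close = this
    show "\<exists>n. \<forall>\<omega>\<in>space trajectory_space. \<forall>\<omega>'\<in>space trajectory_space.
        (\<forall>i<n. \<omega> \<in> A i \<longleftrightarrow> \<omega>' \<in> A i) \<longrightarrow> \<bar>h k \<omega> - h k \<omega>'\<bar> \<le> e"
    proof (intro exI[of _ n] ballI impI)
      fix \<omega> \<omega>' assume "\<omega> \<in> space trajectory_space" "\<omega>' \<in> space trajectory_space"
        "\<forall>i<n. \<omega> \<in> A i \<longleftrightarrow> \<omega>' \<in> A i"
      then show "\<bar>h k \<omega> - h k \<omega>'\<bar> \<le> e"
        using close[of \<omega> \<omega>'] close[of \<omega>' \<omega>] by (auto simp: space_trajectory_space abs_le_iff)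
    qed
  qed
  then show thesis by (rule that)
qed

end

section \<open>Lattice approximation\<close>

text \<open>A finite net replaces the compactness of Stone--Weierstrass. The interpolants are all
  1-Lipschitz for \<open>D\<close>, a property kept by minima and maxima, so exact agreement with
  \<open>F\<close> on the net costs at most \<open>e\<close> for each of the two functions
  elsewhere.\<close>

lemma lattice_approximation:
  fixes V :: "('a \<Rightarrow> real) set" and D :: "'a \<Rightarrow> 'a \<Rightarrow> real"
  assumes V_min: "\<And>f g. f \<in> V \<Longrightarrow> g \<in> V \<Longrightarrow> (\<lambda>w. min (f w) (g w)) \<in> V"
    and V_max: "\<And>f g. f \<in> V \<Longrightarrow> g \<in> V \<Longrightarrow> (\<lambda>w. max (f w) (g w)) \<in> V"
    and pairs: "\<And>x y. x \<in> X \<Longrightarrow> y \<in> X \<Longrightarrow> \<exists>g\<in>V. g x = F x \<and> g y = F y \<and> (\<forall>w w'. \<bar>g w - g w'\<bar> \<le> D w w')"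
    and F: "\<And>x y. x \<in> X \<Longrightarrow> y \<in> X \<Longrightarrow> \<bar>F x - F y\<bar> \<le> D x y"
    and net: "finite S" "S \<noteq> {}" "S \<subseteq> X" "\<And>x. x \<in> X \<Longrightarrow> \<exists>s\<in>S. D x s \<le> e"
  shows "\<exists>g\<in>V. \<forall>x\<in>X. \<bar>g x - F x\<bar> \<le> 2 * e"
proof -
  define L where "L = {g \<in> V. \<forall>w w'. \<bar>g w - g w'\<bar> \<le> D w w'}"
  have L_min: "(\<lambda>w. min (f w) (g w)) \<in> L" if "f \<in> L" "g \<in> L" for f g
  proof -
    have "\<bar>min (f w) (g w) - min (f w') (g w')\<bar> \<le> D w w'" for w w'
    proof -
      have "\<bar>f w - f w'\<bar> \<le> D w w'" "\<bar>g w - g w'\<bar> \<le> D w w'" using that by (auto simp: L_def)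
      then show ?thesis by linarith
    qed
    then show ?thesis using that V_min by (auto simp: L_def)
  qed
  have L_max: "(\<lambda>w. max (f w) (g w)) \<in> L" if "f \<in> L" "g \<in> L" for f g
  proof -
    have "\<bar>max (f w) (g w) - max (f w') (g w')\<bar> \<le> D w w'" for w w'
    proof -
      have "\<bar>f w - f w'\<bar> \<le> D w w'" "\<bar>g w - g w'\<bar> \<le> D w w'" using that by (auto simp: L_def)
      then show ?thesis by linarith
    qed
    then show ?thesis using that V_max by (auto simp: L_def)
  qed
  have Min_L: "(\<lambda>w. Min ((\<lambda>j. G j w) ` S)) \<in> L" if "\<And>j. j \<in> S \<Longrightarrow> G j \<in> L" for G :: "'a \<Rightarrow> 'a \<Rightarrow> real"
    using net(1,2) that
  proof (induction S rule: finite_ne_induct)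
    case (insert s S)
    then show ?case using L_min[of "G s" "\<lambda>w. Min ((\<lambda>j. G j w) ` S)"] by simp
  qed simp
  have Max_L: "(\<lambda>w. Max ((\<lambda>j. G j w) ` S)) \<in> L" if "\<And>j. j \<in> S \<Longrightarrow> G j \<in> L" for G :: "'a \<Rightarrow> 'a \<Rightarrow> real"
    using net(1,2) that
  proof (induction S rule: finite_ne_induct)
    case (insert s S)
    then show ?case using L_max[of "G s" "\<lambda>w. Max ((\<lambda>j. G j w) ` S)"] by simp
  qed simp
  have "\<forall>x\<in>X. \<forall>y\<in>X. \<exists>g. g \<in> L \<and> g x = F x \<and> g y = F y"
    using pairs unfolding L_def by blast
  then obtain g where g: "\<And>x y. x \<in> X \<Longrightarrow> y \<in> X \<Longrightarrow> g x y \<in> L \<and> g x y x = F x \<and> g x y y = F y"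
    by metis
  \<comment> \<open>At a net point \<open>s\<close>, every inner minimum is at most
    \<open>F s\<close> because of \<open>j = s\<close>, and the one for \<open>i = s\<close> equals
    \<open>F s\<close>. Hence \<open>G\<close> agrees with \<open>F\<close> on the net.\<close>
  define G where "G w = Max ((\<lambda>i. Min ((\<lambda>j. g i j w) ` S)) ` S)" for w
  have GL: "G \<in> L"
    unfolding G_def using net(3) g by (intro Max_L Min_L) blast
  have GS: "G s = F s" if s: "s \<in> S" for s
  proof (rule antisym)
    show "G s \<le> F s"
      unfolding G_def
    proof (rule Max.boundedI)
      fix a assume "a \<in> (\<lambda>i. Min ((\<lambda>j. g i j s) ` S)) ` S"
      then obtain i where i: "i \<in> S" "a = Min ((\<lambda>j. g i j s) ` S)" by blast
      have "a \<le> g i s s" unfolding i using net(1) s by (intro Min_le) auto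
      also have "\<dots> = F s" using g[of i s] net(3) i s by blast
      finally show "a \<le> F s" .
    qed (use net in auto)
    have "F s \<le> Min ((\<lambda>j. g s j s) ` S)"
    proof (rule Min.boundedI)
      fix a assume "a \<in> (\<lambda>j. g s j s) ` S"
      then obtain j where j: "j \<in> S" "a = g s j s" by blast
      have "g s j s = F s" using g[of s j] net(3) j s by blast
      then show "F s \<le> a" using j by simp
    qed (use net in auto)
    also have "\<dots> \<le> G s" unfolding G_def using net(1) s by (intro Max_ge) auto
    finally show "F s \<le> G s" .
  qed
  have "\<bar>G x - F x\<bar> \<le> 2 * e" if x: "x \<in> X" for x
  proof -
    obtain s where s: "s \<in> S" "D x s \<le> e" using net(4)[OF x] by blast
    have "\<bar>G x - G s\<bar> \<le> D x s" using GL by (simp add: L_def)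
    moreover have "\<bar>F x - F s\<bar> \<le> D x s" using F[of x s] x s net(3) by blast
    ultimately show ?thesis using GS[OF s(1)] s(2) by linarith
  qed
  then show ?thesis using GL by (auto simp: L_def)
qed

lemma (in bit_coded) finite_net:
  assumes "0 < e"
  shows "\<exists>S. finite S \<and> S \<subseteq> space M \<and> (\<forall>x\<in>space M. \<exists>s\<in>S. maxdiff h N x s \<le> e)"
proof -
  obtain n where n: "\<And>x y. x \<in> space M \<Longrightarrow> y \<in> space M \<Longrightarrow>
      rprefix (bits x) n = rprefix (bits y) n \<Longrightarrow> maxdiff h N x y \<le> e"
    using maxdiff_sep[OF assms, of 0 N] by blast
  define pre where "pre x = rprefix (bits x) n" for x
  have "finite (pre ` space M)"
    by (rule finite_subset[OF _ finite_bool_lists[of n]]) (auto simp: pre_def)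
  then obtain S where S: "S \<subseteq> space M" "finite S" "pre ` space M = pre ` S"
    by (meson finite_subset_image order_refl)
  have "\<exists>s\<in>S. maxdiff h N x s \<le> e" if "x \<in> space M" for x
  proof -
    have "pre x \<in> pre ` S" using S(3) that by blast
    then obtain s where "s \<in> S" "pre x = pre s" by blast
    then show ?thesis using n[of x s] that S(1) by (auto simp: pre_def)
  qed
  then show ?thesis using S by blast
qed

section \<open>Uniform topology and initial law\<close>

context lc_state_space
begin

lemma uniform_metric_ge: "0 \<le> t \<Longrightarrow> \<Delta> (\<omega> t) (\<omega>' t) \<le> uniform_metric \<Delta> \<omega> \<omega>'"
  unfolding uniform_metric_def
  by (rule cSUP_upper) (auto intro!: bdd_aboveI[of _ 1] simp: dist_le_1)

lemma uniform_metric_le: "(\<And>t. 0 \<le> t \<Longrightarrow> \<Delta> (\<omega> t) (\<omega>' t) \<le> b) \<Longrightarrow> uniform_metric \<Delta> \<omega> \<omega>' \<le> b"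
  unfolding uniform_metric_def by (rule cSUP_least) auto

lemma Metric_space_uniform: "Metric_space trajectories (uniform_metric \<Delta>)"
proof
  fix \<omega> \<omega>' \<omega>'' :: "real \<Rightarrow> 'e"
  show nn: "0 \<le> uniform_metric \<Delta> \<omega> \<omega>'"
    using uniform_metric_ge[of 0 \<omega> \<omega>'] nonneg order_trans by blast
  show "uniform_metric \<Delta> \<omega> \<omega>' = uniform_metric \<Delta> \<omega>' \<omega>"
    by (simp add: uniform_metric_def commute)
  show "uniform_metric \<Delta> \<omega> \<omega>'' \<le> uniform_metric \<Delta> \<omega> \<omega>' + uniform_metric \<Delta> \<omega>' \<omega>''"
  proof (rule uniform_metric_le)
    fix t :: real assume "0 \<le> t"
    then show "\<Delta> (\<omega> t) (\<omega>'' t) \<le> uniform_metric \<Delta> \<omega> \<omega>' + uniform_metric \<Delta> \<omega>' \<omega>''"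
      using dist_triangle[of "\<omega> t" "\<omega>'' t" "\<omega>' t"] uniform_metric_ge[of t \<omega> \<omega>'] uniform_metric_ge[of t \<omega>' \<omega>'']
      by linarith
  qed
  assume tr: "\<omega> \<in> trajectories" "\<omega>' \<in> trajectories"
  show "uniform_metric \<Delta> \<omega> \<omega>' = 0 \<longleftrightarrow> \<omega> = \<omega>'"
  proof
    assume 0: "uniform_metric \<Delta> \<omega> \<omega>' = 0"
    have "\<omega> t = \<omega>' t" if "0 \<le> t" for t
      using uniform_metric_ge[OF that, of \<omega> \<omega>'] nonneg[of "\<omega> t" "\<omega>' t"] zero[of "\<omega> t" "\<omega>' t"] 0 by auto
    then show "\<omega> = \<omega>'" using tr by (intro trajectory_eqI) (auto simp: rational_time_nonneg)
  next
    assume "\<omega> = \<omega>'"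
    then have "uniform_metric \<Delta> \<omega> \<omega>' \<le> 0" by (intro uniform_metric_le) simp
    then show "uniform_metric \<Delta> \<omega> \<omega>' = 0" using nn by linarith
  qed
qed

lemma continuous_map_evaluation:
  assumes t: "0 \<le> t"
  shows "continuous_map (uniform_topology \<Delta>) (euclidean :: 'e topology) (\<lambda>\<omega>. \<omega> t)"
proof -
  interpret U: Metric_space trajectories "uniform_metric \<Delta>" by (rule Metric_space_uniform)
  show ?thesis
    unfolding continuous_map_def uniform_topology_def U.openin_mtopology
  proof (intro conjI allI impI)
    fix B \<omega> assume B: "openin (euclidean :: 'e topology) B"
      and \<omega>: "\<omega> \<in> {\<omega> \<in> topspace U.mtopology. \<omega> t \<in> B}"
    then obtain r where r: "r > 0" "\<And>y. \<Delta> (\<omega> t) y < r \<Longrightarrow> y \<in> B" using open_iff[of B] by auto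
    have "U.mball \<omega> r \<subseteq> {\<omega> \<in> topspace U.mtopology. \<omega> t \<in> B}"
    proof
      fix \<omega>' assume \<omega>': "\<omega>' \<in> U.mball \<omega> r"
      then have "\<Delta> (\<omega> t) (\<omega>' t) < r" using uniform_metric_ge[OF t, of \<omega> \<omega>'] by auto
      then show "\<omega>' \<in> {\<omega> \<in> topspace U.mtopology. \<omega> t \<in> B}" using \<omega>' r by auto
    qed
    then show "\<exists>r>0. U.mball \<omega> r \<subseteq> {\<omega> \<in> topspace U.mtopology. \<omega> t \<in> B}" using r by blast
  qed auto
qed

text \<open>\<open>T 0\<close> is the identity on \<open>C0\<close>, so a bump function with value 1
  only at \<open>x\<close> has integral 1 under \<open>P 0 x\<close>, which forces all mass onto
  \<open>x\<close>. Local compactness supplies the ball inside a compact set that puts the bump into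
  \<open>C0\<close>.\<close>

lemma start_kernel:
  fixes P :: "real \<Rightarrow> 'e \<Rightarrow> 'e measure"
  assumes T: "feller_dynkin_semigroup T" and P: "associated_kernels T P" and hon: "honest P"
  shows "emeasure (P 0 x) {x} = 1"
proof -
  interpret p: prob_space "P 0 x" using hon by (simp add: honest_def)
  have "P 0 \<in> borel \<rightarrow>\<^sub>M subprob_algebra borel" using P by (simp add: associated_kernels_def)
  then have "P 0 x \<in> space (subprob_algebra borel)" by (rule measurable_space) simp
  then have setsP: "sets (P 0 x) = sets borel" by (simp add: space_subprob_algebra)
  have spP: "space (P 0 x) = UNIV" using sets_eq_imp_space_eq[OF setsP] by simp
  obtain U C where "openin euclidean U" "compactin euclidean C" and UC: "x \<in> U" "U \<subseteq> C"
    using lc unfolding locally_compact_space_def by (metis UNIV_I topspace_euclidean)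
  then have UC: "open U" "compact C" "x \<in> U" "U \<subseteq> C" by simp_all
  obtain r where r: "r > 0" "\<And>y. \<Delta> x y < r \<Longrightarrow> y \<in> U" using UC open_iff by blast
  define f where "f y = max 0 (1 - \<Delta> x y / r)" for y
  have contf: "continuous_on UNIV f"
    unfolding f_def by (intro continuous_intros continuous_dist) (use r in auto)
  have f0: "f y = 0" if "y \<notin> C" for y
  proof -
    have "r \<le> \<Delta> x y" using that r UC by force
    then show ?thesis using r by (simp add: f_def)
  qed
  have f1: "0 \<le> f y" "f y \<le> 1" for y using r by (auto simp: f_def)
  have "f \<in> C0"
    unfolding C0_def
  proof (intro CollectI conjI contf allI impI)
    fix e :: real assume "0 < e"
    then show "\<exists>K. compact K \<and> (\<forall>x. x \<notin> K \<longrightarrow> \<bar>f x\<bar> < e)"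
      using UC(2) f0 by (intro exI[of _ C]) simp
  qed
  moreover have "\<forall>f\<in>C0. T 0 f = f" using T unfolding feller_dynkin_semigroup_def by blast
  moreover have "\<forall>t\<ge>0. \<forall>f\<in>C0. \<forall>x. T t f x = (\<integral>y. f y \<partial>(P t x))"
    using P unfolding associated_kernels_def by blast
  ultimately have "(\<integral>y. f y \<partial>(P 0 x)) = f x" by (metis order_refl)
  then have int1: "(\<integral>y. f y \<partial>(P 0 x)) = 1" by (simp add: f_def)
  have "f \<in> borel_measurable borel" by (rule borel_measurable_continuous_onI[OF contf])
  then have fm: "f \<in> borel_measurable (P 0 x)" using setsP by (metis measurable_cong_sets)
  have int: "integrable (P 0 x) f"
    by (rule p.integrable_const_bound[where B = 1]) (use f1 fm in auto)
  have "(\<integral>y. 1 - f y \<partial>(P 0 x)) = 0" using int int1 by (simp add: p.prob_space)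
  then have "AE y in P 0 x. 1 - f y = 0"
    using int f1 by (subst (asm) integral_nonneg_eq_0_iff_AE) auto
  then have "AE y in P 0 x. y \<in> {x}"
  proof eventually_elim
    case (elim y)
    then have "\<Delta> x y / r = 0" by (simp add: f_def max_def split: if_splits)
    then show ?case using r by auto
  qed
  moreover have "{x} \<in> sets (P 0 x)" using borel_closed[OF closed_singleton[of x]] setsP by simp
  ultimately show ?thesis
    using p.prob_eq_1[of "{x}"] by (simp add: p.emeasure_eq_measure)
qed

lemma start_law:
  fixes P :: "real \<Rightarrow> 'e \<Rightarrow> 'e measure"
  assumes "feller_dynkin_semigroup T" and "associated_kernels T P" and "honest P"
    and M: "law_from P x M"
  shows "AE \<omega> in M. \<omega> 0 = x"
proof -
  interpret prob_space M using M by (simp add: law_from_def)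
  have sets: "sets M = sets trajectory_space" using M by (simp add: law_from_def)
  have sp: "space M = trajectories"
    using sets_eq_imp_space_eq[OF sets] by (simp add: space_trajectory_space)
  have "emeasure M {\<omega> \<in> trajectories. \<forall>(t, A) \<in> set [(0, {x})]. \<omega> t \<in> A} = fdd P 0 x [(0, {x})]"
  proof -
    have "sorted (0 # map fst [(0 :: real, {x})]) \<and> (\<forall>(t, A) \<in> set [(0 :: real, {x})]. A \<in> sets borel)"
      using borel_closed[OF closed_singleton[of x]] by simp
    then show ?thesis using M unfolding law_from_def by blast
  qed
  also have "\<dots> = (\<integral>\<^sup>+y. indicator {x} y \<partial>(P 0 x))" by simp
  also have "\<dots> = emeasure (P 0 x) {x}"
  proof (rule nn_integral_indicator)
    have "P 0 \<in> borel \<rightarrow>\<^sub>M subprob_algebra borel" using assms(2) by (simp add: associated_kernels_def)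
    then have "P 0 x \<in> space (subprob_algebra borel)" by (rule measurable_space) simp
    then show "{x} \<in> sets (P 0 x)"
      using borel_closed[OF closed_singleton[of x]] by (simp add: space_subprob_algebra)
  qed
  also have "\<dots> = 1" by (rule start_kernel[OF assms(1-3)])
  finally have 1: "emeasure M {\<omega> \<in> trajectories. \<omega> 0 = x} = 1" by simp
  \<comment> \<open>Non-measurable sets have \<open>emeasure\<close> 0, so the value 1 already
    proves measurability.\<close>
  have "{\<omega> \<in> trajectories. \<omega> 0 = x} \<in> sets M"
  proof (rule ccontr)
    assume "{\<omega> \<in> trajectories. \<omega> 0 = x} \<notin> sets M"
    from emeasure_notin_sets[OF this] 1 show False by simp
  qed
  from prob_eq_1[OF this] 1 have "AE \<omega> in M. \<omega> \<in> {\<omega> \<in> trajectories. \<omega> 0 = x}"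
    by (simp add: emeasure_eq_measure)
  then show ?thesis by eventually_elim simp
qed

end

section \<open>The logical distance\<close>

text \<open>Countability of the formulas makes the discounted distance a countable supremum, hence
  measurable.\<close>

instance state_form :: countable
  by countable_datatype

locale diffusion_logic = lc_state_space \<Delta>
  for \<Delta> :: "'e::{t2_space, second_countable_topology} \<Rightarrow> 'e \<Rightarrow> real" +
  fixes \<P> :: "'e \<Rightarrow> (real \<Rightarrow> 'e) measure" and obs :: "'e \<Rightarrow> real" and c :: real
  assumes prob: "prob_space (\<P> x)"
    and sets_law [measurable_cong]: "sets (\<P> x) = sets trajectory_space"
    and start: "AE \<omega> in \<P> x. \<omega> 0 = x"
    and weak: "weakly_continuous \<Delta> \<P>"
    and obs_continuous: "continuous_on UNIV obs"
    and obs_bounds: "0 \<le> obs x" "obs x \<le> 1"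
    and c: "0 < c" "c \<le> 1"
begin

abbreviation S :: "state_form \<Rightarrow> 'e \<Rightarrow> real" where "S \<equiv> sem_state obs \<P> c"
abbreviation G :: "path_form \<Rightarrow> (real \<Rightarrow> 'e) \<Rightarrow> real" where "G \<equiv> sem_path obs \<P> c"
abbreviation ell :: "'e \<Rightarrow> 'e \<Rightarrow> real" where "ell \<equiv> logic_dist obs \<P> c"
abbreviation D :: "(real \<Rightarrow> 'e) \<Rightarrow> (real \<Rightarrow> 'e) \<Rightarrow> real" where "D \<equiv> discounted_uniform c ell"

lemma space_law: "space (\<P> x) = trajectories"
  using sets_eq_imp_space_eq[OF sets_law] by (simp add: space_trajectory_space)

lemma measurable_law: "measurable (\<P> x) N = measurable trajectory_space N"
  by (rule measurable_cong_sets[OF sets_law refl])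

lemma discount_bounds: "0 \<le> t \<Longrightarrow> 0 \<le> c powr t \<and> c powr t \<le> 1"
  using c powr_mono2[of t c 1] by simp

lemma integrable_law:
  fixes F :: "(real \<Rightarrow> 'e) \<Rightarrow> real"
  assumes "F \<in> borel_measurable trajectory_space" and "\<And>\<omega>. \<omega> \<in> trajectories \<Longrightarrow> \<bar>F \<omega>\<bar> \<le> B"
  shows "integrable (\<P> x) F"
proof -
  interpret prob_space "\<P> x" by (rule prob)
  show ?thesis
    using assms by (intro integrable_const_bound[where B = B]) (auto simp: measurable_law space_law)
qed

lemma integral_law_bounds:
  fixes F :: "(real \<Rightarrow> 'e) \<Rightarrow> real"
  assumes "F \<in> borel_measurable trajectory_space" and "\<And>\<omega>. 0 \<le> F \<omega> \<and> F \<omega> \<le> 1"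
  shows "0 \<le> (\<integral>\<omega>. F \<omega> \<partial>(\<P> x)) \<and> (\<integral>\<omega>. F \<omega> \<partial>(\<P> x)) \<le> 1"
proof
  interpret prob_space "\<P> x" by (rule prob)
  show "0 \<le> (\<integral>\<omega>. F \<omega> \<partial>(\<P> x))" using assms by (intro integral_nonneg_AE) auto
  show "(\<integral>\<omega>. F \<omega> \<partial>(\<P> x)) \<le> 1"
    using assms by (intro integral_le_const integrable_law[where B = 1]) auto
qed

lemma continuous_map_min_max:
  fixes f g :: "'b \<Rightarrow> real"
  assumes "continuous_map X euclideanreal f" and "continuous_map X euclideanreal g"
  shows "continuous_map X euclideanreal (\<lambda>x. min (f x) (g x))"
    and "continuous_map X euclideanreal (\<lambda>x. max (f x) (g x))"
  using assms by (simp_all add: continuous_map_atin tendsto_min tendsto_max)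

text \<open>The properties are proved together because weak continuity, which yields the
  \<open>Integ\<close> case, asks for test functions that are continuous, bounded and measurable,
  while the \<open>Ev\<close> case needs continuity of state formulas in return.\<close>

lemma sem_state_regular:
  "wf_state f \<Longrightarrow> continuous_on UNIV (S f) \<and> (\<forall>x. 0 \<le> S f x \<and> S f x \<le> 1)"
  and sem_path_regular:
  "wf_path g \<Longrightarrow> continuous_map (uniform_topology \<Delta>) euclideanreal (G g) \<and>
     G g \<in> borel_measurable trajectory_space \<and> (\<forall>\<omega>. 0 \<le> G g \<omega> \<and> G g \<omega> \<le> 1)"
proof (induction f and g)
  case Obs
  then show ?case using obs_continuous obs_bounds by simp
next
  case (Compl f)
  then show ?case by (auto intro: continuous_intros)
next
  case (Integ g)
  then have g: "continuous_map (uniform_topology \<Delta>) euclideanreal (G g)"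
    "G g \<in> borel_measurable trajectory_space" "\<And>\<omega>. 0 \<le> G g \<omega> \<and> G g \<omega> \<le> 1" by auto
  have "bounded (G g ` trajectories)"
    using g(3) by (intro boundedI[of _ 1]) (auto simp: abs_of_nonneg)
  then have "continuous_on UNIV (\<lambda>x. \<integral>\<omega>. G g \<omega> \<partial>(\<P> x))"
    using weak g unfolding weakly_continuous_def by blast
  then show ?case using integral_law_bounds[OF g(2,3)] by simp
next
  case (Ev f q)
  then have f: "continuous_on UNIV (S f)" "\<And>x. 0 \<le> S f x \<and> S f x \<le> 1" and q: "0 \<le> (of_rat q :: real)" by auto
  have 1: "continuous_map (uniform_topology \<Delta>) euclideanreal (G (Ev f q))"
    using continuous_map_compose[OF continuous_map_evaluation[OF q], of euclideanreal "S f"] f(1)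
    by (simp add: comp_def continuous_map_real_mult_left)
  have "S f \<in> borel_measurable borel" by (rule borel_measurable_continuous_onI[OF f(1)])
  from measurable_compose[OF measurable_evaluation[OF q] this]
  have 2: "G (Ev f q) \<in> borel_measurable trajectory_space" by simp
  have "0 \<le> G (Ev f q) \<omega> \<and> G (Ev f q) \<omega> \<le> 1" for \<omega>
    using f(2)[of "\<omega> (of_rat q)"] discount_bounds[OF q] by (auto intro: mult_nonneg_nonneg mult_le_one)
  then show ?case using 1 2 by blast
next
  case (PMin g1 g2)
  then show ?case by (auto simp: continuous_map_min_max min_le_iff_disj)
next
  case (PMax g1 g2)
  then show ?case by (auto simp: continuous_map_min_max le_max_iff_disj)
next
  case (Minus g q)
  then have q: "0 \<le> (of_rat q :: real)" and g: "continuous_map (uniform_topology \<Delta>) euclideanreal (G g)"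
    "G g \<in> borel_measurable trajectory_space" "\<And>\<omega>. 0 \<le> G g \<omega> \<and> G g \<omega> \<le> 1" by auto
  have "max 0 (G g \<omega> - of_rat q) \<le> 1" for \<omega> using q g(3)[of \<omega>] by linarith
  with g show ?case by (auto simp: continuous_map_atin intro!: tendsto_intros)
next
  case (Plus g q)
  have "0 \<le> (of_rat q :: real)" using Plus by simp
  with Plus show ?case by (auto simp: continuous_map_atin intro!: tendsto_intros)
qed auto

lemma ell_upper:
  assumes "wf_state f"
  shows "\<bar>S f x - S f y\<bar> \<le> ell x y"
  unfolding logic_dist_def
proof (rule cSUP_upper)
  show "f \<in> \<L>\<^sub>\<sigma>" using assms by (simp add: \<L>\<^sub>\<sigma>_def)
  have "\<bar>S f x - S f y\<bar> \<le> 1" if "wf_state f" for f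
    using sem_state_regular[OF that] by (smt (verit))
  then show "bdd_above ((\<lambda>f. \<bar>S f x - S f y\<bar>) ` \<L>\<^sub>\<sigma>)"
    by (intro bdd_aboveI[of _ 1]) (auto simp: \<L>\<^sub>\<sigma>_def)
qed

lemma ell_least:
  assumes "\<And>f. wf_state f \<Longrightarrow> \<bar>S f x - S f y\<bar> \<le> b"
  shows "ell x y \<le> b"
  unfolding logic_dist_def
proof (rule cSUP_least)
  have "Obs \<in> \<L>\<^sub>\<sigma>" by (simp add: \<L>\<^sub>\<sigma>_def)
  then show "\<L>\<^sub>\<sigma> \<noteq> {}" by blast
qed (use assms in \<open>auto simp: \<L>\<^sub>\<sigma>_def\<close>)

lemma ell_bounds: "0 \<le> ell x y" "ell x y \<le> 1"
proof -
  show "0 \<le> ell x y" using ell_upper[of Obs x y] by simp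
  show "ell x y \<le> 1"
    by (rule ell_least) (use sem_state_regular in \<open>smt (verit)\<close>)
qed

lemma D_upper: "0 \<le> t \<Longrightarrow> c powr t * ell (\<omega> t) (\<omega>' t) \<le> D \<omega> \<omega>'"
  unfolding discounted_uniform_def
proof (rule cSUP_upper)
  show "bdd_above ((\<lambda>t. c powr t * ell (\<omega> t) (\<omega>' t)) ` {0..})"
    by (intro bdd_aboveI[of _ 1]) (auto intro!: mult_le_one simp: ell_bounds discount_bounds)
qed simp

lemma D_nonneg: "0 \<le> D \<omega> \<omega>'"
  using D_upper[of 0 \<omega> \<omega>'] ell_bounds(1)[of "\<omega> 0" "\<omega>' 0"] c by simp

lemma D_least: "(\<And>t. 0 \<le> t \<Longrightarrow> c powr t * ell (\<omega> t) (\<omega>' t) \<le> b) \<Longrightarrow> D \<omega> \<omega>' \<le> b"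
  unfolding discounted_uniform_def by (rule cSUP_least) auto

lemma D_le_1: "D \<omega> \<omega>' \<le> 1"
  by (rule D_least) (auto intro!: mult_le_one simp: ell_bounds discount_bounds)

section \<open>Countably many observables determining the discounted distance\<close>

definition observable :: "nat \<Rightarrow> path_form" where
  "observable = from_nat_into {Ev f q | f q. wf_state f \<and> 0 \<le> q}"

lemma range_observable: "range observable = {Ev f q | f q. wf_state f \<and> 0 \<le> q}"
  unfolding observable_def
proof (rule range_from_nat_into)
  have "Ev Obs 0 \<in> {Ev f q | f q. wf_state f \<and> 0 \<le> q}" by simp
  then show "{Ev f q | f q. wf_state f \<and> 0 \<le> q} \<noteq> {}" by blast
  have "{Ev f q | f q. wf_state f \<and> 0 \<le> q} \<subseteq> (\<lambda>(f, q). Ev f q) ` UNIV" by auto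
  then show "countable {Ev f q | f q. wf_state f \<and> 0 \<le> q}"
    by (rule countable_subset) (intro countable_image uncountable_def countableI_type)
qed

lemma observable_cases:
  obtains f q where "observable k = Ev f q" and "wf_state f" and "0 \<le> q"
  using rangeI[of observable k] unfolding range_observable by blast

lemma wf_observable: "wf_path (observable k)"
  by (rule observable_cases[of k]) simp

definition h :: "nat \<Rightarrow> (real \<Rightarrow> 'e) \<Rightarrow> real" where
  "h k = G (observable k)"

lemma h_measurable: "h k \<in> borel_measurable trajectory_space"
  and h_bounds: "0 \<le> h k \<omega> \<and> h k \<omega> \<le> 1"
  unfolding h_def using sem_path_regular[OF wf_observable] by blast+

lemma h_diff_le_D: "\<bar>h k \<omega> - h k \<omega>'\<bar> \<le> D \<omega> \<omega>'"
proof (rule observable_cases[of k])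
  fix f q assume k: "observable k = Ev f q" "wf_state f" "0 \<le> q"
  let ?t = "of_rat q :: real"
  have t: "0 \<le> ?t" using k by simp
  have "\<bar>h k \<omega> - h k \<omega>'\<bar> = c powr ?t * \<bar>S f (\<omega> ?t) - S f (\<omega>' ?t)\<bar>"
    using discount_bounds[OF t] by (simp add: h_def k right_diff_distrib[symmetric] abs_mult)
  also have "\<dots> \<le> c powr ?t * ell (\<omega> ?t) (\<omega>' ?t)"
    using discount_bounds[OF t] ell_upper[OF k(2)] by (intro mult_left_mono) auto
  also have "\<dots> \<le> D \<omega> \<omega>'" by (rule D_upper[OF t])
  finally show ?thesis .
qed

lemma maxdiff_le_D: "maxdiff h N \<omega> \<omega>' \<le> D \<omega> \<omega>'"
  by (rule maxdiff_le) (rule D_nonneg, rule h_diff_le_D)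

text \<open>With the formula fixed, its difference along two paths is continuous in time, and so is
  the discount, so the bound passes from rational to real times. The supremum over formulas is taken
  only afterwards, which avoids any continuity claim about \<open>ell\<close>.\<close>

lemma D_le_if_observables:
  assumes tr: "\<omega> \<in> trajectories" "\<omega>' \<in> trajectories"
    and b: "\<And>k. \<bar>h k \<omega> - h k \<omega>'\<bar> \<le> b"
  shows "D \<omega> \<omega>' \<le> b"
proof (rule D_least)
  fix t :: real assume t: "0 \<le> t"
  obtain s where s: "\<And>\<omega> :: real \<Rightarrow> 'e. \<omega> \<in> trajectories \<Longrightarrow> (\<lambda>n. \<omega> (rational_time (s n))) \<longlonglongrightarrow> \<omega> t"
    and st: "(\<lambda>n. rational_time (s n)) \<longlonglongrightarrow> t"
    using trajectory_rational_limit[OF t] by blast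
  have pos: "0 < c powr t" using c by simp
  have "ell (\<omega> t) (\<omega>' t) \<le> b / c powr t"
  proof (rule ell_least)
    fix f assume f: "wf_state f"
    have lim: "(\<lambda>n. S f (w (rational_time (s n)))) \<longlonglongrightarrow> S f (w t)" if "w \<in> trajectories" for w
      using sem_state_regular[OF f] s[OF that] by (auto intro: continuous_on_tendsto_compose)
    have "(\<lambda>n. c powr rational_time (s n) *
        \<bar>S f (\<omega> (rational_time (s n))) - S f (\<omega>' (rational_time (s n)))\<bar>) \<longlonglongrightarrow>
        c powr t * \<bar>S f (\<omega> t) - S f (\<omega>' t)\<bar>"
      by (intro tendsto_intros st lim tr) (use c in auto)
    moreover have "c powr rational_time i * \<bar>S f (\<omega> (rational_time i)) - S f (\<omega>' (rational_time i))\<bar> \<le> b" for i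
    proof -
      have "rational_time i \<in> \<rat>" "0 \<le> rational_time i" using range_rational_time by auto
      then obtain q where q: "rational_time i = of_rat q" "0 \<le> q"
        by (metis Rats_cases zero_le_of_rat_iff)
      then have "Ev f q \<in> range observable" using f by (auto simp: range_observable)
      then obtain k where k: "Ev f q = observable k" by blast
      have "0 \<le> c powr rational_time i" by simp
      then show ?thesis
        using b[of k] by (simp add: h_def k[symmetric] q right_diff_distrib[symmetric] abs_mult)
    qed
    ultimately have "c powr t * \<bar>S f (\<omega> t) - S f (\<omega>' t)\<bar> \<le> b"
      by (intro LIMSEQ_le_const2) auto
    then show "\<bar>S f (\<omega> t) - S f (\<omega>' t)\<bar> \<le> b / c powr t"
      using pos by (simp add: field_simps)
  qed
  then show "c powr t * ell (\<omega> t) (\<omega>' t) \<le> b" using pos by (simp add: field_simps)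
qed

lemma maxdiff_tendsto_D:
  assumes tr: "\<omega> \<in> trajectories" "\<omega>' \<in> trajectories"
  shows "(\<lambda>N. maxdiff h N \<omega> \<omega>') \<longlonglongrightarrow> D \<omega> \<omega>'"
proof -
  have "incseq (\<lambda>N. maxdiff h N \<omega> \<omega>')" by (rule incseq_SucI) (rule maxdiff_mono, simp)
  then obtain l where l: "(\<lambda>N. maxdiff h N \<omega> \<omega>') \<longlonglongrightarrow> l" "\<And>N. maxdiff h N \<omega> \<omega>' \<le> l"
    using incseq_convergent[of "\<lambda>N. maxdiff h N \<omega> \<omega>'" "D \<omega> \<omega>'"] maxdiff_le_D by blast
  have "\<bar>h k \<omega> - h k \<omega>'\<bar> \<le> l" for k
    using maxdiff_ge[of k "Suc k" h \<omega> \<omega>'] l(2)[of "Suc k"] by simp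
  then have "D \<omega> \<omega>' \<le> l" by (rule D_le_if_observables[OF tr])
  moreover have "l \<le> D \<omega> \<omega>'" using l(1) maxdiff_le_D by (intro LIMSEQ_le_const2) auto
  ultimately show ?thesis using l(1) by simp
qed

lemma coupling_facts:
  assumes "\<gamma> \<in> couplings (\<P> x) (\<P> y)"
  shows "prob_space \<gamma>" and "space \<gamma> = trajectories \<times> trajectories"
    and "sets \<gamma> = sets (trajectory_space \<Otimes>\<^sub>M trajectory_space)"
    and "distr \<gamma> (\<P> x) fst = \<P> x" and "distr \<gamma> (\<P> y) snd = \<P> y"
proof -
  show p: "prob_space \<gamma>" "distr \<gamma> (\<P> x) fst = \<P> x" "distr \<gamma> (\<P> y) snd = \<P> y"
    using assms by (auto simp: couplings_def)
  have "sets \<gamma> = sets (\<P> x \<Otimes>\<^sub>M \<P> y)" using assms by (auto simp: couplings_def)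
  then show s: "sets \<gamma> = sets (trajectory_space \<Otimes>\<^sub>M trajectory_space)"
    using sets_pair_measure_cong[OF sets_law sets_law] by simp
  show "space \<gamma> = trajectories \<times> trajectories"
    using sets_eq_imp_space_eq[OF s] by (simp add: space_pair_measure space_trajectory_space)
qed

lemma maxdiff_measurable: "(\<lambda>z. maxdiff h N (fst z) (snd z)) \<in> borel_measurable (trajectory_space \<Otimes>\<^sub>M trajectory_space)"
  by (rule borel_measurable_maxdiff[OF h_measurable measurable_fst measurable_snd])

text \<open>\<open>D\<close> is a supremum over uncountably many times, but on trajectories it is
  the limit of the measurable functions \<open>maxdiff h N\<close>.\<close>

lemma D_measurable: "(\<lambda>z. D (fst z) (snd z)) \<in> borel_measurable (trajectory_space \<Otimes>\<^sub>M trajectory_space)"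
proof (rule borel_measurable_LIMSEQ_real[OF _ maxdiff_measurable])
  fix z assume "z \<in> space (trajectory_space \<Otimes>\<^sub>M trajectory_space :: ((real \<Rightarrow> 'e) \<times> (real \<Rightarrow> 'e)) measure)"
  then show "(\<lambda>N. maxdiff h N (fst z) (snd z)) \<longlonglongrightarrow> D (fst z) (snd z)"
    by (intro maxdiff_tendsto_D) (auto simp: space_pair_measure space_trajectory_space)
qed

lemma integral_coupling_le:
  assumes \<gamma>: "\<gamma> \<in> couplings (\<P> x) (\<P> y)" and L: "\<And>N. (\<integral>(\<omega>, \<omega>'). maxdiff h N \<omega> \<omega>' \<partial>\<gamma>) \<le> L"
  shows "(\<integral>(\<omega>, \<omega>'). D \<omega> \<omega>' \<partial>\<gamma>) \<le> L"
proof -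
  note \<gamma>' = coupling_facts[OF \<gamma>]
  interpret prob_space \<gamma> by (rule \<gamma>'(1))
  have meas: "measurable \<gamma> N = measurable (trajectory_space \<Otimes>\<^sub>M trajectory_space) N" for N :: "real measure"
    by (rule measurable_cong_sets[OF \<gamma>'(3) refl])
  have "(\<lambda>N. \<integral>z. maxdiff h N (fst z) (snd z) \<partial>\<gamma>) \<longlonglongrightarrow> (\<integral>z. D (fst z) (snd z) \<partial>\<gamma>)"
  proof (rule integral_dominated_convergence[where w = "\<lambda>_. 1"])
    show "(\<lambda>z. D (fst z) (snd z)) \<in> borel_measurable \<gamma>" unfolding meas by (rule D_measurable)
    show "(\<lambda>z. maxdiff h N (fst z) (snd z)) \<in> borel_measurable \<gamma>" for N unfolding meas by (rule maxdiff_measurable)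
    show "AE z in \<gamma>. (\<lambda>N. maxdiff h N (fst z) (snd z)) \<longlonglongrightarrow> D (fst z) (snd z)"
      by (rule AE_I2) (auto simp: \<gamma>'(2) intro: maxdiff_tendsto_D)
    show "AE z in \<gamma>. norm (maxdiff h N (fst z) (snd z)) \<le> 1" for N
    proof (rule AE_I2)
      fix z
      show "norm (maxdiff h N (fst z) (snd z)) \<le> 1"
        using maxdiff_nonneg[of h N "fst z" "snd z"] maxdiff_le_D[of N "fst z" "snd z"] D_le_1[of "fst z" "snd z"]
        unfolding real_norm_def by linarith
    qed
  qed simp
  then have "(\<integral>z. D (fst z) (snd z) \<partial>\<gamma>) \<le> L"
    by (rule LIMSEQ_le_const2) (use L in \<open>auto simp: case_prod_unfold\<close>)
  then show ?thesis by (simp add: case_prod_unfold)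
qed

text \<open>\<open>True\<close> fills the slot for state formulas in the mutual induction.
  Evaluations are observables, and minima, maxima and truncated shifts do not enlarge
  differences.\<close>

lemma
  fixes f :: state_form
  shows True and path_lipschitz: "wf_path g \<Longrightarrow> \<bar>G g \<omega> - G g \<omega>'\<bar> \<le> D \<omega> \<omega>'"
proof (induction f and g)
  case (Ev f q)
  then have "Ev f q \<in> range observable" by (auto simp: range_observable)
  then obtain k where "Ev f q = observable k" by blast
  then show ?case using h_diff_le_D[of k \<omega> \<omega>'] by (simp add: h_def)
next
  case (PMin g1 g2)
  then show ?case by simp
next
  case (PMax g1 g2)
  then show ?case by simp
next
  case (Minus g q)
  then show ?case by simp
next
  case (Plus g q)
  then show ?case by simp
qed auto

lemma integ_diff_le:
  assumes \<gamma>: "\<gamma> \<in> couplings (\<P> x) (\<P> y)" and g: "wf_path g"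
  shows "\<bar>S (Integ g) x - S (Integ g) y\<bar> \<le> (\<integral>(\<omega>, \<omega>'). D \<omega> \<omega>' \<partial>\<gamma>)"
proof -
  note \<gamma>' = coupling_facts[OF \<gamma>]
  interpret prob_space \<gamma> by (rule \<gamma>'(1))
  have meas: "measurable \<gamma> N = measurable (trajectory_space \<Otimes>\<^sub>M trajectory_space) N" for N :: "'z measure"
    by (rule measurable_cong_sets[OF \<gamma>'(3) refl])
  have to: "measurable N (\<P> x) = measurable N trajectory_space" for N :: "'z measure" and x
    by (rule measurable_cong_sets[OF refl sets_law])
  have Gm: "G g \<in> borel_measurable trajectory_space" and Gb: "\<And>\<omega>. 0 \<le> G g \<omega> \<and> G g \<omega> \<le> 1"
    using sem_path_regular[OF g] by blast+
  have f: "fst \<in> \<gamma> \<rightarrow>\<^sub>M \<P> x" "snd \<in> \<gamma> \<rightarrow>\<^sub>M \<P> y" unfolding meas to by auto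
  have Gf: "(\<lambda>z. G g (fst z)) \<in> borel_measurable \<gamma>" "(\<lambda>z. G g (snd z)) \<in> borel_measurable \<gamma>"
    unfolding meas by (rule measurable_compose[OF measurable_fst Gm], rule measurable_compose[OF measurable_snd Gm])
  have int: "integrable \<gamma> (\<lambda>z. G g (fst z))" "integrable \<gamma> (\<lambda>z. G g (snd z))"
    by (rule integrable_const_bound[where B = 1]; use Gf Gb in auto)+
  have intD: "integrable \<gamma> (\<lambda>z. D (fst z) (snd z))"
    by (rule integrable_const_bound[where B = 1])
      (auto simp: abs_of_nonneg D_nonneg D_le_1 meas intro: D_measurable)
  have "S (Integ g) x = (\<integral>\<omega>. G g \<omega> \<partial>(distr \<gamma> (\<P> x) fst))" by (simp add: \<gamma>'(4))
  also have "\<dots> = (\<integral>z. G g (fst z) \<partial>\<gamma>)"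
    by (rule integral_distr[OF f(1)]) (simp add: measurable_law Gm)
  finally have x: "S (Integ g) x = (\<integral>z. G g (fst z) \<partial>\<gamma>)" .
  have "S (Integ g) y = (\<integral>\<omega>. G g \<omega> \<partial>(distr \<gamma> (\<P> y) snd))" by (simp add: \<gamma>'(5))
  also have "\<dots> = (\<integral>z. G g (snd z) \<partial>\<gamma>)"
    by (rule integral_distr[OF f(2)]) (simp add: measurable_law Gm)
  finally have y: "S (Integ g) y = (\<integral>z. G g (snd z) \<partial>\<gamma>)" .
  have "\<bar>S (Integ g) x - S (Integ g) y\<bar> = \<bar>\<integral>z. G g (fst z) - G g (snd z) \<partial>\<gamma>\<bar>"
    unfolding x y using int by simp
  also have "\<dots> \<le> (\<integral>z. \<bar>G g (fst z) - G g (snd z)\<bar> \<partial>\<gamma>)" by (rule integral_abs_bound)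
  also have "\<dots> \<le> (\<integral>z. D (fst z) (snd z) \<partial>\<gamma>)"
    using int intD by (intro integral_mono) (auto intro: path_lipschitz[OF g])
  finally show ?thesis by (simp add: case_prod_unfold)
qed

lemma obs_as_integral: "S (Integ (Ev Obs 0)) x = obs x"
proof -
  interpret prob_space "\<P> x" by (rule prob)
  have "(\<integral>\<omega>. obs (\<omega> 0) \<partial>(\<P> x)) = (\<integral>\<omega>. obs x \<partial>(\<P> x))"
  proof (rule integral_cong_AE)
    show "(\<lambda>\<omega>. obs (\<omega> 0)) \<in> borel_measurable (\<P> x)"
      using sem_path_regular(1)[of "Ev Obs 0"] c by (simp add: measurable_law)
    show "AE \<omega> in \<P> x. obs (\<omega> 0) = obs x" using start[of x] by eventually_elim simp
  qed simp
  then show ?thesis using c by (simp add: prob_space)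
qed

lemma ell_le_coupling:
  assumes \<gamma>: "\<gamma> \<in> couplings (\<P> x) (\<P> y)"
  shows "ell x y \<le> (\<integral>(\<omega>, \<omega>'). D \<omega> \<omega>' \<partial>\<gamma>)"
proof (rule ell_least)
  have nn: "0 \<le> (\<integral>(\<omega>, \<omega>'). D \<omega> \<omega>' \<partial>\<gamma>)"
    by (rule integral_nonneg_AE) (auto simp: D_nonneg)
  \<comment> \<open>Nothing is claimed for path formulas here, since \<open>integ_diff_le\<close>
    treats them as a whole. \<open>Compl\<close> leaves differences unchanged and constants have
    none.\<close>
  have "wf_state f \<Longrightarrow> \<bar>S f x - S f y\<bar> \<le> (\<integral>(\<omega>, \<omega>'). D \<omega> \<omega>' \<partial>\<gamma>)" and "wf_path g \<Longrightarrow> True" for f g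
  proof (induction f and g)
    case Obs
    show ?case using integ_diff_le[OF \<gamma>, of "Ev Obs 0"] unfolding obs_as_integral by simp
  next
    case (Integ g)
    then show ?case using integ_diff_le[OF \<gamma>, of g] by simp
  qed (use nn in auto)
  then show "\<bar>S f x - S f y\<bar> \<le> (\<integral>(\<omega>, \<omega>'). D \<omega> \<omega>' \<partial>\<gamma>)" if "wf_state f" for f using that by blast
qed

end

section \<open>Lipschitz functions as uniform limits of path formulas\<close>

lemma ex_rat_unit_interval_near:
  fixes a e :: real
  assumes "0 \<le> a" and "a \<le> 1" and "0 < e"
  shows "\<exists>q :: rat. 0 \<le> q \<and> q \<le> 1 \<and> \<bar>of_rat q - a\<bar> \<le> e"
proof (cases "a = 0")
  case True
  then show ?thesis using assms by (intro exI[of _ 0]) simp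
next
  case False
  then have "max 0 (a - e) < a" using assms by auto
  then obtain q :: rat where q: "max 0 (a - e) < of_rat q" "of_rat q < a" using of_rat_dense by blast
  then have "(0 :: real) \<le> of_rat q" "(of_rat q :: real) \<le> 1" using assms by linarith+
  then have "0 \<le> q" "q \<le> 1" by auto
  then show ?thesis using q by (intro exI[of _ q]) auto
qed

context diffusion_logic
begin

text \<open>The uniform closure of the path formulas on trajectories. Passing to it turns rational
  shifts into real ones, as needed to attain prescribed real values exactly.\<close>

definition approximable :: "((real \<Rightarrow> 'e) \<Rightarrow> real) set" where
  "approximable = {F. \<forall>e>0. \<exists>g. wf_path g \<and> (\<forall>\<omega>\<in>trajectories. \<bar>G g \<omega> - F \<omega>\<bar> \<le> e)}"

lemma approximableE:
  assumes "F \<in> approximable" and "0 < e"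
  obtains g where "wf_path g" and "\<And>\<omega>. \<omega> \<in> trajectories \<Longrightarrow> \<bar>G g \<omega> - F \<omega>\<bar> \<le> e"
  using assms unfolding approximable_def by blast

lemma approximable_path: "wf_path g \<Longrightarrow> G g \<in> approximable"
  unfolding approximable_def by (intro CollectI allI impI exI[of _ g]) auto

lemma approximable_min:
  assumes "F1 \<in> approximable" and "F2 \<in> approximable"
  shows "(\<lambda>\<omega>. min (F1 \<omega>) (F2 \<omega>)) \<in> approximable"
  unfolding approximable_def
proof (intro CollectI allI impI)
  fix e :: real assume e: "0 < e"
  obtain g1 g2 where g: "wf_path g1" "wf_path g2"
    "\<And>\<omega>. \<omega> \<in> trajectories \<Longrightarrow> \<bar>G g1 \<omega> - F1 \<omega>\<bar> \<le> e" "\<And>\<omega>. \<omega> \<in> trajectories \<Longrightarrow> \<bar>G g2 \<omega> - F2 \<omega>\<bar> \<le> e"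
    using approximableE[OF assms(1) e] approximableE[OF assms(2) e] by metis
  have "\<bar>G (PMin g1 g2) \<omega> - min (F1 \<omega>) (F2 \<omega>)\<bar> \<le> e" if "\<omega> \<in> trajectories" for \<omega>
    using g(3)[OF that] g(4)[OF that] unfolding sem_path.simps by linarith
  then show "\<exists>g. wf_path g \<and> (\<forall>\<omega>\<in>trajectories. \<bar>G g \<omega> - min (F1 \<omega>) (F2 \<omega>)\<bar> \<le> e)"
    using g by (intro exI[of _ "PMin g1 g2"]) simp
qed

lemma approximable_max:
  assumes "F1 \<in> approximable" and "F2 \<in> approximable"
  shows "(\<lambda>\<omega>. max (F1 \<omega>) (F2 \<omega>)) \<in> approximable"
  unfolding approximable_def
proof (intro CollectI allI impI)
  fix e :: real assume e: "0 < e"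
  obtain g1 g2 where g: "wf_path g1" "wf_path g2"
    "\<And>\<omega>. \<omega> \<in> trajectories \<Longrightarrow> \<bar>G g1 \<omega> - F1 \<omega>\<bar> \<le> e" "\<And>\<omega>. \<omega> \<in> trajectories \<Longrightarrow> \<bar>G g2 \<omega> - F2 \<omega>\<bar> \<le> e"
    using approximableE[OF assms(1) e] approximableE[OF assms(2) e] by metis
  have "\<bar>G (PMax g1 g2) \<omega> - max (F1 \<omega>) (F2 \<omega>)\<bar> \<le> e" if "\<omega> \<in> trajectories" for \<omega>
    using g(3)[OF that] g(4)[OF that] unfolding sem_path.simps by linarith
  then show "\<exists>g. wf_path g \<and> (\<forall>\<omega>\<in>trajectories. \<bar>G g \<omega> - max (F1 \<omega>) (F2 \<omega>)\<bar> \<le> e)"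
    using g by (intro exI[of _ "PMax g1 g2"]) simp
qed

lemma approximable_minus:
  assumes F: "F \<in> approximable" and a: "0 \<le> a" "a \<le> 1"
  shows "(\<lambda>\<omega>. max 0 (F \<omega> - a)) \<in> approximable"
  unfolding approximable_def
proof (intro CollectI allI impI)
  fix e :: real assume e: "0 < e"
  then have e2: "0 < e / 2" by simp
  obtain g where g: "wf_path g" "\<And>\<omega>. \<omega> \<in> trajectories \<Longrightarrow> \<bar>G g \<omega> - F \<omega>\<bar> \<le> e / 2"
    using approximableE[OF F e2] by metis
  obtain q :: rat where q: "0 \<le> q" "q \<le> 1" "\<bar>of_rat q - a\<bar> \<le> e / 2"
    using ex_rat_unit_interval_near[OF a e2] by blast
  have "\<bar>G (Minus g q) \<omega> - max 0 (F \<omega> - a)\<bar> \<le> e" if "\<omega> \<in> trajectories" for \<omega>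
    using g(2)[OF that] q(3) unfolding sem_path.simps by linarith
  then show "\<exists>g. wf_path g \<and> (\<forall>\<omega>\<in>trajectories. \<bar>G g \<omega> - max 0 (F \<omega> - a)\<bar> \<le> e)"
    using g q by (intro exI[of _ "Minus g q"]) simp
qed

lemma approximable_plus:
  assumes F: "F \<in> approximable" and a: "0 \<le> a" "a \<le> 1"
  shows "(\<lambda>\<omega>. min 1 (F \<omega> + a)) \<in> approximable"
  unfolding approximable_def
proof (intro CollectI allI impI)
  fix e :: real assume e: "0 < e"
  then have e2: "0 < e / 2" by simp
  obtain g where g: "wf_path g" "\<And>\<omega>. \<omega> \<in> trajectories \<Longrightarrow> \<bar>G g \<omega> - F \<omega>\<bar> \<le> e / 2"
    using approximableE[OF F e2] by metis
  obtain q :: rat where q: "0 \<le> q" "q \<le> 1" "\<bar>of_rat q - a\<bar> \<le> e / 2"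
    using ex_rat_unit_interval_near[OF a e2] by blast
  have "\<bar>G (Plus g q) \<omega> - min 1 (F \<omega> + a)\<bar> \<le> e" if "\<omega> \<in> trajectories" for \<omega>
    using g(2)[OF that] q(3) unfolding sem_path.simps by linarith
  then show "\<exists>g. wf_path g \<and> (\<forall>\<omega>\<in>trajectories. \<bar>G g \<omega> - min 1 (F \<omega> + a)\<bar> \<le> e)"
    using g q by (intro exI[of _ "Plus g q"]) simp
qed

lemma approximable_const:
  assumes "0 \<le> a" and "a \<le> 1"
  shows "(\<lambda>_. a) \<in> approximable"
proof -
  have "(\<lambda>\<omega>. min 1 (G (Ev (Const 0) 0) \<omega> + a)) \<in> approximable"
    by (rule approximable_plus[OF approximable_path]) (use assms in auto)
  then show ?thesis using assms by simp
qed

lemma approximable_closed: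
  assumes "\<And>e. 0 < e \<Longrightarrow> \<exists>H\<in>approximable. \<forall>\<omega>\<in>trajectories. \<bar>H \<omega> - F \<omega>\<bar> \<le> e"
  shows "F \<in> approximable"
  unfolding approximable_def
proof (intro CollectI allI impI)
  fix e :: real assume "0 < e"
  then have e2: "0 < e / 2" by simp
  obtain H where H: "H \<in> approximable" "\<And>\<omega>. \<omega> \<in> trajectories \<Longrightarrow> \<bar>H \<omega> - F \<omega>\<bar> \<le> e / 2"
    using assms[OF e2] by blast
  obtain g where g: "wf_path g" "\<And>\<omega>. \<omega> \<in> trajectories \<Longrightarrow> \<bar>G g \<omega> - H \<omega>\<bar> \<le> e / 2"
    using approximableE[OF H(1) e2] by metis
  have "\<bar>G g \<omega> - F \<omega>\<bar> \<le> e" if "\<omega> \<in> trajectories" for \<omega>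
    using g(2)[OF that] H(2)[OF that] by linarith
  then show "\<exists>g. wf_path g \<and> (\<forall>\<omega>\<in>trajectories. \<bar>G g \<omega> - F \<omega>\<bar> \<le> e)" using g(1) by blast
qed

text \<open>Path formulas have no complement, so an observable is reflected at the level of states:
  evaluating \<open>Compl f\<close> yields \<open>c powr of_rat q - h k\<close>, which reverses the
  sign of every difference.\<close>

lemma oriented_observable:
  "\<exists>u\<in>approximable. u \<omega> - u \<omega>' = \<bar>h k \<omega> - h k \<omega>'\<bar> \<and> (\<forall>w. 0 \<le> u w \<and> u w \<le> 1) \<and>
     (\<forall>w w'. \<bar>u w - u w'\<bar> = \<bar>h k w - h k w'\<bar>)"
proof (cases "h k \<omega>' \<le> h k \<omega>")
  case True
  have "h k \<in> approximable" unfolding h_def by (rule approximable_path[OF wf_observable])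
  then show ?thesis using True h_bounds by (intro bexI[of _ "h k"]) auto
next
  case False
  obtain f q where k: "observable k = Ev f q" "wf_state f" "0 \<le> q" by (rule observable_cases)
  let ?u = "G (Ev (Compl f) q)"
  have wf: "wf_path (Ev (Compl f) q)" using k by simp
  have u: "?u w = c powr of_rat q - h k w" for w by (simp add: h_def k algebra_simps)
  show ?thesis
  proof (intro bexI[of _ ?u] conjI allI)
    show "?u \<in> approximable" by (rule approximable_path[OF wf])
    show "0 \<le> ?u w" "?u w \<le> 1" for w using sem_path_regular[OF wf] by blast+
    show "?u \<omega> - ?u \<omega>' = \<bar>h k \<omega> - h k \<omega>'\<bar>" unfolding u using False by linarith
    show "\<bar>?u w - ?u w'\<bar> = \<bar>h k w - h k w'\<bar>" for w w' unfolding u by linarith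
  qed
qed

lemma two_point_interpolation:
  assumes ab: "0 \<le> b" "b \<le> a" "a \<le> 1" and le: "a - b \<le> maxdiff h N \<omega> \<omega>'"
  shows "\<exists>H\<in>approximable. H \<omega> = a \<and> H \<omega>' = b \<and> (\<forall>w w'. \<bar>H w - H w'\<bar> \<le> maxdiff h N w w')"
proof (cases "a = b")
  case True
  then show ?thesis using ab by (intro bexI[of _ "\<lambda>_. a"] approximable_const) (auto simp: maxdiff_nonneg)
next
  case False
  then have "maxdiff h N \<omega> \<omega>' \<noteq> 0" using ab le by linarith
  then obtain k where k: "k < N" "maxdiff h N \<omega> \<omega>' = \<bar>h k \<omega> - h k \<omega>'\<bar>"
    using maxdiff_attained[of h N \<omega> \<omega>'] by blast
  obtain u where u: "u \<in> approximable" "u \<omega> - u \<omega>' = \<bar>h k \<omega> - h k \<omega>'\<bar>"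
    "\<And>w. 0 \<le> u w \<and> u w \<le> 1" "\<And>w w'. \<bar>u w - u w'\<bar> = \<bar>h k w - h k w'\<bar>"
    using oriented_observable[of \<omega> \<omega>' k] by blast
  \<comment> \<open>Shift \<open>u\<close> to vanish at \<open>\<omega>'\<close>, cut at height
    \<open>a - b\<close>, raise by \<open>b\<close>. At \<open>\<omega>\<close> the shifted value is
    at least \<open>a - b\<close>, so the cut gives exactly \<open>a\<close>. The outer
    \<open>min 1\<close> is inactive since \<open>a \<le> 1\<close>; it only matches the form of
    \<open>Plus\<close>. Every operation is a contraction.\<close>
  define H where "H w = min 1 (min (max 0 (u w - u \<omega>')) (a - b) + b)" for w
  have "H \<in> approximable"
    unfolding H_def
    by (intro approximable_plus approximable_min approximable_minus approximable_const u(1)) (use ab u(3)[of \<omega>'] in auto)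
  moreover have "H \<omega> = a" "H \<omega>' = b" using ab le k u(2) by (auto simp: H_def)
  moreover have "\<bar>H w - H w'\<bar> \<le> maxdiff h N w w'" for w w'
  proof -
    have 1: "\<bar>max 0 (s - r) - max 0 (t - r)\<bar> \<le> \<bar>s - t\<bar>" for r s t :: real by linarith
    have 2: "\<bar>min s r - min t r\<bar> \<le> \<bar>s - t\<bar>" for r s t :: real by linarith
    have 3: "\<bar>min 1 (s + r) - min 1 (t + r)\<bar> \<le> \<bar>s - t\<bar>" for r s t :: real by linarith
    have "\<bar>H w - H w'\<bar> \<le> \<bar>u w - u w'\<bar>"
      unfolding H_def by (rule order_trans[OF 3 order_trans[OF 2 1]])
    also have "\<dots> \<le> maxdiff h N w w'" using u(4)[of w w'] maxdiff_ge[OF k(1), of h w w'] by linarith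
    finally show ?thesis .
  qed
  ultimately show ?thesis by blast
qed

text \<open>The bit code supplies the finite net. \<open>lattice_approximation\<close> doubles its
  radius, hence \<open>e / 2\<close>.\<close>

lemma lipschitz_approximable:
  assumes F01: "\<And>\<omega>. \<omega> \<in> trajectories \<Longrightarrow> 0 \<le> F \<omega> \<and> F \<omega> \<le> 1"
    and F: "\<And>\<omega> \<omega>'. \<omega> \<in> trajectories \<Longrightarrow> \<omega>' \<in> trajectories \<Longrightarrow> \<bar>F \<omega> - F \<omega>'\<bar> \<le> maxdiff h N \<omega> \<omega>'"
  shows "F \<in> approximable"
proof (rule approximable_closed)
  fix e :: real assume "0 < e"
  then have e2: "0 < e / 2" by simp
  obtain A R where "bit_coded (trajectory_space :: (real \<Rightarrow> 'e) measure) A R h" by (rule bit_coded_trajectories[OF h_measurable h_bounds])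
  then interpret bc: bit_coded "trajectory_space :: (real \<Rightarrow> 'e) measure" A R h .
  obtain S where S: "finite S" "S \<subseteq> trajectories" "\<And>x. x \<in> trajectories \<Longrightarrow> \<exists>s\<in>S. maxdiff h N x s \<le> e / 2"
    using bc.finite_net[OF e2, of N] unfolding space_trajectory_space by blast
  have Sne: "S \<noteq> {}" using S(3)[OF some_path] by blast
  have "\<exists>H\<in>approximable. \<forall>x\<in>trajectories. \<bar>H x - F x\<bar> \<le> 2 * (e / 2)"
  proof (rule lattice_approximation[where D = "maxdiff h N" and S = S])
    fix x y :: "real \<Rightarrow> 'e" assume xy: "x \<in> trajectories" "y \<in> trajectories"
    show "\<exists>g\<in>approximable. g x = F x \<and> g y = F y \<and> (\<forall>w w'. \<bar>g w - g w'\<bar> \<le> maxdiff h N w w')"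
    proof (cases "F y \<le> F x")
      case True
      have "F x - F y \<le> maxdiff h N x y" using F[OF xy] by linarith
      then show ?thesis using two_point_interpolation[of "F y" "F x" N x y] True F01[OF xy(1)] F01[OF xy(2)] by blast
    next
      case False
      have "F y - F x \<le> maxdiff h N y x" using F[OF xy(2,1)] by linarith
      then show ?thesis
        using two_point_interpolation[of "F x" "F y" N y x] False F01[OF xy(1)] F01[OF xy(2)]
        by (metis linear)
    qed
  qed (use S Sne F approximable_min approximable_max in auto)
  then show "\<exists>H\<in>approximable. \<forall>\<omega>\<in>trajectories. \<bar>H \<omega> - F \<omega>\<bar> \<le> e" by simp
qed

text \<open>Path formulas take values in [0,1] only. As \<open>maxdiff h N\<close> is at most 1,
  \<open>F\<close> oscillates by at most 1, so subtracting its infimum \<open>m\<close> brings it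
  into that range. Both laws have mass 1, so \<open>m\<close> cancels in the difference. This is the
  dual bound that \<open>optimal_coupling_exists\<close> requires.\<close>

lemma lipschitz_integral_diff:
  assumes Fm: "F \<in> borel_measurable trajectory_space"
    and F: "\<And>\<omega> \<omega>'. \<omega> \<in> trajectories \<Longrightarrow> \<omega>' \<in> trajectories \<Longrightarrow> \<bar>F \<omega> - F \<omega>'\<bar> \<le> maxdiff h N \<omega> \<omega>'"
  shows "(\<integral>\<omega>. F \<omega> \<partial>(\<P> x)) - (\<integral>\<omega>. F \<omega> \<partial>(\<P> y)) \<le> ell x y"
proof (rule field_le_epsilon)
  fix e :: real assume "0 < e"
  then have e2: "0 < e / 2" by simp
  interpret X: prob_space "\<P> x" by (rule prob)
  interpret Y: prob_space "\<P> y" by (rule prob)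
  have F1: "\<bar>F \<omega> - F \<omega>'\<bar> \<le> 1" if "\<omega> \<in> trajectories" "\<omega>' \<in> trajectories" for \<omega> \<omega>'
    using F[OF that] maxdiff_le_D[of N \<omega> \<omega>'] D_le_1[of \<omega> \<omega>'] by linarith
  define m where "m = (INF \<omega>\<in>trajectories. F \<omega>)"
  have bdd: "bdd_below (F ` trajectories)"
  proof (rule bdd_belowI2)
    show "F some_path - 1 \<le> F \<omega>" if "\<omega> \<in> trajectories" for \<omega> using F1[OF some_path that] by linarith
  qed
  define F' where "F' \<omega> = F \<omega> - m" for \<omega>
  have "0 \<le> F' \<omega> \<and> F' \<omega> \<le> 1" if \<omega>: "\<omega> \<in> trajectories" for \<omega>
  proof -
    have "m \<le> F \<omega>" unfolding m_def by (rule cINF_lower[OF bdd \<omega>])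
    moreover have "F \<omega> - 1 \<le> m"
      unfolding m_def
    proof (rule cINF_greatest)
      show "(trajectories :: (real \<Rightarrow> 'e) set) \<noteq> {}" using \<omega> by blast
      show "F \<omega> - 1 \<le> F \<omega>'" if "\<omega>' \<in> trajectories" for \<omega>' using F1[OF \<omega> that] by linarith
    qed
    ultimately show ?thesis by (simp add: F'_def)
  qed
  then have "F' \<in> approximable"
    by (rule lipschitz_approximable[where N = N]) (use F in \<open>auto simp: F'_def\<close>)
  then obtain g where g: "wf_path g" "\<And>\<omega>. \<omega> \<in> trajectories \<Longrightarrow> \<bar>G g \<omega> - F' \<omega>\<bar> \<le> e / 2"
    using approximableE[OF _ e2] by metis
  have Gm: "G g \<in> borel_measurable trajectory_space" and Gb: "\<And>\<omega>. 0 \<le> G g \<omega> \<and> G g \<omega> \<le> 1"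
    using sem_path_regular[OF g(1)] by blast+
  have Gi: "integrable (\<P> w) (G g)" for w
    by (rule integrable_law[OF Gm, where B = 1]) (use Gb in auto)
  have Fi: "integrable (\<P> w) F" for w
  proof (rule integrable_law[OF Fm])
    show "\<bar>F \<omega>\<bar> \<le> \<bar>F some_path\<bar> + 1" if "\<omega> \<in> trajectories" for \<omega> using F1[OF some_path that] by linarith
  qed
  have "(\<integral>\<omega>. F \<omega> \<partial>(\<P> x)) \<le> (\<integral>\<omega>. G g \<omega> + (m + e / 2) \<partial>(\<P> x))"
  proof (rule integral_mono)
    fix \<omega> assume "\<omega> \<in> space (\<P> x)"
    then have "\<bar>G g \<omega> - F' \<omega>\<bar> \<le> e / 2" using g(2) by (simp add: space_law)
    then show "F \<omega> \<le> G g \<omega> + (m + e / 2)" unfolding F'_def by linarith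
  qed (use Fi Gi in auto)
  also have "\<dots> = S (Integ g) x + (m + e / 2)" using Gi by (simp add: X.prob_space)
  finally have 1: "(\<integral>\<omega>. F \<omega> \<partial>(\<P> x)) \<le> S (Integ g) x + (m + e / 2)" .
  have "S (Integ g) y + (m - e / 2) = (\<integral>\<omega>. G g \<omega> + (m - e / 2) \<partial>(\<P> y))"
    using Gi by (simp add: Y.prob_space)
  also have "\<dots> \<le> (\<integral>\<omega>. F \<omega> \<partial>(\<P> y))"
  proof (rule integral_mono)
    fix \<omega> assume "\<omega> \<in> space (\<P> y)"
    then have "\<bar>G g \<omega> - F' \<omega>\<bar> \<le> e / 2" using g(2) by (simp add: space_law)
    then show "G g \<omega> + (m - e / 2) \<le> F \<omega>" unfolding F'_def by linarith
  qed (use Fi Gi in auto)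
  finally have 2: "S (Integ g) y + (m - e / 2) \<le> (\<integral>\<omega>. F \<omega> \<partial>(\<P> y))" .
  have "S (Integ g) x - S (Integ g) y \<le> ell x y"
    using ell_upper[of "Integ g" x y] g(1) by simp
  then show "(\<integral>\<omega>. F \<omega> \<partial>(\<P> x)) - (\<integral>\<omega>. F \<omega> \<partial>(\<P> y)) \<le> ell x y + e" using 1 2 by linarith
qed

text \<open>The lower bound valid for every coupling also keeps the infimum bounded below; the
  coupling constructed for the upper bound shows that it ranges over a nonempty set.\<close>

theorem ell_fixpoint: "ell = \<G> \<P> c ell"
proof (intro ext)
  fix x y
  obtain A R where "bit_coded (trajectory_space :: (real \<Rightarrow> 'e) measure) A R h" by (rule bit_coded_trajectories[OF h_measurable h_bounds])
  then interpret bc: bit_coded "trajectory_space :: (real \<Rightarrow> 'e) measure" A R h .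
  have "\<exists>\<gamma>\<in>couplings (\<P> x) (\<P> y). \<forall>N. (\<integral>(\<omega>, \<omega>'). maxdiff h N \<omega> \<omega>' \<partial>\<gamma>) \<le> ell x y"
    by (rule bc.optimal_coupling_exists[OF prob sets_law prob sets_law lipschitz_integral_diff])
      (auto simp: space_trajectory_space)
  then obtain \<gamma> where \<gamma>: "\<gamma> \<in> couplings (\<P> x) (\<P> y)"
    "\<And>N. (\<integral>(\<omega>, \<omega>'). maxdiff h N \<omega> \<omega>' \<partial>\<gamma>) \<le> ell x y" by blast
  have lower: "ell x y \<le> (\<integral>(\<omega>, \<omega>'). D \<omega> \<omega>' \<partial>\<gamma>')" if "\<gamma>' \<in> couplings (\<P> x) (\<P> y)" for \<gamma>'
    by (rule ell_le_coupling[OF that])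
  show "ell x y = \<G> \<P> c ell x y"
    unfolding \<G>_def transport_cost_def
  proof (rule antisym)
    show "ell x y \<le> (INF \<gamma>\<in>couplings (\<P> x) (\<P> y). \<integral>(\<omega>, \<omega>'). D \<omega> \<omega>' \<partial>\<gamma>)"
      by (rule cINF_greatest) (use \<gamma>(1) lower in auto)
    have "(INF \<gamma>\<in>couplings (\<P> x) (\<P> y). \<integral>(\<omega>, \<omega>'). D \<omega> \<omega>' \<partial>\<gamma>) \<le> (\<integral>(\<omega>, \<omega>'). D \<omega> \<omega>' \<partial>\<gamma>)"
      by (rule cINF_lower[OF _ \<gamma>(1)]) (use lower in \<open>auto intro!: bdd_belowI2\<close>)
    also have "\<dots> \<le> ell x y" by (rule integral_coupling_le[OF \<gamma>])
    finally show "(INF \<gamma>\<in>couplings (\<P> x) (\<P> y). \<integral>(\<omega>, \<omega>'). D \<omega> \<omega>' \<partial>\<gamma>) \<le> ell x y" .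
  qed
qed

end

theorem theorem5p5:
  fixes \<Delta> :: "'e::{t2_space, second_countable_topology} \<Rightarrow> 'e \<Rightarrow> real"
    and T :: "real \<Rightarrow> ('e \<Rightarrow> real) \<Rightarrow> ('e \<Rightarrow> real)"
    and P :: "real \<Rightarrow> 'e \<Rightarrow> 'e measure"
    and \<P> :: "'e \<Rightarrow> (real \<Rightarrow> 'e) measure"
    and obs :: "'e \<Rightarrow> real"
    and c :: real
  assumes "locally_compact_space (euclidean :: 'e topology)"
    and "Metric_space UNIV \<Delta>"
    and "Metric_space.mtopology UNIV \<Delta> = euclidean"
    and "\<forall>x y. \<Delta> x y \<le> 1"
    and "feller_dynkin_semigroup T"
    and "associated_kernels T P"
    and "honest P"
    and "\<forall>x. law_from P x (\<P> x)"
    and "weakly_continuous \<Delta> \<P>"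
    and "continuous_on UNIV obs"
    and "\<forall>x. 0 \<le> obs x \<and> obs x \<le> 1"
    and "0 < c" and "c < 1"
  shows "logic_dist obs \<P> c = \<G> \<P> c (logic_dist obs \<P> c)"
proof -
  interpret M: Metric_space "UNIV :: 'e set" \<Delta> by (rule assms(2))
  interpret lc_state_space \<Delta>
    using assms(1,3,4) by unfold_locales auto
  interpret diffusion_logic \<Delta> \<P> obs c
  proof (intro diffusion_logic.intro diffusion_logic_axioms.intro)
    show "lc_state_space \<Delta>" by (rule lc_state_space_axioms)
    fix x
    have law: "law_from P x (\<P> x)" using assms(8) by blast
    then show "prob_space (\<P> x)" "sets (\<P> x) = sets trajectory_space" by (auto simp: law_from_def)
    show "AE \<omega> in \<P> x. \<omega> 0 = x" by (rule start_law[OF assms(5-7) law])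
  qed (use assms in auto)
  show ?thesis by (rule ell_fixpoint)
qed

end
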